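(* Let $1<p<\infty$, $\frac1p+\frac1{p'}=1$, and $X_p,Y_p\in\{H(\infty,p),H^p,D^p_{p-1},HL(p)\}$. For each radial weight $\nu$ such that $Q:L^p_{[0,1)}\to Y_p$ is bounded, where $Q\in\{H_\nu,\widetilde{H_\nu}\}$, there is a radial weight $\omega$ such that $$\widehat{\omega}(t)\asymp\widehat{\nu}(t),\quad t\in[0,1),$$ $\omega\in L^{p'}_{[0,r_0]}$ for any $r_0\in(0,1)$, $T:X_p\to Y_p$ is bounded, and $T:L^p_{[0,1)}\to Y_p$ is not bounded, where $T\in\{H_\omega,\widetilde{H_\omega}\}$.
   Context: $\mathbb{D}$ is the open unit disc of $\mathbb{C}$, $\mathcal{H}(\mathbb{D})$ the space of analytic functions on $\mathbb{D}$, $dA=\frac{dx\,dy}{\pi}$. $L^p_{[0,1)}$ is the Lebesgue space of measurable functions on $[0,1)$ with $\|f\|^p=\int_0^1|f(t)|^p\,dt<\infty$; $L^{p'}_{[0,r_0]}$ is the analogous space on $[0,r_0]$. $a\asymp b$ means $C^{-1}a\le b\le Ca$ for a constant $C>0$ (here independent of $t$). Radial weights: a radial weight is a nonnegative $\omega\in L^1([0,1))$, extended to $\mathbb{D}$ by $\omega(z)=\omega(|z|)$; standing assumption: $\widehat{\omega}(r)=\int_r^1\omega(s)\,ds>0$ for all $0\le r<1$. Moments: $\omega_x=\int_0^1 r^x\omega(r)\,dr$, $x\ge0$. Operators (for any radial weight $\omega$): $B^\omega_z(\zeta)=\sum_{n\ge0}\frac{(\overline{z}\zeta)^n}{2\omega_{2n+1}}$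 is the reproducing kernel of the Bergman space $A^2_\omega=\{f\in\mathcal{H}(\mathbb{D}):\int_{\mathbb{D}}|f|^2\omega\,dA<\infty\}$, and $$H_\omega(f)(z)=\int_0^1 f(t)\left(\frac1z\int_0^zB^\omega_t(\zeta)\,d\zeta\right)\omega(t)\,dt,\qquad \widetilde{H_\omega}(f)(z)=\int_0^1|f(t)|\left(\frac1z\int_0^zB^\omega_t(\zeta)\,d\zeta\right)\omega(t)\,dt.$$ $T:X\to Y$ is bounded if $T(f)$ is well defined and belongs to $Y$ for every $f\in X$, and $\sup_{\|f\|_X\le1}\|T(f)\|_Y<\infty$. Spaces (of $f(z)=\sum_{n\ge 0}\widehat f(n)z^n\in\mathcal{H}(\mathbb{D})$ with finite norm), where $M_p(r,f)=\left(\frac1{2\pi}\int_0^{2\pi}|f(re^{i\theta})|^pd\theta\right)^{1/p}$ and $M_\infty(r,f)=\max_\theta|f(re^{i\theta})|$: $H^p$: $\|f\|_{H^p}=\sup_{0<r<1}M_p(r,f)$; $D^p_{p-1}$: $\|f\|^p=|f(0)|^p+\int_{\mathbb{D}}|f'(z)|^p(1-|z|)^{p-1}dA(z)$; $HL(p)$: $\|f\|^p=\sum_{n\ge0}|\widehat f(n)|^p(n+1)^{p-2}$; $H(\infty,p)$: $\|f\|^p=\int_0^1M_\infty^p(r,f)\,dr$. *)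

theory Defs
  imports "HOL-Complex_Analysis.Complex_Analysis"
begin

(* All integrals are taken over the Lebesgue (completed) measure, so that "measurable" means
   Lebesgue measurable. The spaces are described by extended norms, valued in ennreal; a function
   belongs to the space iff it has the required regularity and its extended norm is finite. *)

(* Positive powers of extended nonnegative reals; only meant for a > 0. *)
definition enn_powr :: "ennreal \<Rightarrow> real \<Rightarrow> ennreal" where
  "enn_powr x a = (if x = top then top else ennreal (enn2real x powr a))"

definition Lp_norm :: "real \<Rightarrow> real set \<Rightarrow> (real \<Rightarrow> 'a::real_normed_vector) \<Rightarrow> ennreal" where
  "Lp_norm p S f = enn_powr (\<integral>\<^sup>+ t\<in>S. ennreal (norm (f t) powr p) \<partial>lebesgue) (1 / p)"

definition Lp_space :: "real \<Rightarrow> real set \<Rightarrow> (real \<Rightarrow> 'a::real_normed_vector) set" where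
  "Lp_space p S = {f. set_borel_measurable lebesgue S f \<and> Lp_norm p S f < top}"

definition weight_tail :: "(real \<Rightarrow> real) \<Rightarrow> real \<Rightarrow> real" where
  "weight_tail \<omega> r = (LINT s:{r..<1}|lebesgue. \<omega> s)"

definition radial_weight :: "(real \<Rightarrow> real) \<Rightarrow> bool" where
  "radial_weight \<omega> \<longleftrightarrow>
     (\<forall>r\<in>{0..<1}. 0 \<le> \<omega> r) \<and>
     set_integrable lebesgue {0..<1} \<omega> \<and>
     (\<forall>r\<in>{0..<1}. 0 < weight_tail \<omega> r)"

definition moment :: "(real \<Rightarrow> real) \<Rightarrow> real \<Rightarrow> real" where
  "moment \<omega> x = (LINT r:{0..<1}|lebesgue. r powr x * \<omega> r)"

definition bergman_kernel :: "(real \<Rightarrow> real) \<Rightarrow> complex \<Rightarrow> complex \<Rightarrow> complex" where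
  "bergman_kernel \<omega> z \<zeta> =
     (\<Sum>n. (cnj z * \<zeta>) ^ n / of_real (2 * moment \<omega> (real (2 * n + 1))))"

(* The mean of the kernel over the segment from 0 to z; at z = 0 the removable singularity
   is filled in. *)
definition hilbert_kernel :: "(real \<Rightarrow> real) \<Rightarrow> real \<Rightarrow> complex \<Rightarrow> complex" where
  "hilbert_kernel \<omega> t z =
     (if z = 0 then bergman_kernel \<omega> (of_real t) 0
      else 1 / z * contour_integral (linepath 0 z) (bergman_kernel \<omega> (of_real t)))"

(* The operators are partial: the value is None unless the defining integral converges absolutely
   at every point of the disc. *)
definition H_op :: "(real \<Rightarrow> real) \<Rightarrow> (real \<Rightarrow> complex) \<Rightarrow> (complex \<Rightarrow> complex) option" where
  "H_op \<omega> f =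
     (if \<forall>z\<in>ball 0 1. set_integrable lebesgue {0..<1}
           (\<lambda>t. f t * hilbert_kernel \<omega> t z * of_real (\<omega> t))
      then Some (\<lambda>z. LINT t:{0..<1}|lebesgue. f t * hilbert_kernel \<omega> t z * of_real (\<omega> t))
      else None)"

definition H_tilde_op :: "(real \<Rightarrow> real) \<Rightarrow> (real \<Rightarrow> complex) \<Rightarrow> (complex \<Rightarrow> complex) option" where
  "H_tilde_op \<omega> f =
     (if \<forall>z\<in>ball 0 1. set_integrable lebesgue {0..<1}
           (\<lambda>t. of_real (norm (f t)) * hilbert_kernel \<omega> t z * of_real (\<omega> t))
      then Some (\<lambda>z. LINT t:{0..<1}|lebesgue.
                       of_real (norm (f t)) * hilbert_kernel \<omega> t z * of_real (\<omega> t))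
      else None)"

definition integral_mean :: "real \<Rightarrow> real \<Rightarrow> (complex \<Rightarrow> complex) \<Rightarrow> real" where
  "integral_mean p r f =
     (1 / (2 * pi) * (LINT \<theta>:{0..2 * pi}|lebesgue. norm (f (of_real r * cis \<theta>)) powr p)) powr (1 / p)"

definition max_modulus :: "real \<Rightarrow> (complex \<Rightarrow> complex) \<Rightarrow> real" where
  "max_modulus r f = (SUP \<theta>\<in>{0..2 * pi}. norm (f (of_real r * cis \<theta>)))"

definition taylor_coeff :: "(complex \<Rightarrow> complex) \<Rightarrow> nat \<Rightarrow> complex" where
  "taylor_coeff f n = (deriv ^^ n) f 0 / fact n"

definition Hardy_norm :: "real \<Rightarrow> (complex \<Rightarrow> complex) \<Rightarrow> ennreal" where
  "Hardy_norm p f = (SUP r\<in>{0<..<1}. ennreal (integral_mean p r f))"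

(* The factor 1 / pi comes from the normalised area measure dA = dx dy / pi. *)
definition Dirichlet_norm :: "real \<Rightarrow> (complex \<Rightarrow> complex) \<Rightarrow> ennreal" where
  "Dirichlet_norm p f =
     enn_powr (ennreal (norm (f 0) powr p) +
       ennreal (1 / pi) * (\<integral>\<^sup>+ z\<in>ball 0 1. ennreal (norm (deriv f z) powr p * (1 - norm z) powr (p - 1)) \<partial>lebesgue))
     (1 / p)"

definition HL_norm :: "real \<Rightarrow> (complex \<Rightarrow> complex) \<Rightarrow> ennreal" where
  "HL_norm p f =
     enn_powr (\<Sum>n. ennreal (norm (taylor_coeff f n) powr p * (real n + 1) powr (p - 2))) (1 / p)"

definition H_inf_norm :: "real \<Rightarrow> (complex \<Rightarrow> complex) \<Rightarrow> ennreal" where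
  "H_inf_norm p f =
     enn_powr (\<integral>\<^sup>+ r\<in>{0..<1}. ennreal (max_modulus r f powr p) \<partial>lebesgue) (1 / p)"

definition analytic_space :: "((complex \<Rightarrow> complex) \<Rightarrow> ennreal) \<Rightarrow> (complex \<Rightarrow> complex) set" where
  "analytic_space N = {f. f holomorphic_on ball 0 1 \<and> N f < top}"

(* Boundedness of a partial operator T from the space X with norm NX into the space of analytic
   functions with extended norm NY. *)
definition bounded_op ::
  "'f set \<Rightarrow> ('f \<Rightarrow> ennreal) \<Rightarrow> ('f \<Rightarrow> (complex \<Rightarrow> complex) option) \<Rightarrow>
   ((complex \<Rightarrow> complex) \<Rightarrow> ennreal) \<Rightarrow> bool" where
  "bounded_op X NX T NY \<longleftrightarrow>
     (\<forall>f\<in>X. \<exists>g\<in>analytic_space NY. T f = Some g) \<and>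
     (SUP f\<in>{f\<in>X. NX f \<le> 1}. NY (the (T f))) < top"

definition bounded_from_Lp ::
  "real \<Rightarrow> ((real \<Rightarrow> complex) \<Rightarrow> (complex \<Rightarrow> complex) option) \<Rightarrow>
   ((complex \<Rightarrow> complex) \<Rightarrow> ennreal) \<Rightarrow> bool" where
  "bounded_from_Lp p T NY \<longleftrightarrow> bounded_op (Lp_space p {0..<1}) (Lp_norm p {0..<1}) T NY"

(* An analytic function on the disc is fed to the operator through its restriction to [0,1). *)
definition bounded_from_analytic ::
  "((complex \<Rightarrow> complex) \<Rightarrow> ennreal) \<Rightarrow>
   ((real \<Rightarrow> complex) \<Rightarrow> (complex \<Rightarrow> complex) option) \<Rightarrow>
   ((complex \<Rightarrow> complex) \<Rightarrow> ennreal) \<Rightarrow> bool" where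
  "bounded_from_analytic NX T NY \<longleftrightarrow>
     bounded_op (analytic_space NX) NX (\<lambda>f. T (\<lambda>t. f (of_real t))) NY"

definition asymp_equiv_on :: "real set \<Rightarrow> (real \<Rightarrow> real) \<Rightarrow> (real \<Rightarrow> real) \<Rightarrow> bool" where
  "asymp_equiv_on S a b \<longleftrightarrow> (\<exists>C>0. \<forall>t\<in>S. inverse C * b t \<le> a t \<and> a t \<le> C * b t)"

end

theory Submission
  imports Defs
begin

text \<open>
  If \<open>Q\<close> is bounded on \<open>L^p\<close>, then \<open>\<nu>\<close> lies in \<open>L^q\<close>, with \<open>q = p'\<close> the conjugate exponent, because
  the value of \<open>Q f\<close> at \<open>0\<close> is a constant times the integral of \<open>f \<nu>\<close>. Put \<open>\<omega> = \<nu> + \<eta>\<close>, where \<open>\<eta>\<close> is a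
  train of ever higher and thinner spikes accumulating at \<open>1\<close>. The heights can be chosen so that \<open>\<eta>\<close> is not in
  \<open>L^q\<close>, so that the operators of \<open>\<omega>\<close> are not even defined on all of \<open>L^p\<close>, while the masses can be taken
  as small as we please: since the moments of \<open>\<nu>\<close> decay subexponentially, the \<open>n\<close>-th moment of
  \<open>\<eta>(t) / (1 - t)^2\<close> can be kept below \<open>(n + 1)^{-3} min(\<nu>_{2n+1}, \<nu>_{2n+1}^2)\<close>.

  For \<open>f\<close> in one of the four spaces, the restriction of \<open>f\<close> to the radius is in \<open>L^p\<close> (a Fejer--Riesz type
  inequality) and is \<open>O((1 - t)^{-2})\<close>. Hence \<open>H_\<omega> f\<close> differs from \<open>H_\<nu> f\<close>, which is controlled by
  assumption, by a power series with coefficients \<open>O((n + 1)^{-3})\<close>, which belongs to all four spaces. The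
  three nontrivial Fejer--Riesz type inequalities are reduced to Hilbert's inequality for the kernel \<open>1 / (x + y)\<close>.
\<close>

subsection \<open>Hilbert's inequality\<close>

text \<open>Two features shape the statements. For analytic \<open>f\<close>, the operator
  \<open>H_tilde_op\<close> sees \<open>|f|\<close>, which is not analytic. So everything about the
  new weight is proved for arbitrary measurable \<open>g\<close> on \<open>[0,1)\<close> of which
  only the size is known: an \<open>L^p\<close> bound and the growth \<open>(1 - t)^(-2)\<close>.
  Moreover \<open>Q\<close> and \<open>T\<close> may be different operators. Boundedness of the
  sublinear one speaks about nonnegative functions only, and a splitting into four nonnegative parts
  extends it to all \<open>g\<close>.

  The square in the bound on the spikes is due to the kernel, which changes together with the
  weight: its coefficients contain the reciprocals of the moments. A difference of two such
  reciprocals has a product of two moments in the denominator, and it multiplies a moment of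
  \<open>g \<nu>\<close> that is merely bounded. Hence the spikes must be small against the square
  of the moments as well.

  On the negative side, one nonnegative \<open>f\<close> in \<open>L^p\<close> for which
  \<open>f \<omega>\<close> is not integrable defeats both operators at once, at the point
  0.\<close>

text \<open>Young's inequality for the product of \<open>g * s / v\<close> and 1, multiplied by
  \<open>v / s\<close>. The free parameter \<open>s\<close> is optimised in the next proof.\<close>

lemma young_scaled:
  fixes p g v s :: real
  assumes "p > 1" "g \<ge> 0" "v > 0" "s > 0"
  shows "g \<le> 1 / p * s powr (p - 1) * (g powr p * v powr (1 - p)) + (1 - 1 / p) * (v / s)"
proof -
  define x where "x = g * s / v"
  have x: "x \<ge> 0" using assms by (simp add: x_def)
  have "x * 1 \<le> x powr p / p + 1 powr (p / (p - 1)) / (p / (p - 1))"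
    using assms x by (intro Youngs_inequality) (auto simp: field_simps)
  also have "1 powr (p / (p - 1)) / (p / (p - 1)) = 1 - 1 / p"
    using assms by (simp add: field_simps)
  finally have "x * (v / s) \<le> (x powr p / p + (1 - 1 / p)) * (v / s)"
    using assms by (intro mult_right_mono) auto
  also have "x * (v / s) = g" using assms by (simp add: x_def)
  also have "(x powr p / p + (1 - 1 / p)) * (v / s) = 1 / p * (x powr p * (v / s)) + (1 - 1 / p) * (v / s)"
    by (simp add: algebra_simps)
  also have "x powr p * (v / s) = s powr (p - 1) * (g powr p * v powr (1 - p))"
    using assms by (simp add: x_def powr_mult powr_divide powr_diff field_simps)
  finally show ?thesis by simp
qed

text \<open>Hoelder's inequality for the measure \<open>k dM\<close> and the factorisation of
  \<open>g\<close> as \<open>(g / v^(1-1/p)) * v^(1-1/p)\<close>. The left side is a real lower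
  bound \<open>F\<close> of the integral, so that the integral itself may be infinite.\<close>

lemma weighted_Holder:
  fixes k g v :: "'a \<Rightarrow> real" and p a F :: real
  assumes p: "p > 1" and a: "a > 0" and F: "F \<ge> 0"
    and [measurable]: "k \<in> borel_measurable M" "g \<in> borel_measurable M" "v \<in> borel_measurable M"
    and k: "\<And>x. x \<in> space M \<Longrightarrow> k x \<ge> 0"
    and pos: "\<And>x. x \<in> space M \<Longrightarrow> k x > 0 \<Longrightarrow> v x > 0 \<and> g x \<ge> 0"
    and FI: "ennreal F \<le> (\<integral>\<^sup>+x. ennreal (k x * g x) \<partial>M)"
    and aI: "(\<integral>\<^sup>+x. ennreal (k x * v x) \<partial>M) \<le> ennreal a"
  shows "ennreal (F powr p) \<le> ennreal (a powr (p - 1)) * (\<integral>\<^sup>+x. ennreal (k x * (g x powr p * v x powr (1 - p))) \<partial>M)"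
proof (cases "F = 0")
  case False
  then have F: "F > 0" using F by simp
  \<comment> \<open>With this \<open>s\<close> the term containing the integral of
    \<open>k * v\<close> is at most \<open>(1 - 1/p) * F\<close>, which the left side
    absorbs.\<close>
  define s where "s = a / F"
  have s: "s > 0" using a F by (simp add: s_def)
  define c where "c = 1 / p * s powr (p - 1)"
  define d where "d = (1 - 1 / p) / s"
  have c: "c \<ge> 0" and d: "d \<ge> 0" using p s by (auto simp: c_def d_def)
  define I where "I = (\<integral>\<^sup>+x. ennreal (k x * (g x powr p * v x powr (1 - p))) \<partial>M)"
  have "ennreal F \<le> (\<integral>\<^sup>+x. ennreal c * ennreal (k x * (g x powr p * v x powr (1 - p))) + ennreal d * ennreal (k x * v x) \<partial>M)"
  proof (rule order_trans[OF FI], rule nn_integral_mono)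
    fix x assume x: "x \<in> space M"
    show "ennreal (k x * g x) \<le> ennreal c * ennreal (k x * (g x powr p * v x powr (1 - p))) + ennreal d * ennreal (k x * v x)"
    proof (cases "k x = 0")
      case True then show ?thesis by simp
    next
      case False
      then have kx: "k x > 0" using k[OF x] by simp
      with pos[OF x] have "v x > 0" "g x \<ge> 0" by auto
      then have "k x * g x \<le> k x * (1 / p * s powr (p - 1) * (g x powr p * v x powr (1 - p)) + (1 - 1 / p) * (v x / s))"
        using kx young_scaled[OF p \<open>g x \<ge> 0\<close> \<open>v x > 0\<close> s] by (intro mult_left_mono) auto
      also have "\<dots> = c * (k x * (g x powr p * v x powr (1 - p))) + d * (k x * v x)"
        using s p by (simp add: c_def d_def field_simps)
      finally show ?thesis
        using c d kx \<open>v x > 0\<close> by (simp add: ennreal_mult[symmetric] ennreal_plus[symmetric] ennreal_leI del: ennreal_plus)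
    qed
  qed
  also have "\<dots> = ennreal c * I + ennreal d * (\<integral>\<^sup>+x. ennreal (k x * v x) \<partial>M)"
    by (simp add: nn_integral_add nn_integral_cmult I_def)
  also have "\<dots> \<le> ennreal c * I + ennreal d * ennreal a"
    by (intro add_left_mono mult_left_mono aI) auto
  also have "ennreal d * ennreal a = ennreal ((1 - 1 / p) * F)"
  proof -
    have "d * a = (1 - 1 / p) * F" using a F by (simp add: d_def s_def)
    then show ?thesis using a d by (simp add: ennreal_mult[symmetric])
  qed
  finally have main: "ennreal F \<le> ennreal c * I + ennreal ((1 - 1 / p) * F)" .
  show ?thesis
  proof (cases I)
    case top
    have "a powr (p - 1) > 0" using a by simp
    then show ?thesis using top by (simp add: I_def[symmetric] ennreal_mult_top)
  next
    case (real i)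
    have "(1 - 1 / p) * F \<ge> 0" using p F by simp
    then have "ennreal F \<le> ennreal (c * i + (1 - 1 / p) * F)"
      using main real c by (simp add: ennreal_mult[symmetric] ennreal_plus[symmetric] del: ennreal_plus)
    then have "F \<le> c * i + (1 - 1 / p) * F"
      using c real \<open>(1 - 1 / p) * F \<ge> 0\<close> by (subst (asm) ennreal_le_iff) auto
    then have "F \<le> s powr (p - 1) * i"
      using p by (simp add: c_def algebra_simps divide_simps split: if_splits)
    also have "\<dots> = a powr (p - 1) * i / F powr (p - 1)"
      using a F by (simp add: s_def powr_divide)
    finally have "F * F powr (p - 1) \<le> a powr (p - 1) * i"
      using F by (simp add: field_simps)
    also have "F * F powr (p - 1) = F powr p"
      using F by (simp add: powr_diff)
    finally show ?thesis
      using real by (simp add: I_def[symmetric] ennreal_mult[symmetric] ennreal_leI)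
  qed
qed (use p in simp)

text \<open>The kernel \<open>1 / (x + y)\<close> is at most \<open>1 / x\<close> for
  \<open>y \<le> x\<close> and at most \<open>1 / y\<close> beyond. The two pieces contribute the
  summands \<open>1 / (1 - a)\<close> and \<open>1 / a\<close>.\<close>

lemma nn_integral_Hilbert_kernel_powr:
  fixes x a :: real
  assumes "x > 0" "0 < a" "a < 1"
  shows "(\<integral>\<^sup>+y. ennreal (indicator {0<..} y * (y powr (-a) / (x + y))) \<partial>lborel) \<le> ennreal ((1 / (1 - a) + 1 / a) * x powr (-a))"
proof -
  have "(\<integral>\<^sup>+y. ennreal (indicator {0<..} y * (y powr (-a) / (x + y))) \<partial>lborel)
     \<le> (\<integral>\<^sup>+y. ennreal (1 / x) * (ennreal (y powr (-a)) * indicator {0..x} y)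
            + ennreal (y powr (-a - 1)) * indicator {x..} y \<partial>lborel)"
  proof (rule nn_integral_mono)
    fix y :: real
    show "ennreal (indicator {0<..} y * (y powr (-a) / (x + y))) \<le>
       ennreal (1 / x) * (ennreal (y powr (-a)) * indicator {0..x} y) + ennreal (y powr (-a - 1)) * indicator {x..} y"
    proof (cases "0 < y \<and> y \<le> x")
      case True
      then have "y powr (-a) / (x + y) \<le> 1 / x * y powr (-a)"
        using assms by (simp add: field_simps)
      then have "ennreal (y powr (-a) / (x + y)) \<le> ennreal (1 / x) * ennreal (y powr (-a))"
        using assms by (simp add: ennreal_mult[symmetric] ennreal_leI)
      then show ?thesis using True by (auto simp: indicator_def intro: add_increasing2)
    next
      case False
      show ?thesis
      proof (cases "y \<le> 0")
        case False
        with \<open>\<not> (0 < y \<and> y \<le> x)\<close> have y: "y > x" by auto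
        then have "y powr (-a) / (x + y) \<le> y powr (-a - 1)"
          using assms by (simp add: powr_diff field_simps)
        then show ?thesis using y assms by (auto simp: indicator_def ennreal_leI)
      qed auto
    qed
  qed
  also have "\<dots> = ennreal (1 / x) * (\<integral>\<^sup>+y. ennreal (y powr (-a)) * indicator {0..x} y \<partial>lborel)
      + (\<integral>\<^sup>+y. ennreal (y powr (-a - 1)) * indicator {x..} y \<partial>lborel)"
    by (subst nn_integral_add) (auto simp: nn_integral_cmult)
  also have "(\<integral>\<^sup>+y. ennreal (y powr (-a)) * indicator {0..x} y \<partial>lborel) = ennreal (x powr (-a + 1) / (-a + 1))"
    using assms by (intro nn_integral_has_integral_lebesgue' has_integral_powr_from_0) auto
  also have "(\<integral>\<^sup>+y. ennreal (y powr (-a - 1)) * indicator {x..} y \<partial>lborel) = ennreal (- (x powr (-a - 1 + 1)) / (-a - 1 + 1))"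
    using assms by (intro nn_integral_has_integral_lebesgue' has_integral_powr_to_inf) auto
  also have "ennreal (1 / x) * ennreal (x powr (-a + 1) / (-a + 1)) + ennreal (- (x powr (-a - 1 + 1)) / (-a - 1 + 1))
     = ennreal (1 / x * (x powr (-a + 1) / (-a + 1)) + - (x powr (-a - 1 + 1)) / (-a - 1 + 1))"
    using assms by (simp add: ennreal_mult[symmetric] ennreal_plus[symmetric] del: ennreal_plus)
  also have "1 / x * (x powr (-a + 1) / (-a + 1)) + - (x powr (-a - 1 + 1)) / (-a - 1 + 1) = (1 / (1 - a) + 1 / a) * x powr (-a)"
      proof -
    have "x powr (-a + 1) = x powr (-a) * x" using assms by (subst powr_add) simp
    then show ?thesis using assms by (simp add: field_simps)
  qed
  finally show ?thesis .
qed

text \<open>Schur test with the weight \<open>y powr (-1/p)\<close>.\<close>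

proposition Hilbert_inequality:
  fixes p :: real and F g :: "real \<Rightarrow> real"
  assumes p: "p > 1"
    and [measurable]: "g \<in> borel_measurable borel"
    and g: "\<And>y. y > 0 \<Longrightarrow> g y \<ge> 0"
    and F: "\<And>x. x > 0 \<Longrightarrow> F x \<ge> 0"
    and FI: "\<And>x. x > 0 \<Longrightarrow> ennreal (F x) \<le> (\<integral>\<^sup>+y. ennreal (indicator {0<..} y * (g y / (x + y))) \<partial>lborel)"
  shows "(\<integral>\<^sup>+x. ennreal (F x powr p) * indicator {0<..} x \<partial>lborel)
     \<le> ennreal ((p / (p - 1) + p) powr p) * (\<integral>\<^sup>+y. ennreal (g y powr p) * indicator {0<..} y \<partial>lborel)"
proof -
  define A where "A = p / (p - 1) + p"
  have A: "A > 0" using p by (simp add: A_def add_pos_pos)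
  \<comment> \<open>The kernel estimate is used with exponent \<open>1/p\<close> in \<open>y\<close>
    and with \<open>1 - 1/p\<close> in \<open>x\<close>. Its constant is symmetric under exchanging
    \<open>a\<close> and \<open>1 - a\<close>, so both uses give the same \<open>A\<close>.\<close>
  have A1: "1 / (1 - 1 / p) + 1 / (1 / p) = A" using p by (simp add: A_def field_simps)
  have A2: "1 / (1 - (1 - 1 / p)) + 1 / (1 - 1 / p) = A" using p by (simp add: A_def field_simps)
  have bound: "ennreal (F x powr p) \<le> ennreal ((A * x powr (-1/p)) powr (p - 1)) *
      (\<integral>\<^sup>+y. ennreal (indicator {0<..} y / (x + y) * (g y powr p * (y powr (-1/p)) powr (1 - p))) \<partial>lborel)"
    if x: "x > 0" for x
  proof (rule weighted_Holder[OF p])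
    show "ennreal (F x) \<le> (\<integral>\<^sup>+y. ennreal (indicator {0<..} y / (x + y) * g y) \<partial>lborel)"
      using FI[OF x] by simp
    have "(\<integral>\<^sup>+y. ennreal (indicator {0<..} y / (x + y) * y powr (-1/p)) \<partial>lborel) =
       (\<integral>\<^sup>+y. ennreal (indicator {0<..} y * (y powr (-(1/p)) / (x + y))) \<partial>lborel)"
      by (simp add: field_simps)
    also have "\<dots> \<le> ennreal (A * x powr (-(1/p)))"
      using nn_integral_Hilbert_kernel_powr[of x "1/p"] x p unfolding A1 by simp
    finally show "(\<integral>\<^sup>+y. ennreal (indicator {0<..} y / (x + y) * y powr (-1/p)) \<partial>lborel) \<le> ennreal (A * x powr (-1/p))"
      by simp
      show "y powr (-1/p) > 0 \<and> g y \<ge> 0" if "0 < indicator {0<..} y / (x + y)" for y :: real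
      using that g by (cases "y > 0") auto
  qed (use x A p F in \<open>auto simp: indicator_def\<close>)
  have "(\<integral>\<^sup>+x. ennreal (F x powr p) * indicator {0<..} x \<partial>lborel) \<le>
     (\<integral>\<^sup>+x. \<integral>\<^sup>+y. ennreal (A powr (p - 1)) * (ennreal (g y powr p * y powr (1 - 1/p) * indicator {0<..} y) *
         ennreal (indicator {0<..} x * (x powr (-(1 - 1/p)) / (y + x)))) \<partial>lborel \<partial>lborel)"
  proof (rule nn_integral_mono)
    fix x :: real
    show "ennreal (F x powr p) * indicator {0<..} x \<le> (\<integral>\<^sup>+y. ennreal (A powr (p - 1)) * (ennreal (g y powr p * y powr (1 - 1/p) * indicator {0<..} y) *
         ennreal (indicator {0<..} x * (x powr (-(1 - 1/p)) / (y + x)))) \<partial>lborel)"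
    proof (cases "x > 0")
      case True
      have e: "(A * x powr (-1/p)) powr (p - 1) = A powr (p - 1) * x powr (-(1 - 1/p))"
        using A p by (simp add: powr_mult powr_powr field_simps)
      have e2: "(y powr (-1/p)) powr (1 - p) = y powr (1 - 1/p)" for y :: real
      proof -
        have "- 1 / p * (1 - p) = 1 - 1 / p" using p by (simp add: field_simps)
        then show ?thesis by (simp only: powr_powr)
      qed
      have "ennreal (F x powr p) \<le> (\<integral>\<^sup>+y. ennreal ((A * x powr (-1/p)) powr (p - 1)) *
            ennreal (indicator {0<..} y / (x + y) * (g y powr p * (y powr (-1/p)) powr (1 - p))) \<partial>lborel)"
        using bound[OF True] by (subst nn_integral_cmult) auto
      also have "\<dots> = (\<integral>\<^sup>+y. ennreal (A powr (p - 1)) * (ennreal (g y powr p * y powr (1 - 1/p) * indicator {0<..} y) *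
         ennreal (indicator {0<..} x * (x powr (-(1 - 1/p)) / (y + x)))) \<partial>lborel)"
        using True A unfolding e e2
        by (intro nn_integral_cong) (auto simp: indicator_def ennreal_mult'[symmetric] ennreal_mult''[symmetric] add.commute field_simps)
      finally show ?thesis using True by simp
    qed simp
  qed
  also have "\<dots> = (\<integral>\<^sup>+y. \<integral>\<^sup>+x. ennreal (A powr (p - 1)) * (ennreal (g y powr p * y powr (1 - 1/p) * indicator {0<..} y) *
         ennreal (indicator {0<..} x * (x powr (-(1 - 1/p)) / (y + x)))) \<partial>lborel \<partial>lborel)"
    by (rule lborel_pair.Fubini') (simp add: split_beta')
  also have "\<dots> \<le> (\<integral>\<^sup>+y. ennreal (A powr p) * (ennreal (g y powr p) * indicator {0<..} y) \<partial>lborel)"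
  proof (rule nn_integral_mono)
    fix y :: real
    show "(\<integral>\<^sup>+x. ennreal (A powr (p - 1)) * (ennreal (g y powr p * y powr (1 - 1/p) * indicator {0<..} y) *
         ennreal (indicator {0<..} x * (x powr (-(1 - 1/p)) / (y + x)))) \<partial>lborel) \<le> ennreal (A powr p) * (ennreal (g y powr p) * indicator {0<..} y)"
    proof (cases "y > 0")
      case True
      have "(\<integral>\<^sup>+x. ennreal (A powr (p - 1)) * (ennreal (g y powr p * y powr (1 - 1/p) * indicator {0<..} y) *
         ennreal (indicator {0<..} x * (x powr (-(1 - 1/p)) / (y + x)))) \<partial>lborel)
        = ennreal (A powr (p - 1)) * (ennreal (g y powr p * y powr (1 - 1/p)) * (\<integral>\<^sup>+x. ennreal (indicator {0<..} x * (x powr (-(1 - 1/p)) / (y + x))) \<partial>lborel))"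
        using True by (simp add: nn_integral_cmult)
      also have "\<dots> \<le> ennreal (A powr (p - 1)) * (ennreal (g y powr p * y powr (1 - 1/p)) * ennreal (A * y powr (-(1 - 1/p))))"
        using nn_integral_Hilbert_kernel_powr[of y "1 - 1/p"] True p unfolding A2 by (intro mult_left_mono) auto
      also have "\<dots> = ennreal (A powr (p - 1) * (g y powr p * y powr (1 - 1/p) * (A * y powr (-(1 - 1/p)))))"
        using A by (simp add: ennreal_mult[symmetric])
      also have "A powr (p - 1) * (g y powr p * y powr (1 - 1/p) * (A * y powr (-(1 - 1/p)))) = A powr p * g y powr p"
        using A True by (simp add: powr_diff powr_minus)
      finally show ?thesis using True by (simp add: ennreal_mult)
    qed simp
  qed
  also have "\<dots> = ennreal (A powr p) * (\<integral>\<^sup>+y. ennreal (g y powr p) * indicator {0<..} y \<partial>lborel)"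
    by (rule nn_integral_cmult) simp
  finally show ?thesis by (simp add: A_def)
qed

subsection \<open>Submean value properties\<close>

text \<open>Cauchy's formula with absolute values inside. At the centre it yields the submean
  property, on a radius the Fejer-Riesz inequality and pointwise growth. The larger radius
  \<open>R'\<close> makes \<open>f\<close> continuous on the closed disc.\<close>

lemma Cauchy_norm_le_circle_integral:
  assumes holf: "f holomorphic_on ball c R'" and R: "0 < R" "R < R'" and w: "norm (w - c) < R"
  shows "ennreal (norm (f w)) \<le> (\<integral>\<^sup>+\<theta>. ennreal (indicator {0..2*pi} \<theta> *
           (R / (2 * pi * norm (of_real R * cis \<theta> - (w - c))) * norm (f (c + of_real R * cis \<theta>)))) \<partial>lborel)"
proof -
  let ?h = "\<lambda>t. f (c + R * cis t) / (c + R * cis t - w) * R * \<i> * cis t"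
  let ?g = "\<lambda>t. R / (norm (of_real R * cis t - (w - c))) * norm (f (c + of_real R * cis t))"
  have hol: "f holomorphic_on cball c R"
    using holf by (rule holomorphic_on_subset) (use R in auto)
  have "((\<lambda>u. f u / (u - w)) has_contour_integral (2 * of_real pi * \<i> * f w)) (circlepath c R)"
    by (rule Cauchy_integral_circlepath_simple[OF hol w])
  then have hi: "(?h has_integral (2 * of_real pi * \<i> * f w)) {0..2*pi}"
    unfolding circlepath_def by (subst (asm) has_contour_integral_part_circlepath_iff) auto
  have ne: "c + R * cis t - w \<noteq> 0" for t
  proof
    assume "c + R * cis t - w = 0"
    then have "w - c = R * cis t" by (simp add: algebra_simps)
    then have "norm (w - c) = norm (R * cis t)" by simp
    then show False using w R by (simp add: norm_mult)
  qed
  have ne': "of_real R * cis t - (w - c) \<noteq> 0" for t using ne[of t] by (simp add: algebra_simps)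
  have "continuous_on {0..2*pi} (\<lambda>t. f (c + R * cis t))"
    using R by (intro continuous_on_compose2[OF holomorphic_on_imp_continuous_on[OF holf]] continuous_intros)
       (auto simp: dist_norm norm_mult)
  then have cont: "continuous_on {0..2*pi} ?g"
    using ne' by (intro continuous_intros) auto
  then have gi: "(?g has_integral integral {0..2*pi} ?g) {0..2*pi}"
    using integrable_continuous_interval by blast
  have nh: "norm (?h t) = ?g t" for t
    using R ne[of t] ne'[of t] by (simp add: norm_mult norm_divide field_simps)
  have "norm (2 * of_real pi * \<i> * f w) = norm (integral {0..2*pi} ?h)"
    using hi by (simp add: integral_unique)
  also have "\<dots> \<le> integral {0..2*pi} ?g"
    using hi gi nh by (intro Henstock_Kurzweil_Integration.integral_norm_bound_integral) auto
  finally have "norm (f w) \<le> 1 / (2 * pi) * integral {0..2*pi} ?g"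
    by (simp add: norm_mult field_simps)
  then have "ennreal (norm (f w)) \<le> ennreal (1 / (2 * pi) * integral {0..2*pi} ?g)"
    by (rule ennreal_leI)
  also have "\<dots> = (\<integral>\<^sup>+t. ennreal (1 / (2 * pi) * ?g t) * indicator {0..2*pi} t \<partial>lborel)"
    using R by (intro nn_integral_has_integral_lebesgue'[symmetric] has_integral_mult_right gi) auto
  also have "\<dots> = (\<integral>\<^sup>+t. ennreal (indicator {0..2*pi} t *
           (R / (2 * pi * norm (of_real R * cis t - (w - c))) * norm (f (c + of_real R * cis t)))) \<partial>lborel)"
    by (intro nn_integral_cong) (auto simp: indicator_def field_simps)
  finally show ?thesis .
qed

section \<open>Plane Lebesgue measure: Tonelli, shears and rotations\<close>

lemma measurable_Complex [measurable]:
  assumes [measurable]: "f \<in> borel_measurable M" "g \<in> borel_measurable M"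
  shows "(\<lambda>x. Complex (f x) (g x)) \<in> borel_measurable M"
  unfolding Complex_eq by measurable

text \<open>Both measures give a box the product of its side lengths, which characterises Lebesgue
  measure. This opens Tonelli's theorem in Cartesian coordinates.\<close>

lemma lborel_complex_eq: "(lborel :: complex measure) = distr (lborel \<Otimes>\<^sub>M lborel) borel (\<lambda>(x, y). Complex x y)"
proof (rule lborel_eqI)
  have [measurable]: "(\<lambda>(x, y). Complex x y) \<in> borel_measurable (lborel \<Otimes>\<^sub>M lborel)"
    unfolding split_beta' by measurable
  fix l u :: complex
  assume le: "\<And>b. b \<in> Basis \<Longrightarrow> l \<bullet> b \<le> u \<bullet> b"
  have le': "Re l \<le> Re u" "Im l \<le> Im u" using le[of 1] le[of \<i>] by (auto simp: Basis_complex_def)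
  have eq: "(\<lambda>(x, y). Complex x y) -` box l u \<inter> space (lborel \<Otimes>\<^sub>M lborel) = {Re l<..<Re u} \<times> {Im l<..<Im u}"
    by (auto simp: space_pair_measure box_def Basis_complex_def)
  have "emeasure (distr (lborel \<Otimes>\<^sub>M lborel) borel (\<lambda>(x, y). Complex x y)) (box l u) =
     emeasure (lborel \<Otimes>\<^sub>M lborel) ({Re l<..<Re u} \<times> {Im l<..<Im u})"
    by (subst emeasure_distr) (simp_all add: eq)
  also have "\<dots> = ennreal ((Re u - Re l) * (Im u - Im l))"
    using le' by (subst lborel.emeasure_pair_measure_Times) (auto simp: ennreal_mult[symmetric])
  also have "(Re u - Re l) * (Im u - Im l) = (\<Prod>b\<in>Basis. (u - l) \<bullet> b)"
    by (simp add: Basis_complex_def)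
  finally show "emeasure (distr (lborel \<Otimes>\<^sub>M lborel) borel (\<lambda>(x, y). Complex x y)) (box l u) = ennreal (\<Prod>b\<in>Basis. (u - l) \<bullet> b)" .
qed simp

lemma nn_integral_lborel_complex:
  assumes [measurable]: "g \<in> borel_measurable borel"
  shows "(\<integral>\<^sup>+z. g z \<partial>lborel) = (\<integral>\<^sup>+x. \<integral>\<^sup>+y. g (Complex x y) \<partial>lborel \<partial>lborel)"
    and "(\<integral>\<^sup>+z. g z \<partial>lborel) = (\<integral>\<^sup>+y. \<integral>\<^sup>+x. g (Complex x y) \<partial>lborel \<partial>lborel)"
proof -
  have [measurable]: "(\<lambda>(x, y). Complex x y) \<in> borel_measurable (lborel \<Otimes>\<^sub>M lborel)"
    unfolding split_beta' by measurable
  show 1: "(\<integral>\<^sup>+z. g z \<partial>lborel) = (\<integral>\<^sup>+x. \<integral>\<^sup>+y. g (Complex x y) \<partial>lborel \<partial>lborel)"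
    by (subst lborel_complex_eq, subst nn_integral_distr) (auto simp: lborel.nn_integral_fst[symmetric])
  show "(\<integral>\<^sup>+z. g z \<partial>lborel) = (\<integral>\<^sup>+y. \<integral>\<^sup>+x. g (Complex x y) \<partial>lborel \<partial>lborel)"
    unfolding 1 by (rule lborel_pair.Fubini'[symmetric]) simp
qed

lemma nn_integral_lborel_translate:
  fixes f :: "real \<Rightarrow> ennreal"
  assumes [measurable]: "f \<in> borel_measurable borel"
  shows "(\<integral>\<^sup>+x. f (x + t) \<partial>lborel) = (\<integral>\<^sup>+x. f x \<partial>lborel)"
  using nn_integral_real_affine[of f 1 t] by (simp add: add.commute)

text \<open>On each line parallel to the direction of the shear, the map is a translation.\<close>

lemma nn_integral_lborel_shear:
  fixes g :: "complex \<Rightarrow> ennreal" and a :: real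
  assumes [measurable]: "g \<in> borel_measurable borel"
  shows "(\<integral>\<^sup>+z. g (z + of_real (a * Im z)) \<partial>lborel) = (\<integral>\<^sup>+z. g z \<partial>lborel)"
    and "(\<integral>\<^sup>+z. g (z + \<i> * of_real (a * Re z)) \<partial>lborel) = (\<integral>\<^sup>+z. g z \<partial>lborel)"
proof -
  have "(\<integral>\<^sup>+z. g (z + of_real (a * Im z)) \<partial>lborel) = (\<integral>\<^sup>+y. \<integral>\<^sup>+x. g (Complex (x + a * y) y) \<partial>lborel \<partial>lborel)"
    by (subst nn_integral_lborel_complex(2)) (auto simp: complex_eq_iff intro!: nn_integral_cong arg_cong[where f = g])
  also have "\<dots> = (\<integral>\<^sup>+z. g z \<partial>lborel)"
    using nn_integral_lborel_translate[of "\<lambda>x. g (Complex x y)" "a * y" for y]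
    by (subst nn_integral_lborel_complex(2)) auto
  finally show "(\<integral>\<^sup>+z. g (z + of_real (a * Im z)) \<partial>lborel) = (\<integral>\<^sup>+z. g z \<partial>lborel)" .
  have "(\<integral>\<^sup>+z. g (z + \<i> * of_real (a * Re z)) \<partial>lborel) = (\<integral>\<^sup>+x. \<integral>\<^sup>+y. g (Complex x (y + a * x)) \<partial>lborel \<partial>lborel)"
    by (subst nn_integral_lborel_complex(1)) (auto simp: complex_eq_iff intro!: nn_integral_cong arg_cong[where f = g])
  also have "\<dots> = (\<integral>\<^sup>+z. g z \<partial>lborel)"
    using nn_integral_lborel_translate[of "\<lambda>y. g (Complex x y)" "a * x" for x]
    by (subst nn_integral_lborel_complex(1)) auto
  finally show "(\<integral>\<^sup>+z. g (z + \<i> * of_real (a * Re z)) \<partial>lborel) = (\<integral>\<^sup>+z. g z \<partial>lborel)" .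
qed

lemma nn_integral_lborel_rotate:
  fixes g :: "complex \<Rightarrow> ennreal"
  assumes [measurable]: "g \<in> borel_measurable borel" and ne: "cos \<theta> \<noteq> -1"
  shows "(\<integral>\<^sup>+z. g (z * cis \<theta>) \<partial>lborel) = (\<integral>\<^sup>+z. g z \<partial>lborel)"
proof -
  \<comment> \<open>a rotation is a product of three shears, each of which preserves area by Fubini\<close>
  define c s a where "c = cos \<theta>" and "s = sin \<theta>" and "a = - s / (1 + c)"
  define S1 where "S1 = (\<lambda>z::complex. z + of_real (a * Im z))"
  define S2 where "S2 = (\<lambda>z::complex. z + \<i> * of_real (s * Re z))"
  have [measurable]: "S1 \<in> borel_measurable borel" "S2 \<in> borel_measurable borel"
    unfolding S1_def S2_def by measurable
  \<comment> \<open>The slope \<open>a\<close> is \<open>- tan (\<theta> / 2)\<close>; only for the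
    half turn is it infinite.\<close>
  have c1: "1 + c \<noteq> 0" using ne unfolding c_def by (metis add_minus_cancel add.right_neutral)
  have cs: "c\<^sup>2 + s\<^sup>2 = 1" by (simp add: c_def s_def)
  have as: "1 + a * s = c"
  proof -
    have "(1 + a * s) * (1 + c) = 1 + c - s * s" using c1 by (simp add: a_def field_simps)
    also have "\<dots> = c * (1 + c)" using cs by (simp add: power2_eq_square algebra_simps)
    finally show ?thesis using c1 by simp
  qed
  have ac: "a * (1 + c) = - s" using c1 by (simp add: a_def)
  have "S1 (S2 (S1 z)) = z * cis \<theta>" for z
  proof (rule complex_eqI)
    have "Im (S1 (S2 (S1 z))) = (1 + a * s) * Im z + s * Re z"
      by (simp add: S1_def S2_def algebra_simps)
    then show "Im (S1 (S2 (S1 z))) = Im (z * cis \<theta>)"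
      unfolding as by (simp add: c_def s_def)
    have "Re (S1 (S2 (S1 z))) = (1 + a * s) * Re z + a * (1 + (1 + a * s)) * Im z"
      by (simp add: S1_def S2_def algebra_simps)
    then show "Re (S1 (S2 (S1 z))) = Re (z * cis \<theta>)"
      unfolding as ac by (simp add: c_def s_def)
  qed
  then have "(\<integral>\<^sup>+z. g (z * cis \<theta>) \<partial>lborel) = (\<integral>\<^sup>+z. g (S1 (S2 (S1 z))) \<partial>lborel)" by simp
  also have "\<dots> = (\<integral>\<^sup>+z. g (S1 (S2 z)) \<partial>lborel)"
    using nn_integral_lborel_shear(1)[of "\<lambda>z. g (S1 (S2 z))" a] by (simp add: fun_cong[OF S1_def, of z for z])
  also have "\<dots> = (\<integral>\<^sup>+z. g (S1 z) \<partial>lborel)"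
    using nn_integral_lborel_shear(2)[of "\<lambda>z. g (S1 z)" s] by (simp add: fun_cong[OF S2_def, of z for z])
  also have "\<dots> = (\<integral>\<^sup>+z. g z \<partial>lborel)"
    using nn_integral_lborel_shear(1)[of g a] by (simp add: fun_cong[OF S1_def, of z for z])
  finally show ?thesis .
qed

text \<open>Hoelder's inequality raises the mean value inequality to the power \<open>p\<close>, the
  measure on the circle having mass 1. The circle is given by one of its points \<open>z\<close>
  instead of its radius, so that \<open>z\<close> can afterwards be averaged over a disc.\<close>

lemma circle_submean_powr:
  assumes holf: "f holomorphic_on ball c R" and z: "norm z < R" and p: "p > 1"
  shows "ennreal (norm (f c) powr p) \<le> (\<integral>\<^sup>+\<theta>. ennreal (indicator {0..2*pi} \<theta> / (2 * pi) * norm (f (c + z * cis \<theta>)) powr p) \<partial>lborel)"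
proof -
  obtain R' where R': "R' > 1" "norm z * R' < R"
  proof (cases "z = 0")
    case True then show ?thesis using that[of 2] z by auto
  next
    case False
    then have "1 < R / norm z" using z by (simp add: field_simps)
    then obtain t where "1 < t" "t < R / norm z" using dense by blast
    then show ?thesis using that[of t] False by (simp add: field_simps)
  qed
  define F where "F = (\<lambda>w. f (c + z * w))"
  have holF: "F holomorphic_on ball 0 R'"
    unfolding F_def
  proof (rule holomorphic_on_compose_gen[OF _ holf, unfolded o_def])
    show "(\<lambda>w. c + z * w) ` ball 0 R' \<subseteq> ball c R"
    proof safe
      fix w :: complex assume "w \<in> ball 0 R'"
      then have "norm z * norm w \<le> norm z * R'" by (intro mult_left_mono) auto
      then show "c + z * w \<in> ball c R" using R' by (simp add: dist_norm norm_mult)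
    qed
  qed (intro holomorphic_intros)
  have "continuous_on UNIV (\<lambda>t. F (cis t))"
    using R' by (intro continuous_on_compose2[OF holomorphic_on_imp_continuous_on[OF holF]] continuous_intros) auto
  then have [measurable]: "(\<lambda>t. F (cis t)) \<in> borel_measurable borel" by (rule borel_measurable_continuous_onI)
  have "ennreal (norm (F 0)) \<le> (\<integral>\<^sup>+\<theta>. ennreal (indicator {0..2*pi} \<theta> * (1 / (2 * pi * norm (of_real 1 * cis \<theta> - (0 - 0))) * norm (F (0 + of_real 1 * cis \<theta>)))) \<partial>lborel)"
    by (rule Cauchy_norm_le_circle_integral[OF holF]) (use R' in auto)
  then have le: "ennreal (norm (F 0)) \<le> (\<integral>\<^sup>+\<theta>. ennreal (indicator {0..2*pi} \<theta> / (2 * pi) * norm (F (cis \<theta>))) \<partial>lborel)"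
    by (simp add: norm_mult)
  have one: "(\<integral>\<^sup>+\<theta>. ennreal (indicator {0..2*pi} \<theta> / (2 * pi) * 1) \<partial>lborel) \<le> ennreal 1"
  proof -
    have "(\<integral>\<^sup>+\<theta>. ennreal (indicator {0..2*pi} \<theta> / (2 * pi) * 1) \<partial>lborel) = (\<integral>\<^sup>+\<theta>. ennreal (1 / (2 * pi)) * indicator {0..2*pi} \<theta> \<partial>lborel)"
      by (intro nn_integral_cong) (auto simp: indicator_def)
    also have "\<dots> = ennreal (1 / (2 * pi)) * ennreal (2 * pi)"
      by (subst nn_integral_cmult_indicator) auto
    finally show ?thesis by (simp add: ennreal_mult[symmetric])
  qed
  have "ennreal (norm (F 0) powr p) \<le> ennreal (1 powr (p - 1)) * (\<integral>\<^sup>+\<theta>. ennreal (indicator {0..2*pi} \<theta> / (2 * pi) * (norm (F (cis \<theta>)) powr p * 1 powr (1 - p))) \<partial>lborel)"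
    by (rule weighted_Holder[OF p _ _ _ _ _ _ _ le one]) auto
  then show ?thesis by (simp add: F_def)
qed

text \<open>Rotation invariance takes the place of polar coordinates: the circle inequality is
  integrated over all \<open>z\<close> in the disc, the integrals are exchanged, and for each fixed
  angle the rotation drops out of the area integral.\<close>

lemma area_submean_powr:
  assumes holf: "f holomorphic_on ball c R" and R: "R > 0" and p: "p > 1"
  shows "ennreal (pi * R\<^sup>2) * ennreal (norm (f c) powr p) \<le> (\<integral>\<^sup>+z. ennreal (norm (f z) powr p) * indicator (ball c R) z \<partial>lborel)"
proof -
  define G where "G = (\<lambda>z. ennreal (norm (f (c + z)) powr p) * indicator (ball 0 R) z)"
  have G_eq: "G = (\<lambda>z. ennreal (indicator (ball 0 R) z *\<^sub>R (norm (f (c + z)) powr p)))"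
    by (auto simp: G_def indicator_def)
  have [measurable]: "G \<in> borel_measurable borel"
    unfolding G_eq using p
    by (intro measurable_compose[OF _ measurable_ennreal] borel_measurable_continuous_on_indicator continuous_intros
         continuous_on_powr' continuous_on_compose2[OF holomorphic_on_imp_continuous_on[OF holf]]) (auto simp: dist_norm)
  have "ennreal (pi * R\<^sup>2) * ennreal (norm (f c) powr p) = (\<integral>\<^sup>+z. ennreal (norm (f c) powr p) * indicator (ball 0 R) (z::complex) \<partial>lborel)"
    using R by (subst nn_integral_cmult_indicator) (simp_all add: emeasure_ball unit_ball_vol_2 mult.commute)
  also have "\<dots> \<le> (\<integral>\<^sup>+z. \<integral>\<^sup>+\<theta>. ennreal (indicator {0..2*pi} \<theta> / (2 * pi)) * G (z * cis \<theta>) \<partial>lborel \<partial>lborel)"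
  proof (rule nn_integral_mono)
    fix z :: complex
    show "ennreal (norm (f c) powr p) * indicator (ball 0 R) z \<le> (\<integral>\<^sup>+\<theta>. ennreal (indicator {0..2*pi} \<theta> / (2 * pi)) * G (z * cis \<theta>) \<partial>lborel)"
    proof (cases "norm z < R")
      case True
      have "ennreal (norm (f c) powr p) \<le> (\<integral>\<^sup>+\<theta>. ennreal (indicator {0..2*pi} \<theta> / (2 * pi) * norm (f (c + z * cis \<theta>)) powr p) \<partial>lborel)"
        by (rule circle_submean_powr[OF holf True p])
      also have "\<dots> = (\<integral>\<^sup>+\<theta>. ennreal (indicator {0..2*pi} \<theta> / (2 * pi)) * G (z * cis \<theta>) \<partial>lborel)"
        using True by (intro nn_integral_cong) (simp add: G_def norm_mult ennreal_mult[symmetric])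
      finally show ?thesis using True by simp
    qed simp
  qed
  also have "\<dots> = (\<integral>\<^sup>+\<theta>. \<integral>\<^sup>+z. ennreal (indicator {0..2*pi} \<theta> / (2 * pi)) * G (z * cis \<theta>) \<partial>lborel \<partial>lborel)"
    by (rule pair_sigma_finite.Fubini'[symmetric])
       (auto simp: pair_sigma_finite_def lborel.sigma_finite_measure_axioms split_beta' cis_conv_exp)
  also have "\<dots> = (\<integral>\<^sup>+\<theta>. ennreal (indicator {0..2*pi} \<theta> / (2 * pi)) * (\<integral>\<^sup>+z. G z \<partial>lborel) \<partial>lborel)"
  \<comment> \<open>The half turn has no factorisation into the three shears, but a single angle is
    a null set.\<close>
  proof (rule nn_integral_cong_AE, rule AE_I[of _ _ "{pi}"])
    show "{\<theta> \<in> space lborel. \<not> (\<integral>\<^sup>+z. ennreal (indicator {0..2*pi} \<theta> / (2 * pi)) * G (z * cis \<theta>) \<partial>lborel) =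
        ennreal (indicator {0..2*pi} \<theta> / (2 * pi)) * (\<integral>\<^sup>+z. G z \<partial>lborel)} \<subseteq> {pi}"
    proof (safe, rule ccontr)
      fix t :: real
      assume neq: "(\<integral>\<^sup>+z. ennreal (indicator {0..2*pi} t / (2 * pi)) * G (z * cis t) \<partial>lborel) \<noteq>
        ennreal (indicator {0..2*pi} t / (2 * pi)) * (\<integral>\<^sup>+z. G z \<partial>lborel)" and "t \<noteq> pi"
      have "cos t \<noteq> - 1" if "0 \<le> t" "t \<le> 2 * pi"
        using \<open>t \<noteq> pi\<close> that cos_inj_pi[of t pi] cos_inj_pi[of "2 * pi - t" pi] by (cases "t \<le> pi") auto
      then show False using neq
        by (cases "t \<in> {0..2*pi}") (auto simp: nn_integral_cmult nn_integral_lborel_rotate)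
    qed
  qed auto
  also have "\<dots> = (\<integral>\<^sup>+\<theta>. ennreal (1 / (2 * pi)) * (\<integral>\<^sup>+z. G z \<partial>lborel) * indicator {0..2*pi} \<theta> \<partial>lborel)"
    by (intro nn_integral_cong) (auto simp: indicator_def)
  also have "\<dots> = ennreal (1 / (2 * pi)) * ennreal (2 * pi) * (\<integral>\<^sup>+z. G z \<partial>lborel)"
    by (subst nn_integral_cmult_indicator) (auto simp: mult_ac)
  also have "ennreal (1 / (2 * pi)) * ennreal (2 * pi) = 1"
    by (simp add: ennreal_mult[symmetric])
  also have "1 * (\<integral>\<^sup>+z. G z \<partial>lborel) = (\<integral>\<^sup>+z. G (z - c) \<partial>lborel)"
    using nn_integral_distr[of "(+) (-c)" lborel borel G] by (simp add: lborel_distr_plus)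
  also have "\<dots> = (\<integral>\<^sup>+z. ennreal (norm (f z) powr p) * indicator (ball c R) z \<partial>lborel)"
    by (intro nn_integral_cong) (auto simp: G_def indicator_def dist_norm norm_minus_commute)
  finally show ?thesis .
qed

subsection \<open>The four norms\<close>

text \<open>The four powers are integrals over \<open>lborel\<close> instead of its completion: the
  values are the same and Tonelli's theorem applies.\<close>

definition H_inf_power :: "real \<Rightarrow> (complex \<Rightarrow> complex) \<Rightarrow> ennreal" where
  "H_inf_power p f = (\<integral>\<^sup>+r\<in>{0..<1}. ennreal (max_modulus r f powr p) \<partial>lborel)"

definition Hardy_power :: "real \<Rightarrow> (complex \<Rightarrow> complex) \<Rightarrow> ennreal" where
  "Hardy_power p f = (SUP r\<in>{0<..<1}. \<integral>\<^sup>+\<theta>\<in>{0..2*pi}. ennreal (norm (f (of_real r * cis \<theta>)) powr p / (2 * pi)) \<partial>lborel)"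

definition Dirichlet_power :: "real \<Rightarrow> (complex \<Rightarrow> complex) \<Rightarrow> ennreal" where
  "Dirichlet_power p f = ennreal (norm (f 0) powr p) +
     ennreal (1 / pi) * (\<integral>\<^sup>+z\<in>ball 0 1. ennreal (norm (deriv f z) powr p * (1 - norm z) powr (p - 1)) \<partial>lborel)"

definition HL_power :: "real \<Rightarrow> (complex \<Rightarrow> complex) \<Rightarrow> ennreal" where
  "HL_power p f = (\<Sum>n. ennreal (norm (taylor_coeff f n) powr p * (real n + 1) powr (p - 2)))"

text \<open>
  \<open>V\<close> is the \<open>p\<close>-th power of the norm \<open>N\<close>. Stating this through sublevel sets avoids commuting the
  supremum in the Hardy norm with the \<open>p\<close>-th root.
\<close>

definition norm_power :: "real \<Rightarrow> ((complex \<Rightarrow> complex) \<Rightarrow> ennreal) \<Rightarrow> ((complex \<Rightarrow> complex) \<Rightarrow> ennreal) \<Rightarrow> bool" where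
  "norm_power p N V \<longleftrightarrow> (\<forall>f. f holomorphic_on ball 0 1 \<longrightarrow>
     (\<forall>B\<ge>0. N f \<le> ennreal B \<longleftrightarrow> V f \<le> ennreal (B powr p)))"

text \<open>Functions are compared on the disc only, since values of the operators outside it are
  arbitrary. The factor \<open>2 powr p\<close> comes from bounding a sum by twice the
  maximum.\<close>

definition quasilinear_power :: "real \<Rightarrow> ((complex \<Rightarrow> complex) \<Rightarrow> ennreal) \<Rightarrow> bool" where
  "quasilinear_power p V \<longleftrightarrow>
     (\<forall>f g h. f holomorphic_on ball 0 1 \<longrightarrow> g holomorphic_on ball 0 1 \<longrightarrow> h holomorphic_on ball 0 1 \<longrightarrow>
        (\<forall>z\<in>ball 0 1. h z = f z + g z) \<longrightarrow> V h \<le> ennreal (2 powr p) * (V f + V g)) \<and>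
     (\<forall>f h c. f holomorphic_on ball 0 1 \<longrightarrow> h holomorphic_on ball 0 1 \<longrightarrow>
        (\<forall>z\<in>ball 0 1. h z = c * f z) \<longrightarrow> V h \<le> ennreal (norm c powr p) * V f)"

text \<open>The exponent 3 is dictated by the Dirichlet space: differentiation costs one power of
  \<open>n + 1\<close>, and what remains must still be summable.\<close>

definition bounded_on_small_series :: "((complex \<Rightarrow> complex) \<Rightarrow> ennreal) \<Rightarrow> bool" where
  "bounded_on_small_series V \<longleftrightarrow> (\<exists>B. \<forall>f e. f holomorphic_on ball 0 1 \<longrightarrow>
     (\<forall>z\<in>ball 0 1. (\<lambda>n. e n * z ^ n) sums f z) \<longrightarrow> (\<forall>n. norm (e n) \<le> 1 / (real n + 1) ^ 3) \<longrightarrow> V f \<le> ennreal B)"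

section \<open>Powers of sums, and passing between the norms and their powers\<close>

lemma powr_add_le:
  fixes a b c p :: real
  assumes "p > 0" "0 \<le> a" "0 \<le> b" "0 \<le> c" "a \<le> b + c"
  shows "a powr p \<le> 2 powr p * (b powr p + c powr p)"
proof -
  have "a powr p \<le> (2 * max b c) powr p" using assms by (intro powr_mono2) auto
  also have "\<dots> = 2 powr p * max b c powr p" using assms by (simp add: powr_mult)
  also have "\<dots> \<le> 2 powr p * (b powr p + c powr p)"
    by (intro mult_left_mono) (auto simp: max_def)
  finally show ?thesis .
qed

lemma ennreal_powr_add_le:
  fixes a b c p w :: real
  assumes "p > 0" "0 \<le> a" "0 \<le> b" "0 \<le> c" "a \<le> b + c" "w \<ge> 0"
  shows "ennreal (a powr p * w) \<le> ennreal (2 powr p) * (ennreal (b powr p * w) + ennreal (c powr p * w))"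
proof -
  have "a powr p * w \<le> 2 powr p * (b powr p + c powr p) * w"
    using powr_add_le[of p a b c] assms by (intro mult_right_mono) auto
  also have "\<dots> = 2 powr p * (b powr p * w + c powr p * w)" by (simp add: algebra_simps)
  finally show ?thesis using assms
    by (simp add: ennreal_mult[symmetric] ennreal_plus[symmetric] ennreal_leI del: ennreal_plus)
qed

lemma enn_powr_le_iff:
  assumes "p > 0" "B \<ge> 0"
  shows "enn_powr x (1 / p) \<le> ennreal B \<longleftrightarrow> x \<le> ennreal (B powr p)"
proof (cases x)
  case (real r)
  have "r powr (1 / p) \<le> B \<longleftrightarrow> r \<le> B powr p"
  proof
    assume "r powr (1 / p) \<le> B"
    then have "(r powr (1 / p)) powr p \<le> B powr p" using assms by (intro powr_mono2) auto
    then show "r \<le> B powr p" using assms real by (simp add: powr_powr)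
  next
    assume "r \<le> B powr p"
    then have "r powr (1 / p) \<le> (B powr p) powr (1 / p)" using assms real by (intro powr_mono2) auto
    then show "r powr (1 / p) \<le> B" using assms by (simp add: powr_powr)
  qed
  then show ?thesis using assms real by (simp add: enn_powr_def)
next
  case top
  then show ?thesis using assms by (simp add: enn_powr_def top_unique)
qed

lemma norm_powerI: "p > 0 \<Longrightarrow> (\<And>f. N f = enn_powr (V f) (1 / p)) \<Longrightarrow> norm_power p N V"
  by (simp add: norm_power_def enn_powr_le_iff)

lemma norm_power_H_inf: "p > 0 \<Longrightarrow> norm_power p (H_inf_norm p) (H_inf_power p)"
  by (rule norm_powerI) (simp_all add: H_inf_norm_def H_inf_power_def nn_integral_completion)

lemma norm_power_Dirichlet: "p > 0 \<Longrightarrow> norm_power p (Dirichlet_norm p) (Dirichlet_power p)"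
  by (rule norm_powerI) (simp_all add: Dirichlet_norm_def Dirichlet_power_def nn_integral_completion)

lemma norm_power_HL: "p > 0 \<Longrightarrow> norm_power p (HL_norm p) (HL_power p)"
  by (rule norm_powerI) (simp_all add: HL_norm_def HL_power_def)

lemma continuous_on_circle:
  assumes "f holomorphic_on ball 0 1" "0 \<le> r" "r < 1"
  shows "continuous_on A (\<lambda>\<theta>. f (of_real r * cis \<theta>))"
  using assms by (intro continuous_on_compose2[OF holomorphic_on_imp_continuous_on[OF assms(1)]] continuous_intros)
     (auto simp: norm_mult)

text \<open>The integral mean is a Bochner integral over the completed measure. On each circle the
  integrand is continuous on a compact interval, so this integral agrees with the nonnegative one;
  sublevel sets then pass to the supremum circle by circle.\<close>

lemma norm_power_Hardy:
  assumes p: "p > 0"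
  shows "norm_power p (Hardy_norm p) (Hardy_power p)"
  unfolding norm_power_def
proof safe
  fix f :: "complex \<Rightarrow> complex" and B :: real
  assume holf: "f holomorphic_on ball 0 1" and B: "B \<ge> 0"
  define J where "J r = 1 / (2 * pi) * (LINT \<theta>:{0..2*pi}|lebesgue. norm (f (of_real r * cis \<theta>)) powr p)" for r
  have J0: "J r \<ge> 0" for r
    unfolding J_def set_lebesgue_integral_def by (intro mult_nonneg_nonneg integral_nonneg_AE) (auto simp: indicator_def)
  have J: "ennreal (J r) = (\<integral>\<^sup>+\<theta>\<in>{0..2*pi}. ennreal (norm (f (of_real r * cis \<theta>)) powr p / (2 * pi)) \<partial>lborel)"
    if r: "r \<in> {0<..<1}" for r
  proof -
    let ?g = "\<lambda>\<theta>. norm (f (of_real r * cis \<theta>)) powr p"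
    have "continuous_on {0..2*pi} ?g"
      using p r by (intro continuous_intros continuous_on_powr' continuous_on_circle[OF holf]) auto
    then have int: "integrable lborel (\<lambda>\<theta>. indicator {0..2*pi} \<theta> *\<^sub>R ?g \<theta>)"
      by (intro borel_integrable_compact) auto
    have "J r = (\<integral>\<theta>. 1 / (2 * pi) * (indicator {0..2*pi} \<theta> *\<^sub>R ?g \<theta>) \<partial>lborel)"
      unfolding J_def set_lebesgue_integral_def
      using int by (subst integral_completion) (auto dest: borel_measurable_integrable)
    then have "ennreal (J r) = (\<integral>\<^sup>+\<theta>. ennreal (1 / (2 * pi) * (indicator {0..2*pi} \<theta> *\<^sub>R ?g \<theta>)) \<partial>lborel)"
      using int by (subst nn_integral_eq_integral) (auto intro!: integrable_mult_right)
    also have "\<dots> = (\<integral>\<^sup>+\<theta>\<in>{0..2*pi}. ennreal (?g \<theta> / (2 * pi)) \<partial>lborel)"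
      by (intro nn_integral_cong) (auto simp: indicator_def)
    finally show ?thesis .
  qed
  have eq: "ennreal (integral_mean p r f) \<le> ennreal B \<longleftrightarrow> ennreal (J r) \<le> ennreal (B powr p)" for r
    using enn_powr_le_iff[OF p B, of "ennreal (J r)"] J0[of r]
    by (simp add: enn_powr_def integral_mean_def J_def)
  have "Hardy_norm p f \<le> ennreal B \<longleftrightarrow> (\<forall>r\<in>{0<..<1}. ennreal (J r) \<le> ennreal (B powr p))"
    unfolding Hardy_norm_def SUP_le_iff eq ..
  also have "\<dots> \<longleftrightarrow> Hardy_power p f \<le> ennreal (B powr p)"
    unfolding Hardy_power_def SUP_le_iff using J by simp
  finally have iff: "Hardy_norm p f \<le> ennreal B \<longleftrightarrow> Hardy_power p f \<le> ennreal (B powr p)" .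
  show "Hardy_norm p f \<le> ennreal B \<Longrightarrow> Hardy_power p f \<le> ennreal (B powr p)"
    and "Hardy_power p f \<le> ennreal (B powr p) \<Longrightarrow> Hardy_norm p f \<le> ennreal B"
    using iff by simp_all
qed

section \<open>The maximum modulus as a function of the radius\<close>

lemma bdd_above_circle:
  assumes "f holomorphic_on ball 0 1" "0 \<le> r" "r < 1"
  shows "bdd_above ((\<lambda>\<theta>. norm (f (of_real r * cis \<theta>))) ` {0..2*pi})"
proof (rule bounded_imp_bdd_above, rule compact_imp_bounded, rule compact_continuous_image)
  show "continuous_on {0..2*pi} (\<lambda>\<theta>. norm (f (of_real r * cis \<theta>)))"
    using assms by (intro continuous_intros continuous_on_circle) auto
qed simp

lemma norm_le_max_modulus:
  assumes holf: "f holomorphic_on ball 0 1" and r: "norm z \<le> r" "r < 1"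
  shows "norm (f z) \<le> max_modulus r f"
proof -
  have r0: "0 \<le> r" using r norm_ge_zero[of z] by linarith
  have circ: "norm (f w) \<le> max_modulus r f" if wr: "norm w = r" for w
  proof -
    obtain \<theta> where \<theta>: "\<theta> \<in> {0..2*pi}" "w = of_real r * cis \<theta>"
    proof
      show "Arg2pi w \<in> {0..2*pi}" using Arg2pi_ge_0[of w] Arg2pi_lt_2pi[of w] by auto
      show "w = of_real r * cis (Arg2pi w)"
        using Arg2pi_eq[of w] by (simp add: cis_conv_exp wr)
    qed
    show ?thesis unfolding max_modulus_def \<theta>(2)
      by (rule cSUP_upper[OF \<theta>(1)]) (use bdd_above_circle[OF holf r0 r(2)] in auto)
  qed
  show ?thesis
  proof (cases "r = 0")
    case True then show ?thesis using circ[of z] r by simp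
  next
    case False
    have hol: "f holomorphic_on cball 0 r" by (rule holomorphic_on_subset[OF holf]) (use r in auto)
    show ?thesis
    proof (rule maximum_modulus_frontier[of f "cball 0 r"])
      show "f holomorphic_on interior (cball 0 r)" by (rule holomorphic_on_subset[OF hol]) auto
      show "continuous_on (closure (cball 0 r)) f" using holomorphic_on_imp_continuous_on[OF hol] by simp
    qed (use r circ False r0 in auto)
  qed
qed

lemma max_modulus_le:
  assumes "\<And>\<theta>. \<theta> \<in> {0..2*pi} \<Longrightarrow> norm (f (of_real r * cis \<theta>)) \<le> B"
  shows "max_modulus r f \<le> B"
  unfolding max_modulus_def using assms by (intro cSUP_least) auto

lemma max_modulus_nonneg:
  assumes "f holomorphic_on ball 0 1" "0 \<le> r" "r < 1"
  shows "0 \<le> max_modulus r f"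
  using norm_le_max_modulus[OF assms(1), of 0 r] assms norm_ge_zero[of "f 0"] by (metis norm_zero order_trans)

lemma max_modulus_mono:
  assumes "f holomorphic_on ball 0 1" "0 \<le> r" "r \<le> s" "s < 1"
  shows "max_modulus r f \<le> max_modulus s f"
  using assms by (intro max_modulus_le norm_le_max_modulus) (auto simp: norm_mult)

text \<open>The supremum runs over uncountably many angles. Measurability comes from monotonicity in
  \<open>r\<close>, that is, from the maximum principle.\<close>

lemma measurable_max_modulus:
  assumes holf: "f holomorphic_on ball 0 1"
  shows "(\<lambda>r. ennreal (max_modulus r f powr p) * indicator {0..<1} r) \<in> borel_measurable borel"
proof -
  have "mono_on {0..<1} (\<lambda>r. max_modulus r f)"
    by (intro mono_onI max_modulus_mono[OF holf]) auto
  then have "(\<lambda>r. max_modulus r f) \<in> borel_measurable (restrict_space borel {0..<1})"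
    by (rule borel_measurable_mono_on_fnc)
  then have [measurable]: "(\<lambda>r. indicator {0..<1} r *\<^sub>R max_modulus r f) \<in> borel_measurable borel"
    by (subst (asm) borel_measurable_restrict_space_iff) auto
  have "(\<lambda>r. ennreal ((indicator {0..<1} r *\<^sub>R max_modulus r f) powr p) * indicator {0..<1} r) \<in> borel_measurable borel"
    by measurable
  also have "(\<lambda>r. ennreal ((indicator {0..<1} r *\<^sub>R max_modulus r f) powr p) * indicator {0..<1} r) =
     (\<lambda>r. ennreal (max_modulus r f powr p) * indicator {0..<1} r)"
    by (auto simp: indicator_def)
  finally show ?thesis .
qed

section \<open>Quasilinearity of the four powers\<close>

lemma quasilinear_H_inf:
  assumes p: "p > 1"
  shows "quasilinear_power p (H_inf_power p)"
  unfolding quasilinear_power_def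
proof (intro conjI allI impI)
  fix f g h :: "complex \<Rightarrow> complex"
  assume hol: "f holomorphic_on ball 0 1" "g holomorphic_on ball 0 1" "h holomorphic_on ball 0 1"
    and eq: "\<forall>z\<in>ball 0 1. h z = f z + g z"
  have [measurable]: "(\<lambda>r. ennreal (max_modulus r f powr p) * indicator {0..<1} r) \<in> borel_measurable borel"
    "(\<lambda>r. ennreal (max_modulus r g powr p) * indicator {0..<1} r) \<in> borel_measurable borel"
    using hol by (auto intro: measurable_max_modulus)
  have "H_inf_power p h \<le> (\<integral>\<^sup>+r. ennreal (2 powr p) * (ennreal (max_modulus r f powr p) * indicator {0..<1} r + ennreal (max_modulus r g powr p) * indicator {0..<1} r) \<partial>lborel)"
    unfolding H_inf_power_def
  proof (rule nn_integral_mono)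
    fix r :: real
    show "ennreal (max_modulus r h powr p) * indicator {0..<1} r \<le>
      ennreal (2 powr p) * (ennreal (max_modulus r f powr p) * indicator {0..<1} r + ennreal (max_modulus r g powr p) * indicator {0..<1} r)"
    proof (cases "r \<in> {0..<1}")
      case True
      have "max_modulus r h \<le> max_modulus r f + max_modulus r g"
      proof (rule max_modulus_le)
        fix \<theta> :: real
        have "norm (of_real r * cis \<theta>) = r" using True by (simp add: norm_mult)
        then show "norm (h (of_real r * cis \<theta>)) \<le> max_modulus r f + max_modulus r g"
          using True eq hol by (auto intro!: norm_triangle_mono norm_le_max_modulus)
      qed
      then show ?thesis
        using ennreal_powr_add_le[of p "max_modulus r h" "max_modulus r f" "max_modulus r g" 1] True p hol
        by (auto intro!: max_modulus_nonneg)
    qed simp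
  qed
  also have "\<dots> = ennreal (2 powr p) * (H_inf_power p f + H_inf_power p g)"
    by (simp add: H_inf_power_def nn_integral_cmult nn_integral_add)
  finally show "H_inf_power p h \<le> ennreal (2 powr p) * (H_inf_power p f + H_inf_power p g)" .
next
  fix f h :: "complex \<Rightarrow> complex" and c
  assume hol: "f holomorphic_on ball 0 1" "h holomorphic_on ball 0 1" and eq: "\<forall>z\<in>ball 0 1. h z = c * f z"
  have [measurable]: "(\<lambda>r. ennreal (max_modulus r f powr p) * indicator {0..<1} r) \<in> borel_measurable borel"
    using hol by (auto intro: measurable_max_modulus)
  have "H_inf_power p h \<le> (\<integral>\<^sup>+r. ennreal (norm c powr p) * (ennreal (max_modulus r f powr p) * indicator {0..<1} r) \<partial>lborel)"
    unfolding H_inf_power_def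
  proof (rule nn_integral_mono)
    fix r :: real
    show "ennreal (max_modulus r h powr p) * indicator {0..<1} r \<le> ennreal (norm c powr p) * (ennreal (max_modulus r f powr p) * indicator {0..<1} r)"
    proof (cases "r \<in> {0..<1}")
      case True
      have "max_modulus r h \<le> norm c * max_modulus r f"
      proof (rule max_modulus_le)
        fix \<theta> :: real
        have "norm (of_real r * cis \<theta>) = r" using True by (simp add: norm_mult)
        then show "norm (h (of_real r * cis \<theta>)) \<le> norm c * max_modulus r f"
          using True eq hol by (auto simp: norm_mult intro!: mult_left_mono norm_le_max_modulus)
      qed
      then have "max_modulus r h powr p \<le> (norm c * max_modulus r f) powr p"
        using p True hol by (intro powr_mono2 max_modulus_nonneg) auto
      also have "\<dots> = norm c powr p * max_modulus r f powr p"
        using True hol by (simp add: powr_mult max_modulus_nonneg)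
      finally show ?thesis using True by (simp add: ennreal_mult[symmetric] ennreal_leI)
    qed simp
  qed
  also have "\<dots> = ennreal (norm c powr p) * H_inf_power p f"
    by (simp add: H_inf_power_def nn_integral_cmult)
  finally show "H_inf_power p h \<le> ennreal (norm c powr p) * H_inf_power p f" .
qed

lemma measurable_circle_powr:
  assumes "f holomorphic_on ball 0 1" "0 \<le> r" "r < 1"
  shows "(\<lambda>\<theta>. norm (f (of_real r * cis \<theta>)) powr p) \<in> borel_measurable borel"
proof -
  have [measurable]: "(\<lambda>\<theta>. f (of_real r * cis \<theta>)) \<in> borel_measurable borel"
    by (intro borel_measurable_continuous_onI continuous_on_circle[OF assms])
  show ?thesis by measurable
qed

lemma quasilinear_Hardy:
  assumes p: "p > 1"
  shows "quasilinear_power p (Hardy_power p)"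
  unfolding quasilinear_power_def
proof (intro conjI allI impI)
  fix f g h :: "complex \<Rightarrow> complex"
  assume hol: "f holomorphic_on ball 0 1" "g holomorphic_on ball 0 1" "h holomorphic_on ball 0 1"
    and eq: "\<forall>z\<in>ball 0 1. h z = f z + g z"
  let ?J = "\<lambda>f r. \<integral>\<^sup>+\<theta>\<in>{0..2*pi}. ennreal (norm (f (of_real r * cis \<theta>)) powr p / (2 * pi)) \<partial>lborel"
  have "?J h r \<le> ennreal (2 powr p) * (Hardy_power p f + Hardy_power p g)" if r: "r \<in> {0<..<1}" for r
  proof -
    have [measurable]: "(\<lambda>\<theta>. norm (f (of_real r * cis \<theta>)) powr p) \<in> borel_measurable borel"
       "(\<lambda>\<theta>. norm (g (of_real r * cis \<theta>)) powr p) \<in> borel_measurable borel"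
      using hol r by (auto intro: measurable_circle_powr)
    have "?J h r \<le> (\<integral>\<^sup>+\<theta>. ennreal (2 powr p) * (ennreal (norm (f (of_real r * cis \<theta>)) powr p / (2 * pi)) * indicator {0..2*pi} \<theta>
         + ennreal (norm (g (of_real r * cis \<theta>)) powr p / (2 * pi)) * indicator {0..2*pi} \<theta>) \<partial>lborel)"
    proof (rule nn_integral_mono)
      fix \<theta> :: real
      have "norm (of_real r * cis \<theta>) < 1" using r by (simp add: norm_mult)
      then have "norm (h (of_real r * cis \<theta>)) \<le> norm (f (of_real r * cis \<theta>)) + norm (g (of_real r * cis \<theta>))"
        using eq by (auto intro: norm_triangle_ineq)
      then show "ennreal (norm (h (of_real r * cis \<theta>)) powr p / (2 * pi)) * indicator {0..2*pi} \<theta> \<le>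
        ennreal (2 powr p) * (ennreal (norm (f (of_real r * cis \<theta>)) powr p / (2 * pi)) * indicator {0..2*pi} \<theta>
         + ennreal (norm (g (of_real r * cis \<theta>)) powr p / (2 * pi)) * indicator {0..2*pi} \<theta>)"
        using ennreal_powr_add_le[of p "norm (h (of_real r * cis \<theta>))" "norm (f (of_real r * cis \<theta>))" "norm (g (of_real r * cis \<theta>))" "1 / (2 * pi)"] p
        by (auto simp: indicator_def)
    qed
    also have "\<dots> = ennreal (2 powr p) * (?J f r + ?J g r)"
      by (simp add: nn_integral_cmult nn_integral_add)
    also have "\<dots> \<le> ennreal (2 powr p) * (Hardy_power p f + Hardy_power p g)"
      unfolding Hardy_power_def using r by (intro mult_left_mono add_mono SUP_upper) auto
    finally show ?thesis .
  qed
  then show "Hardy_power p h \<le> ennreal (2 powr p) * (Hardy_power p f + Hardy_power p g)"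
    unfolding Hardy_power_def[of p h] by (intro SUP_least) auto
next
  fix f h :: "complex \<Rightarrow> complex" and c
  assume hol: "f holomorphic_on ball 0 1" "h holomorphic_on ball 0 1" and eq: "\<forall>z\<in>ball 0 1. h z = c * f z"
  let ?J = "\<lambda>f r. \<integral>\<^sup>+\<theta>\<in>{0..2*pi}. ennreal (norm (f (of_real r * cis \<theta>)) powr p / (2 * pi)) \<partial>lborel"
  have "?J h r \<le> ennreal (norm c powr p) * Hardy_power p f" if r: "r \<in> {0<..<1}" for r
  proof -
    have [measurable]: "(\<lambda>\<theta>. norm (f (of_real r * cis \<theta>)) powr p) \<in> borel_measurable borel"
      using hol r by (auto intro: measurable_circle_powr)
    have "?J h r = (\<integral>\<^sup>+\<theta>. ennreal (norm c powr p) * (ennreal (norm (f (of_real r * cis \<theta>)) powr p / (2 * pi)) * indicator {0..2*pi} \<theta>) \<partial>lborel)"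
    proof (rule nn_integral_cong)
      fix \<theta> :: real
      have "norm (of_real r * cis \<theta>) < 1" using r by (simp add: norm_mult)
      then show "ennreal (norm (h (of_real r * cis \<theta>)) powr p / (2 * pi)) * indicator {0..2*pi} \<theta> =
        ennreal (norm c powr p) * (ennreal (norm (f (of_real r * cis \<theta>)) powr p / (2 * pi)) * indicator {0..2*pi} \<theta>)"
        using eq by (auto simp: indicator_def ennreal_mult[symmetric] norm_mult powr_mult)
    qed
    also have "\<dots> = ennreal (norm c powr p) * ?J f r"
      by (simp add: nn_integral_cmult)
    also have "\<dots> \<le> ennreal (norm c powr p) * Hardy_power p f"
      unfolding Hardy_power_def using r by (intro mult_left_mono SUP_upper) auto
    finally show ?thesis .
  qed
  then show "Hardy_power p h \<le> ennreal (norm c powr p) * Hardy_power p f"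
    unfolding Hardy_power_def[of p h] by (intro SUP_least) auto
qed

lemma measurable_Dirichlet_integrand:
  assumes "f holomorphic_on ball 0 1" "p > 0"
  shows "(\<lambda>z. ennreal (norm (deriv f z) powr p * (1 - norm z) powr q) * indicator (ball 0 1) z) \<in> borel_measurable borel"
proof -
  have "continuous_on (ball 0 1) (deriv f)"
    using assms by (intro holomorphic_on_imp_continuous_on holomorphic_deriv) auto
  then have "(\<lambda>z. ennreal (indicator (ball 0 1) z *\<^sub>R (norm (deriv f z) powr p * (1 - norm z) powr q))) \<in> borel_measurable borel"
    using assms by (intro measurable_compose[OF _ measurable_ennreal] borel_measurable_continuous_on_indicator
          continuous_intros continuous_on_powr') auto
  also have "(\<lambda>z. ennreal (indicator (ball 0 1) z *\<^sub>R (norm (deriv f z) powr p * (1 - norm z) powr q))) =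
     (\<lambda>z. ennreal (norm (deriv f z) powr p * (1 - norm z) powr q) * indicator (ball 0 1) z)"
    by (auto simp: indicator_def)
  finally show ?thesis .
qed

lemma quasilinear_Dirichlet:
  assumes p: "p > 1"
  shows "quasilinear_power p (Dirichlet_power p)"
  unfolding quasilinear_power_def
proof (intro conjI allI impI)
  fix f g h :: "complex \<Rightarrow> complex"
  assume hol: "f holomorphic_on ball 0 1" "g holomorphic_on ball 0 1" "h holomorphic_on ball 0 1"
    and eq: "\<forall>z\<in>ball 0 1. h z = f z + g z"
  let ?D = "\<lambda>f z. ennreal (norm (deriv f z) powr p * (1 - norm z) powr (p - 1)) * indicator (ball 0 1) z"
  have [measurable]: "?D f \<in> borel_measurable borel" "?D g \<in> borel_measurable borel"
    using hol p by (auto intro: measurable_Dirichlet_integrand)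
  have d: "deriv h z = deriv f z + deriv g z" if "z \<in> ball 0 1" for z
  proof -
    have "deriv h z = deriv (\<lambda>z. f z + g z) z"
      by (rule deriv_cong_ev[OF eventually_nhds_in_open[of "ball 0 1", THEN eventually_mono]]) (use that eq in auto)
    also have "\<dots> = deriv f z + deriv g z"
      using hol that by (intro deriv_add) (auto simp: holomorphic_on_open field_differentiable_def)
    finally show ?thesis .
  qed
  have "(\<integral>\<^sup>+z. ?D h z \<partial>lborel) \<le> (\<integral>\<^sup>+z. ennreal (2 powr p) * (?D f z + ?D g z) \<partial>lborel)"
  proof (rule nn_integral_mono)
    fix z :: complex
    show "?D h z \<le> ennreal (2 powr p) * (?D f z + ?D g z)"
    proof (cases "z \<in> ball 0 1")
      case True
      then have "norm (deriv h z) \<le> norm (deriv f z) + norm (deriv g z)"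
        unfolding d[OF True] by (rule_tac norm_triangle_ineq)
      then show ?thesis
        using ennreal_powr_add_le[of p "norm (deriv h z)" "norm (deriv f z)" "norm (deriv g z)" "(1 - norm z) powr (p - 1)"] True p by simp
    qed simp
  qed
  also have "\<dots> = ennreal (2 powr p) * (integral\<^sup>N lborel (?D f) + integral\<^sup>N lborel (?D g))"
    by (simp add: nn_integral_cmult nn_integral_add)
  finally have 1: "integral\<^sup>N lborel (?D h) \<le> ennreal (2 powr p) * (integral\<^sup>N lborel (?D f) + integral\<^sup>N lborel (?D g))" .
  have "norm (h 0) \<le> norm (f 0) + norm (g 0)" using eq by (simp add: norm_triangle_ineq)
  then have 2: "ennreal (norm (h 0) powr p) \<le> ennreal (2 powr p) * (ennreal (norm (f 0) powr p) + ennreal (norm (g 0) powr p))"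
    using ennreal_powr_add_le[of p "norm (h 0)" "norm (f 0)" "norm (g 0)" 1] p by simp
  have "Dirichlet_power p h \<le> ennreal (2 powr p) * (ennreal (norm (f 0) powr p) + ennreal (norm (g 0) powr p))
     + ennreal (1 / pi) * (ennreal (2 powr p) * (integral\<^sup>N lborel (?D f) + integral\<^sup>N lborel (?D g)))"
    unfolding Dirichlet_power_def[of p h] by (intro add_mono mult_left_mono 1 2) auto
  also have "\<dots> = ennreal (2 powr p) * (Dirichlet_power p f + Dirichlet_power p g)"
    unfolding Dirichlet_power_def by (simp add: distrib_left mult_ac add_ac)
  finally show "Dirichlet_power p h \<le> ennreal (2 powr p) * (Dirichlet_power p f + Dirichlet_power p g)" .
next
  fix f h :: "complex \<Rightarrow> complex" and c
  assume hol: "f holomorphic_on ball 0 1" "h holomorphic_on ball 0 1" and eq: "\<forall>z\<in>ball 0 1. h z = c * f z"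
  let ?D = "\<lambda>f z. ennreal (norm (deriv f z) powr p * (1 - norm z) powr (p - 1)) * indicator (ball 0 1) z"
  have [measurable]: "?D f \<in> borel_measurable borel"
    using hol p by (auto intro: measurable_Dirichlet_integrand)
  have d: "deriv h z = c * deriv f z" if "z \<in> ball 0 1" for z
  proof -
    have "deriv h z = deriv (\<lambda>z. c * f z) z"
      by (rule deriv_cong_ev[OF eventually_nhds_in_open[of "ball 0 1", THEN eventually_mono]]) (use that eq in auto)
    also have "\<dots> = c * deriv f z"
      using hol that by (intro deriv_cmult) (auto simp: holomorphic_on_open field_differentiable_def)
    finally show ?thesis .
  qed
  have "integral\<^sup>N lborel (?D h) = (\<integral>\<^sup>+z. ennreal (norm c powr p) * ?D f z \<partial>lborel)"
    using d by (intro nn_integral_cong) (auto simp: indicator_def ennreal_mult[symmetric] norm_mult powr_mult mult_ac)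
  then have 1: "integral\<^sup>N lborel (?D h) = ennreal (norm c powr p) * integral\<^sup>N lborel (?D f)"
    by (simp add: nn_integral_cmult)
  have 2: "ennreal (norm (h 0) powr p) = ennreal (norm c powr p) * ennreal (norm (f 0) powr p)"
    using eq by (simp add: norm_mult powr_mult ennreal_mult)
  show "Dirichlet_power p h \<le> ennreal (norm c powr p) * Dirichlet_power p f"
    unfolding Dirichlet_power_def 1 2 by (simp add: distrib_left mult_ac)
qed

lemma taylor_coeff_sums:
  assumes "f holomorphic_on ball 0 1" "z \<in> ball 0 1"
  shows "(\<lambda>n. taylor_coeff f n * z ^ n) sums f z"
  using holomorphic_power_series[OF assms] by (simp add: taylor_coeff_def)

lemma taylor_coeff_eqI:
  assumes "\<And>z. z \<in> ball 0 1 \<Longrightarrow> (\<lambda>n. e n * z ^ n) sums f z"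
  shows "taylor_coeff f n = e n"
proof -
  have "f has_fps_expansion Abs_fps e"
    by (rule has_fps_expansionI[OF eventually_nhds_in_open[of "ball 0 1", THEN eventually_mono]]) (use assms in auto)
  from fps_nth_fps_expansion[OF this, of n] show ?thesis by (simp add: taylor_coeff_def)
qed

lemma quasilinear_HL:
  assumes p: "p > 1"
  shows "quasilinear_power p (HL_power p)"
  unfolding quasilinear_power_def
proof (intro conjI allI impI)
  fix f g h :: "complex \<Rightarrow> complex"
  assume hol: "f holomorphic_on ball 0 1" "g holomorphic_on ball 0 1" "h holomorphic_on ball 0 1"
    and eq: "\<forall>z\<in>ball 0 1. h z = f z + g z"
  have tc: "taylor_coeff h n = taylor_coeff f n + taylor_coeff g n" for n
    using eq sums_add[OF taylor_coeff_sums[OF hol(1)] taylor_coeff_sums[OF hol(2)]]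
    by (intro taylor_coeff_eqI) (auto simp: distrib_right)
  have "HL_power p h \<le> (\<Sum>n. ennreal (2 powr p) * (ennreal (norm (taylor_coeff f n) powr p * (real n + 1) powr (p - 2))
      + ennreal (norm (taylor_coeff g n) powr p * (real n + 1) powr (p - 2))))"
    unfolding HL_power_def using p
    by (intro suminf_le ennreal_powr_add_le) (auto simp: tc norm_triangle_ineq)
  also have "\<dots> = ennreal (2 powr p) * (HL_power p f + HL_power p g)"
    by (simp add: HL_power_def suminf_add[symmetric] ennreal_suminf_cmult)
  finally show "HL_power p h \<le> ennreal (2 powr p) * (HL_power p f + HL_power p g)" .
next
  fix f h :: "complex \<Rightarrow> complex" and c
  assume hol: "f holomorphic_on ball 0 1" "h holomorphic_on ball 0 1" and eq: "\<forall>z\<in>ball 0 1. h z = c * f z"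
  have tc: "taylor_coeff h n = c * taylor_coeff f n" for n
    using eq sums_mult[OF taylor_coeff_sums[OF hol(1)]] by (intro taylor_coeff_eqI) (auto simp: mult_ac)
  have "HL_power p h = (\<Sum>n. ennreal (norm c powr p) * ennreal (norm (taylor_coeff f n) powr p * (real n + 1) powr (p - 2)))"
    unfolding HL_power_def by (simp add: tc norm_mult powr_mult ennreal_mult[symmetric] mult_ac)
  then show "HL_power p h \<le> ennreal (norm c powr p) * HL_power p f"
    by (simp add: HL_power_def ennreal_suminf_cmult)
qed

section \<open>Power series with cubically decaying coefficients\<close>

lemma summable_inverse_Suc_power: "k \<ge> 2 \<Longrightarrow> summable (\<lambda>n. 1 / (real n + 1) ^ k)"
  using summable_Suc_iff[of "\<lambda>n. inverse (real n ^ k)"] inverse_power_summable[of k, where 'a = real]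
  by (simp add: inverse_eq_divide add.commute)

lemma small_series_norm_le:
  fixes f :: "complex \<Rightarrow> complex"
  assumes sums: "\<And>z. z \<in> ball 0 1 \<Longrightarrow> (\<lambda>n. e n * z ^ n) sums f z"
    and e: "\<And>n. norm (e n) \<le> 1 / (real n + 1) ^ k" and k: "k \<ge> 2" and z: "z \<in> ball 0 1"
  shows "norm (f z) \<le> (\<Sum>n. 1 / (real n + 1) ^ k)"
proof -
  have le: "norm (e n * z ^ n) \<le> 1 / (real n + 1) ^ k" for n
  proof -
    have "norm (e n) * norm z ^ n \<le> 1 / (real n + 1) ^ k * 1"
      using z by (intro mult_mono e power_le_one) auto
    then show ?thesis by (simp add: norm_mult norm_power)
  qed
  have "norm (\<Sum>n. e n * z ^ n) \<le> (\<Sum>n. 1 / (real n + 1) ^ k)"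
    using le k by (intro norm_suminf_le summable_inverse_Suc_power) auto
  then show ?thesis using sums[OF z] by (simp add: sums_iff)
qed

lemma bounded_on_small_series_H_inf:
  assumes p: "p > 1"
  shows "bounded_on_small_series (H_inf_power p)"
proof -
  define S where "S = (\<Sum>n. 1 / (real n + 1) ^ 3)"
  show ?thesis unfolding bounded_on_small_series_def
  proof (intro exI allI impI)
    fix f e assume hol: "f holomorphic_on ball 0 1" and sums: "\<forall>z\<in>ball 0 1. (\<lambda>n. e n * z ^ n) sums f z"
      and e: "\<forall>n. norm (e n) \<le> 1 / (real n + 1) ^ 3"
    have le: "norm (f z) \<le> S" if "z \<in> ball 0 1" for z
      unfolding S_def using sums e that by (intro small_series_norm_le[of e f 3]) auto
    have "H_inf_power p f \<le> (\<integral>\<^sup>+r. ennreal (S powr p) * indicator {0..<1::real} r \<partial>lborel)"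
      unfolding H_inf_power_def
    proof (intro nn_integral_mono)
      fix r :: real
      show "ennreal (max_modulus r f powr p) * indicator {0..<1} r \<le> ennreal (S powr p) * indicator {0..<1} r"
      proof (cases "r \<in> {0..<1}")
        case True
        have "max_modulus r f \<le> S" using True by (intro max_modulus_le le) (auto simp: norm_mult)
        then show ?thesis using p True max_modulus_nonneg[OF hol, of r] by (auto intro!: ennreal_leI powr_mono2)
      qed simp
    qed
    then show "H_inf_power p f \<le> ennreal (S powr p)" by (simp add: nn_integral_cmult_indicator)
  qed
qed

lemma bounded_on_small_series_Hardy:
  assumes p: "p > 1"
  shows "bounded_on_small_series (Hardy_power p)"
proof -
  define S where "S = (\<Sum>n. 1 / (real n + 1) ^ 3)"
  show ?thesis unfolding bounded_on_small_series_def
  proof (intro exI allI impI)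
    fix f e assume hol: "f holomorphic_on ball 0 1" and sums: "\<forall>z\<in>ball 0 1. (\<lambda>n. e n * z ^ n) sums f z"
      and e: "\<forall>n. norm (e n) \<le> 1 / (real n + 1) ^ 3"
    have le: "norm (f z) \<le> S" if "z \<in> ball 0 1" for z
      unfolding S_def using sums e that by (intro small_series_norm_le[of e f 3]) auto
    show "Hardy_power p f \<le> ennreal (S powr p)"
      unfolding Hardy_power_def
    proof (intro SUP_least)
      fix r :: real assume r: "r \<in> {0<..<1}"
      have "(\<integral>\<^sup>+\<theta>\<in>{0..2*pi}. ennreal (norm (f (of_real r * cis \<theta>)) powr p / (2 * pi)) \<partial>lborel)
        \<le> (\<integral>\<^sup>+\<theta>. ennreal (S powr p / (2 * pi)) * indicator {0..2*pi} \<theta> \<partial>lborel)"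
        using p r by (intro nn_integral_mono mult_right_mono ennreal_leI divide_right_mono powr_mono2 le) (auto simp: norm_mult)
      also have "\<dots> = ennreal (S powr p)"
        by (subst nn_integral_cmult_indicator) (auto simp: ennreal_mult[symmetric])
      finally show "(\<integral>\<^sup>+\<theta>\<in>{0..2*pi}. ennreal (norm (f (of_real r * cis \<theta>)) powr p / (2 * pi)) \<partial>lborel) \<le> ennreal (S powr p)" .
    qed
  qed
qed

lemma bounded_on_small_series_Dirichlet:
  assumes p: "p > 1"
  shows "bounded_on_small_series (Dirichlet_power p)"
proof -
  define S where "S = (\<Sum>n. 1 / (real n + 1) ^ 2)"
  show ?thesis unfolding bounded_on_small_series_def
  proof (intro exI allI impI)
    fix f e assume hol: "f holomorphic_on ball 0 1" and sums: "\<forall>z\<in>ball 0 1. (\<lambda>n. e n * z ^ n) sums f z"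
      and e: "\<forall>n. norm (e n) \<le> 1 / (real n + 1) ^ 3"
    have "(\<lambda>n. diffs e n * z ^ n) sums deriv f z" if "z \<in> ball 0 1" for z
      by (rule termdiffs_sums_strong[of 1 e f]) (use sums that hol holomorphic_derivI[OF hol] in auto)
    \<comment> \<open>This is where one power is lost: the factor \<open>n + 1\<close> turns the
      cube into a square, which still sums to a bound for \<open>deriv f\<close>.\<close>
    moreover have "norm (diffs e n) \<le> 1 / (real n + 1) ^ 2" for n
    proof -
      have "norm (diffs e n) = (real n + 1) * norm (e (Suc n))"
        unfolding diffs_def norm_mult by (simp add: norm_of_nat del: of_nat_Suc)
      also have "\<dots> \<le> (real n + 1) * (1 / (real (Suc n) + 1) ^ 3)" using e[rule_format, of "Suc n"] by (intro mult_left_mono) auto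
      also have "\<dots> \<le> (real n + 1) * (1 / (real n + 1) ^ 3)" by (intro mult_left_mono divide_left_mono power_mono) auto
      also have "\<dots> = 1 / (real n + 1) ^ 2" by (simp add: power3_eq_cube power2_eq_square)
      finally show ?thesis .
    qed
    ultimately have le: "norm (deriv f z) \<le> S" if "z \<in> ball 0 1" for z
      unfolding S_def using that by (intro small_series_norm_le[of "diffs e" "deriv f" 2]) auto
    have "f 0 = e 0" using sums[rule_format, of 0] by (simp add: sums_iff powser_zero)
    then have "norm (f 0) powr p \<le> 1 powr p" using e[rule_format, of 0] p by (intro powr_mono2) auto
    then have 1: "ennreal (norm (f 0) powr p) \<le> ennreal 1" by (intro ennreal_leI) simp
    have "(\<integral>\<^sup>+z\<in>ball 0 1. ennreal (norm (deriv f z) powr p * (1 - norm z) powr (p - 1)) \<partial>lborel)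
       \<le> (\<integral>\<^sup>+z. ennreal (S powr p) * indicator (ball 0 1) (z :: complex) \<partial>lborel)"
    proof (intro nn_integral_mono)
      fix z :: complex
      show "ennreal (norm (deriv f z) powr p * (1 - norm z) powr (p - 1)) * indicator (ball 0 1) z \<le> ennreal (S powr p) * indicator (ball 0 1) z"
      proof (cases "z \<in> ball 0 1")
        case True
        have "norm (deriv f z) powr p * (1 - norm z) powr (p - 1) \<le> S powr p * 1"
          using p True le[OF True] by (intro mult_mono powr_mono2 powr_le1) auto
        then show ?thesis using True by (simp add: ennreal_leI)
      qed simp
    qed
    also have "\<dots> = ennreal (S powr p * pi)"
      by (subst nn_integral_cmult_indicator) (auto simp: emeasure_ball unit_ball_vol_2 ennreal_mult)
    finally have 2: "(\<integral>\<^sup>+z\<in>ball 0 1. ennreal (norm (deriv f z) powr p * (1 - norm z) powr (p - 1)) \<partial>lborel) \<le> ennreal (S powr p * pi)" .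
    have "Dirichlet_power p f \<le> ennreal 1 + ennreal (1 / pi) * ennreal (S powr p * pi)"
      unfolding Dirichlet_power_def by (intro add_mono mult_left_mono 1 2) auto
    also have "\<dots> = ennreal (1 + S powr p)"
      by (subst ennreal_plus) (auto simp: ennreal_mult[symmetric])
    finally show "Dirichlet_power p f \<le> ennreal (1 + S powr p)" .
  qed
qed

lemma bounded_on_small_series_HL:
  assumes p: "p > 1"
  shows "bounded_on_small_series (HL_power p)"
proof -
  define S where "S = (\<Sum>n. 1 / (real n + 1) ^ 2)"
  show ?thesis unfolding bounded_on_small_series_def
  proof (intro exI allI impI)
    fix f e assume hol: "f holomorphic_on ball 0 1" and sums: "\<forall>z\<in>ball 0 1. (\<lambda>n. e n * z ^ n) sums f z"
      and e: "\<forall>n. norm (e n) \<le> 1 / (real n + 1) ^ 3"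
    have tc: "taylor_coeff f n = e n" for n using sums by (intro taylor_coeff_eqI) auto
    have le: "norm (taylor_coeff f n) powr p * (real n + 1) powr (p - 2) \<le> 1 / (real n + 1) ^ 2" for n
    proof -
      have "norm (e n) powr p \<le> ((real n + 1) powr (-3)) powr p"
        using p e[rule_format, of n] by (intro powr_mono2) (auto simp: powr_minus powr_numeral field_simps)
      then have "norm (taylor_coeff f n) powr p * (real n + 1) powr (p - 2) \<le> ((real n + 1) powr (-3)) powr p * (real n + 1) powr (p - 2)"
        unfolding tc by (intro mult_right_mono) auto
      \<comment> \<open>The exponents \<open>-3 * p\<close> and \<open>p - 2\<close> add up to this
        one.\<close>
      also have "\<dots> = (real n + 1) powr (-2 * p - 2)"
        by (simp add: powr_powr powr_add[symmetric])
      also have "\<dots> \<le> (real n + 1) powr (-2)" using p by (intro powr_mono) auto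
      also have "\<dots> = 1 / (real n + 1) ^ 2" by (simp add: powr_minus powr_numeral field_simps)
      finally show ?thesis .
    qed
    have "HL_power p f \<le> (\<Sum>n. ennreal (1 / (real n + 1) ^ 2))"
      unfolding HL_power_def by (intro suminf_le ennreal_leI le) auto
    also have "\<dots> = ennreal S"
      unfolding S_def by (intro suminf_ennreal2 summable_inverse_Suc_power) auto
    finally show "HL_power p f \<le> ennreal S" .
  qed
qed

subsection \<open>Restriction to the radius\<close>

definition radial_embedding :: "real \<Rightarrow> ((complex \<Rightarrow> complex) \<Rightarrow> ennreal) \<Rightarrow> bool" where
  "radial_embedding p V \<longleftrightarrow> (\<exists>C\<ge>0. \<forall>f. f holomorphic_on ball 0 1 \<longrightarrow>
     (\<integral>\<^sup>+t\<in>{0..<1}. ennreal (norm (f (of_real t)) powr p) \<partial>lborel) \<le> ennreal C * V f)"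

text \<open>The exponent 2 is a crude one that serves all four spaces; the spikes can be made thin
  enough to absorb it.\<close>

definition radial_growth :: "real \<Rightarrow> ((complex \<Rightarrow> complex) \<Rightarrow> ennreal) \<Rightarrow> bool" where
  "radial_growth p V \<longleftrightarrow> (\<exists>C\<ge>0. \<forall>f. f holomorphic_on ball 0 1 \<longrightarrow>
     (\<forall>t\<in>{0..<1}. ennreal (norm (f (of_real t)) powr p) \<le> ennreal (C * (1 - t) powr (- 2 * p)) * V f))"

lemma powr_growth_mono:
  fixes t a b :: real
  assumes "0 \<le> t" "t < 1" "a \<le> b"
  shows "(1 - t) powr (- a) \<le> (1 - t) powr (- b)"
  using assms powr_mono'[of "-b" "-a" "1 - t"] by simp

lemma radial_embedding_H_inf: "p > 0 \<Longrightarrow> radial_embedding p (H_inf_power p)"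
  unfolding radial_embedding_def H_inf_power_def
  by (rule exI[of _ 1])
     (auto intro!: nn_integral_mono ennreal_leI powr_mono2 norm_le_max_modulus split: split_indicator)

text \<open>On \<open>[t,1)\<close>, an interval of length \<open>1 - t\<close>, the maximum modulus
  stays above \<open>|f(t)|\<close>. This gives the power \<open>-1\<close> of \<open>1 - t\<close>,
  which is then weakened to \<open>-2 p\<close>.\<close>

lemma radial_growth_H_inf:
  assumes p: "p > 1"
  shows "radial_growth p (H_inf_power p)"
  unfolding radial_growth_def
proof (intro exI[of _ 1] conjI allI impI ballI)
  fix f and t :: real assume hol: "f holomorphic_on ball 0 1" and t: "t \<in> {0..<1}"
  have "ennreal (norm (f t) powr p) * ennreal (1 - t) = (\<integral>\<^sup>+s. ennreal (norm (f t) powr p) * indicator {t..<1} s \<partial>lborel)"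
    using t by (subst nn_integral_cmult_indicator) auto
  also have "\<dots> \<le> H_inf_power p f"
    unfolding H_inf_power_def using t p
    by (auto intro!: nn_integral_mono ennreal_leI powr_mono2 norm_le_max_modulus[OF hol] split: split_indicator)
  finally have "ennreal ((1 - t) powr (-1)) * (ennreal (norm (f t) powr p) * ennreal (1 - t)) \<le> ennreal ((1 - t) powr (-1)) * H_inf_power p f"
    by (rule mult_left_mono) simp
  moreover have "ennreal ((1 - t) powr (-1)) * (ennreal (norm (f t) powr p) * ennreal (1 - t)) = ennreal (norm (f t) powr p)"
  proof -
    define c where "c = (1 - t) powr (-1)"
    have "c * (norm (f t) powr p * (1 - t)) = norm (f t) powr p" and "c \<ge> 0"
      using t by (simp_all add: c_def powr_minus divide_inverse)
    then show ?thesis using t by (simp add: c_def[symmetric] ennreal_mult[symmetric])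
  qed
  moreover have "(1 - t) powr (-1) \<le> (1 - t) powr (-(2 * p))"
    using t p by (intro powr_growth_mono) auto
  ultimately show "ennreal (norm (f t) powr p) \<le> ennreal (1 * (1 - t) powr (- 2 * p)) * H_inf_power p f"
    by (auto elim!: order_trans intro!: mult_right_mono ennreal_leI)
qed simp

section \<open>The Fejer-Riesz inequality and growth in Hardy spaces\<close>

text \<open>Jordan's inequality with \<open>1 / pi\<close> in place of \<open>2 / pi\<close>. Up to
  \<open>pi / 6\<close> the mean value theorem applies with cosine at least \<open>1/2\<close>;
  beyond, the sine is at least \<open>1/2\<close> and \<open>x / pi\<close> at most
  \<open>1/2\<close>.\<close>

lemma sin_ge_linear:
  fixes x :: real
  assumes "0 \<le> x" "x \<le> pi / 2"
  shows "x / pi \<le> sin x"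
proof (cases "x \<le> pi / 6")
  case True
  show ?thesis
  proof (cases "x = 0")
    case False
    then have "0 < x" using assms by simp
    then obtain z where z: "0 < z" "z < x" "sin x - sin 0 = (x - 0) * cos z"
      using MVT2[of 0 x sin cos] DERIV_sin by blast
    have "cos (pi / 3) \<le> cos z" using z True by (intro cos_monotone_0_pi_le) auto
    then have "x * (1 / 2) \<le> x * cos z" using \<open>0 < x\<close> by (intro mult_left_mono) (auto simp: cos_60)
    moreover have "x / pi \<le> x * (1 / 2)" using \<open>0 < x\<close> pi_gt3 by (simp add: field_simps)
    moreover have "sin x = x * cos z" using z by simp
    ultimately show ?thesis by linarith
  qed simp
next
  case False
  have "sin (pi / 6) \<le> sin x" using False assms by (intro sin_monotone_2pi_le) auto
  moreover have "x / pi \<le> 1 / 2" using assms by (simp add: field_simps)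
  ultimately show ?thesis unfolding sin_30 by linarith
qed

text \<open>The distance dominates both the radial gap and the arc from angle 0, up to constants.
  Thus the Cauchy kernel on the circle is controlled by \<open>1 / (x + y)\<close> with
  \<open>x\<close> the gap and \<open>y\<close> the arc. Each of the two is at most
  \<open>2 * pi\<close> times the norm, whence \<open>4 * pi\<close>; for the arc this uses
  \<open>1/2 \<le> r\<close>.\<close>

lemma circle_dist_ge:
  fixes r u \<theta> :: real
  assumes r: "1 / 2 \<le> r" "0 \<le> u" "u \<le> r" and \<theta>: "\<theta> \<in> {0..2*pi}"
  shows "r - u + min \<theta> (2*pi - \<theta>) \<le> 4 * pi * norm (of_real r * cis \<theta> - of_real u)"
proof -
  define m where "m = min \<theta> (2*pi - \<theta>)"
  have m: "0 \<le> m" "m \<le> pi" using \<theta> by (auto simp: m_def)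
  have cm: "cos \<theta> = cos m" "\<bar>sin \<theta>\<bar> = sin m"
    using m sin_ge_zero[of m] by (auto simp: m_def min_def sin_diff cos_diff split: if_splits)
  let ?N = "norm (of_real r * cis \<theta> - of_real u)"
  have N2: "?N\<^sup>2 = (r * cos \<theta> - u)\<^sup>2 + (r * sin \<theta>)\<^sup>2"
    by (simp add: cmod_power2)
  have 1: "r - u \<le> ?N"
    using norm_triangle_ineq2[of "of_real r * cis \<theta>" "of_real u"] r by (simp add: norm_mult)
  \<comment> \<open>On the near half of the circle the imaginary part is large enough; on the far
    half the cosine is at most 0 and the distance is at least \<open>r\<close>.\<close>
  have 2: "r * m / pi \<le> ?N"
  proof (cases "m \<le> pi / 2")
    case True
    have "r * (m / pi) \<le> r * sin m" using sin_ge_linear[of m] True m r by (intro mult_left_mono) auto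
    also have "\<dots> = \<bar>Im (of_real r * cis \<theta> - of_real u)\<bar>" using cm r by (simp add: abs_mult)
    also have "\<dots> \<le> ?N" by (rule abs_Im_le_cmod)
    finally show ?thesis by simp
  next
    case False
    then have "cos m \<le> 0" using m by (intro cos_lt_zero_pi[THEN less_imp_le]) auto
    then have "0 \<le> - (2 * r * u * cos \<theta>)" using cm r by (simp add: mult_nonneg_nonpos)
    have "?N\<^sup>2 = r\<^sup>2 + u\<^sup>2 - 2 * r * u * cos \<theta>"
      unfolding N2 by (simp add: power2_diff power_mult_distrib sin_squared_eq algebra_simps)
    then have "r\<^sup>2 \<le> ?N\<^sup>2" using \<open>0 \<le> - (2 * r * u * cos \<theta>)\<close> zero_le_power2[of u] by linarith
    then have "r \<le> ?N" using norm_ge_zero power2_le_imp_le by blast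
    moreover have "r * m / pi \<le> r" using m r by (simp add: field_simps)
    ultimately show ?thesis by simp
  qed
  have "m \<le> 2 * r * m" using r m mult_right_mono[of 1 "2 * r" m] by simp
  also have "\<dots> \<le> 2 * pi * ?N" using 2 by (simp add: field_simps)
  finally have 3: "m \<le> 2 * pi * ?N" .
  have "1 * ?N \<le> 2 * pi * ?N" using pi_gt3 by (intro mult_right_mono) auto
  then show ?thesis using 1 3 by (simp add: m_def)
qed

lemma nn_integral_exhaust_unit_interval:
  fixes h :: "real \<Rightarrow> ennreal"
  assumes [measurable]: "h \<in> borel_measurable borel"
    and le: "\<And>r. r0 \<le> r \<Longrightarrow> r < 1 \<Longrightarrow> (\<integral>\<^sup>+t\<in>{0..<r}. h t \<partial>lborel) \<le> B" and r0: "r0 < 1"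
  shows "(\<integral>\<^sup>+t\<in>{0..<1}. h t \<partial>lborel) \<le> B"
proof -
  define A where "A = (\<lambda>n::nat. {0..<1 - (1 - r0) / (real n + 1)})"
  have inc: "incseq A" unfolding A_def incseq_def using r0 by (auto intro!: divide_left_mono elim!: less_le_trans)
  have un: "(\<Union>n. A n) = {0..<1}"
  proof (intro equalityI subsetI)
    fix t :: real assume t: "t \<in> {0..<1}"
    obtain n :: nat where "(1 - r0) / (1 - t) < real n" using reals_Archimedean2 by blast
    then have "1 - r0 < real n * (1 - t)" using t by (simp add: field_simps)
    also have "\<dots> \<le> (real n + 1) * (1 - t)" using t by (intro mult_right_mono) auto
    finally have "(1 - r0) / (real n + 1) < 1 - t" by (simp add: field_simps)
    then show "t \<in> (\<Union>n. A n)" using t by (auto simp: A_def intro!: exI[of _ n])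
  next
    fix t assume "t \<in> (\<Union>n. A n)"
    then obtain n where t: "t \<in> A n" by auto
    have "0 < (1 - r0) / (real n + 1)" using r0 by simp
    then show "t \<in> {0..<1}" using t by (auto simp: A_def)
  qed
  have [measurable]: "A n \<in> sets borel" for n by (simp add: A_def)
  have "(\<integral>\<^sup>+t\<in>{0..<1}. h t \<partial>lborel) = emeasure (density lborel h) (\<Union>n. A n)"
    by (simp add: un emeasure_density)
  also have "\<dots> = (SUP n. emeasure (density lborel h) (A n))"
    using inc by (intro SUP_emeasure_incseq[symmetric]) auto
  also have "\<dots> \<le> B"
  proof (rule SUP_least)
    fix n
    have "(1 - r0) / (real n + 1) \<le> (1 - r0) / 1" using r0 by (intro divide_left_mono) auto
    moreover have "0 < (1 - r0) / (real n + 1)" using r0 by simp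
    ultimately show "emeasure (density lborel h) (A n) \<le> B"
      by (simp add: emeasure_density A_def le)
  qed
  finally show ?thesis .
qed

lemma nn_integral_lborel_reflect:
  fixes h :: "real \<Rightarrow> ennreal"
  assumes [measurable]: "h \<in> borel_measurable borel"
  shows "(\<integral>\<^sup>+x. h (a - x) \<partial>lborel) = (\<integral>\<^sup>+x. h x \<partial>lborel)"
  using nn_integral_real_affine[of h "-1" a] by simp

lemma measurable_radial:
  assumes "f holomorphic_on ball 0 1"
  shows "(\<lambda>t. indicator {0..<1} t *\<^sub>R f (of_real t)) \<in> borel_measurable borel"
  by (intro borel_measurable_continuous_on_indicator continuous_on_compose2[OF holomorphic_on_imp_continuous_on[OF assms]]
      continuous_intros) auto

text \<open>In the variable \<open>x = r - t\<close> the Cauchy kernel on the circle of radius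
  \<open>r\<close> is dominated by the Hilbert kernel, and Hilbert's inequality bounds the radial
  integral by the circle mean. The constant does not depend on \<open>r\<close>, so \<open>r\<close>
  may tend to 1 although \<open>f\<close> need not extend to the boundary.\<close>

lemma Fejer_Riesz_radius:
  assumes p: "p > 1" and hol: "f holomorphic_on ball 0 1" and r: "1 / 2 \<le> r" "r < 1"
  shows "(\<integral>\<^sup>+t\<in>{0..<r}. ennreal (norm (f (of_real t)) powr p) \<partial>lborel)
     \<le> ennreal ((p / (p - 1) + p) powr p * (4 powr p * 4 * pi)) * Hardy_power p f"
proof -
  define G where "G = (\<lambda>\<theta>. norm (f (of_real r * cis \<theta>)))"
  have [measurable]: "G \<in> borel_measurable borel"
    unfolding G_def by (intro borel_measurable_continuous_onI continuous_intros continuous_on_circle[OF hol]) (use r in auto)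
  have G0: "G \<theta> \<ge> 0" for \<theta> by (simp add: G_def)
  define F where "F = (\<lambda>x. if x \<le> r then norm (f (of_real (r - x))) else 0)"
  \<comment> \<open>The arc to angle 0 may be \<open>\<theta>\<close> or
    \<open>2*pi - \<theta>\<close>; adding the reflected function covers both. The factor 2 is
    \<open>4 * pi\<close> from the distance estimate divided by \<open>2 * pi\<close> from Cauchy's
    formula.\<close>
  define g where "g = (\<lambda>y. indicator {0..2*pi} y * (2 * (G y + G (2*pi - y))))"
  have [measurable]: "g \<in> borel_measurable borel" unfolding g_def by measurable
  define IG where "IG = (\<integral>\<^sup>+\<theta>\<in>{0..2*pi}. ennreal (G \<theta> powr p / (2 * pi)) \<partial>lborel)"
  have IG: "IG \<le> Hardy_power p f"
    unfolding IG_def G_def Hardy_power_def using r by (intro SUP_upper) auto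
  have FI: "ennreal (F x) \<le> (\<integral>\<^sup>+y. ennreal (indicator {0<..} y * (g y / (x + y))) \<partial>lborel)" if x: "x > 0" for x
  proof (cases "x \<le> r")
    case True
    have "ennreal (norm (f (of_real (r - x)))) \<le> (\<integral>\<^sup>+\<theta>. ennreal (indicator {0..2*pi} \<theta> *
           (r / (2 * pi * norm (of_real r * cis \<theta> - (of_real (r - x) - 0))) * norm (f (0 + of_real r * cis \<theta>)))) \<partial>lborel)"
      by (rule Cauchy_norm_le_circle_integral[OF hol])
         (use r x True in \<open>auto simp: norm_mult norm_of_real simp flip: of_real_diff\<close>)
    also have "\<dots> \<le> (\<integral>\<^sup>+\<theta>. ennreal (indicator {0..2*pi} \<theta> * (2 * G \<theta> / (x + \<theta>)))
         + ennreal (indicator {0..2*pi} (2*pi - \<theta>) * (2 * G \<theta> / (x + (2*pi - \<theta>)))) \<partial>lborel)"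
    proof (rule nn_integral_mono)
      fix \<theta> :: real
      show "ennreal (indicator {0..2*pi} \<theta> *
           (r / (2 * pi * norm (of_real r * cis \<theta> - (of_real (r - x) - 0))) * norm (f (0 + of_real r * cis \<theta>)))) \<le>
        ennreal (indicator {0..2*pi} \<theta> * (2 * G \<theta> / (x + \<theta>)))
         + ennreal (indicator {0..2*pi} (2*pi - \<theta>) * (2 * G \<theta> / (x + (2*pi - \<theta>))))"
      proof (cases "\<theta> \<in> {0..2*pi}")
        case \<theta>: True
        let ?N = "norm (of_real r * cis \<theta> - of_real (r - x))"
        define m where "m = min \<theta> (2*pi - \<theta>)"
        have m: "0 \<le> m" using \<theta> by (auto simp: m_def)
        have N: "x + m \<le> 4 * pi * ?N"
          using circle_dist_ge[of r "r - x" \<theta>] r True x \<theta> by (simp add: m_def)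
        have "0 < x + m" using x m by simp
        then have N0: "0 < ?N" using N pi_gt_zero by (smt (verit) mult_nonneg_nonpos)
        have "r / (2 * pi * ?N) \<le> 1 / (2 * pi * ?N)" using r N0 by (intro divide_right_mono) auto
        also have "\<dots> \<le> 2 / (x + m)" using N N0 \<open>0 < x + m\<close> by (simp add: field_simps)
        also have "\<dots> \<le> 2 / (x + \<theta>) + 2 / (x + (2*pi - \<theta>))"
          using \<theta> x by (auto simp: m_def min_def intro: add_increasing add_increasing2)
        finally have "r / (2 * pi * ?N) * G \<theta> \<le> (2 / (x + \<theta>) + 2 / (x + (2*pi - \<theta>))) * G \<theta>"
          by (intro mult_right_mono G0)
        also have "\<dots> = 2 * G \<theta> / (x + \<theta>) + 2 * G \<theta> / (x + (2*pi - \<theta>))"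
          by (simp add: distrib_right)
        finally show ?thesis
          using \<theta> x G0[of \<theta>] by (simp add: G_def[symmetric] fun_cong[OF G_def, symmetric] ennreal_plus[symmetric] ennreal_leI del: ennreal_plus)
      qed simp
    qed
    also have "\<dots> = (\<integral>\<^sup>+\<theta>. ennreal (indicator {0..2*pi} \<theta> * (2 * G \<theta> / (x + \<theta>))) \<partial>lborel)
         + (\<integral>\<^sup>+\<theta>. ennreal (indicator {0..2*pi} (2*pi - \<theta>) * (2 * G \<theta> / (x + (2*pi - \<theta>)))) \<partial>lborel)"
      by (rule nn_integral_add) measurable
    also have "(\<integral>\<^sup>+\<theta>. ennreal (indicator {0..2*pi} (2*pi - \<theta>) * (2 * G \<theta> / (x + (2*pi - \<theta>)))) \<partial>lborel)
       = (\<integral>\<^sup>+\<theta>. ennreal (indicator {0..2*pi} \<theta> * (2 * G (2*pi - \<theta>) / (x + \<theta>))) \<partial>lborel)"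
      using nn_integral_lborel_reflect[of "\<lambda>\<theta>. ennreal (indicator {0..2*pi} \<theta> * (2 * G (2*pi - \<theta>) / (x + \<theta>)))" "2*pi"]
      by simp
    also have "(\<integral>\<^sup>+\<theta>. ennreal (indicator {0..2*pi} \<theta> * (2 * G \<theta> / (x + \<theta>))) \<partial>lborel) + \<dots>
       = (\<integral>\<^sup>+\<theta>. ennreal (indicator {0..2*pi} \<theta> * (2 * G \<theta> / (x + \<theta>))) + ennreal (indicator {0..2*pi} \<theta> * (2 * G (2*pi - \<theta>) / (x + \<theta>))) \<partial>lborel)"
      by (rule nn_integral_add[symmetric]) measurable
    also have "\<dots> = (\<integral>\<^sup>+y. ennreal (indicator {0<..} y * (g y / (x + y))) \<partial>lborel)"
    \<comment> \<open>The integrands may differ at \<open>y = 0\<close>, where one indicator is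
      closed and the other open.\<close>
    proof (rule nn_integral_cong_AE, rule AE_I[of _ _ "{0}"])
      show "{y \<in> space lborel. \<not> ennreal (indicator {0..2*pi} y * (2 * G y / (x + y))) + ennreal (indicator {0..2*pi} y * (2 * G (2*pi - y) / (x + y)))
          = ennreal (indicator {0<..} y * (g y / (x + y)))} \<subseteq> {0}"
        using x G0 by (auto simp: g_def indicator_def ennreal_plus[symmetric] add_divide_distrib distrib_left simp del: ennreal_plus split: if_splits)
    qed auto
    finally show ?thesis using True by (simp add: F_def)
  qed (simp add: F_def)
  define R where "R = (\<lambda>t. indicator {0..<1} t *\<^sub>R f (of_real t))"
  have [measurable]: "R \<in> borel_measurable borel" unfolding R_def by (rule measurable_radial[OF hol])
  have "(\<integral>\<^sup>+t\<in>{0..<r}. ennreal (norm (f (of_real t)) powr p) \<partial>lborel)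
     = (\<integral>\<^sup>+t. ennreal (norm (R t) powr p) * indicator {0..<r} t \<partial>lborel)"
    using r by (intro nn_integral_cong) (auto simp: indicator_def R_def)
  also have "\<dots> = (\<integral>\<^sup>+x. ennreal (norm (R (r - x)) powr p) * indicator {0..<r} (r - x) \<partial>lborel)"
    by (rule nn_integral_lborel_reflect[symmetric, where h = "\<lambda>t. ennreal (norm (R t) powr p) * indicator {0..<r} t"]) measurable
  also have "\<dots> \<le> (\<integral>\<^sup>+x. ennreal (F x powr p) * indicator {0<..} x \<partial>lborel)"
    by (intro nn_integral_mono) (auto simp: F_def R_def indicator_def)
  also have "\<dots> \<le> ennreal ((p / (p - 1) + p) powr p) * (\<integral>\<^sup>+y. ennreal (g y powr p) * indicator {0<..} y \<partial>lborel)"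
    by (rule Hilbert_inequality[OF p _ _ _ FI]) (auto simp: F_def g_def G0)
  also have "(\<integral>\<^sup>+y. ennreal (g y powr p) * indicator {0<..} y \<partial>lborel)
     \<le> (\<integral>\<^sup>+y. ennreal (4 powr p * (2 * pi)) * (ennreal (G y powr p / (2 * pi)) * indicator {0..2*pi} y + ennreal (G (2*pi - y) powr p / (2 * pi)) * indicator {0..2*pi} (2*pi - y)) \<partial>lborel)"
  proof (rule nn_integral_mono)
    fix y :: real
    show "ennreal (g y powr p) * indicator {0<..} y \<le> ennreal (4 powr p * (2 * pi)) * (ennreal (G y powr p / (2 * pi)) * indicator {0..2*pi} y + ennreal (G (2*pi - y) powr p / (2 * pi)) * indicator {0..2*pi} (2*pi - y))"
    proof (cases "y \<in> {0..2*pi}")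
      case True
      have "g y powr p \<le> 2 powr p * ((2 * G y) powr p + (2 * G (2*pi - y)) powr p)"
        using True p G0 by (intro powr_add_le) (auto simp: g_def)
      also have "\<dots> = 4 powr p * (G y powr p + G (2*pi - y) powr p)"
        using powr_mult[of 2 2 p] by (simp add: powr_mult G0 distrib_left)
      also have "\<dots> = 4 powr p * (2 * pi) * (G y powr p / (2 * pi) + G (2*pi - y) powr p / (2 * pi))"
        by (simp add: field_simps)
      finally have "ennreal (g y powr p) \<le> ennreal (4 powr p * (2 * pi)) * (ennreal (G y powr p / (2 * pi)) + ennreal (G (2*pi - y) powr p / (2 * pi)))"
        by (simp add: ennreal_plus[symmetric] ennreal_mult[symmetric] ennreal_leI del: ennreal_plus)
      then show ?thesis using True by (auto simp: indicator_def)
    qed (simp add: g_def)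
  qed
  also have "\<dots> = ennreal (4 powr p * (2 * pi)) * (IG + (\<integral>\<^sup>+y. ennreal (G (2*pi - y) powr p / (2 * pi)) * indicator {0..2*pi} (2*pi - y) \<partial>lborel))"
    unfolding IG_def by (subst nn_integral_cmult, measurable, subst nn_integral_add) auto
  also have "(\<integral>\<^sup>+y. ennreal (G (2*pi - y) powr p / (2 * pi)) * indicator {0..2*pi} (2*pi - y) \<partial>lborel) = IG"
    unfolding IG_def by (rule nn_integral_lborel_reflect[where h = "\<lambda>y. ennreal (G y powr p / (2 * pi)) * indicator {0..2*pi} y"]) measurable
  also have "IG + IG = ennreal 2 * IG" by (simp add: mult_2)
  also have "ennreal ((p / (p - 1) + p) powr p) * (ennreal (4 powr p * (2 * pi)) * (ennreal 2 * IG)) =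
     ennreal ((p / (p - 1) + p) powr p * (4 powr p * 4 * pi)) * IG"
  proof -
    have "(p / (p - 1) + p) powr p * (4 powr p * 4 * pi) = (p / (p - 1) + p) powr p * ((4 powr p * (2 * pi)) * 2)" by simp
    then show ?thesis by (simp only: ennreal_mult mult.assoc powr_ge_zero) (simp add: ennreal_mult mult_ac)
  qed
  also have "\<dots> \<le> ennreal ((p / (p - 1) + p) powr p * (4 powr p * 4 * pi)) * Hardy_power p f"
    by (intro mult_left_mono IG) simp
  finally show ?thesis by (simp add: mult_left_mono)
qed

lemma radial_embedding_Hardy:
  assumes p: "p > 1"
  shows "radial_embedding p (Hardy_power p)"
  unfolding radial_embedding_def
proof (intro exI conjI allI impI)
  fix f assume hol: "f holomorphic_on ball 0 1"
  define R where "R = (\<lambda>t. indicator {0..<1} t *\<^sub>R f (of_real t))"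
  have [measurable]: "R \<in> borel_measurable borel" unfolding R_def by (rule measurable_radial[OF hol])
  let ?h = "\<lambda>t. ennreal (norm (R t) powr p)"
  have "(\<integral>\<^sup>+t\<in>{0..<1}. ?h t \<partial>lborel) \<le> ennreal ((p / (p - 1) + p) powr p * (4 powr p * 4 * pi)) * Hardy_power p f"
  proof (rule nn_integral_exhaust_unit_interval[of _ "1/2"])
    fix r :: real assume r: "1 / 2 \<le> r" "r < 1"
    have "(\<integral>\<^sup>+t\<in>{0..<r}. ?h t \<partial>lborel) = (\<integral>\<^sup>+t\<in>{0..<r}. ennreal (norm (f (of_real t)) powr p) \<partial>lborel)"
      using r by (intro nn_integral_cong) (auto simp: R_def indicator_def)
    then show "(\<integral>\<^sup>+t\<in>{0..<r}. ?h t \<partial>lborel) \<le> ennreal ((p / (p - 1) + p) powr p * (4 powr p * 4 * pi)) * Hardy_power p f"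
      using Fejer_Riesz_radius[OF p hol r] by simp
  qed simp_all
  also have "(\<integral>\<^sup>+t\<in>{0..<1}. ?h t \<partial>lborel) = (\<integral>\<^sup>+t\<in>{0..<1}. ennreal (norm (f (of_real t)) powr p) \<partial>lborel)"
    by (intro nn_integral_cong) (auto simp: R_def indicator_def)
  finally show "(\<integral>\<^sup>+t\<in>{0..<1}. ennreal (norm (f (of_real t)) powr p) \<partial>lborel) \<le> ennreal ((p / (p - 1) + p) powr p * (4 powr p * 4 * pi)) * Hardy_power p f" .
qed simp

text \<open>Cauchy's formula is taken on the circle of radius \<open>(1 + t) / 2\<close>, whose
  distance from \<open>t\<close> is \<open>(1 - t) / 2\<close>. The kernel is then at most
  \<open>2 / (1 - t)\<close>, and Hoelder's inequality gives the power \<open>-p\<close> of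
  \<open>1 - t\<close>.\<close>

lemma radial_growth_Hardy:
  assumes p: "p > 1"
  shows "radial_growth p (Hardy_power p)"
  unfolding radial_growth_def
proof (intro exI[of _ "2 powr p"] conjI allI impI ballI)
  fix f and t :: real assume hol: "f holomorphic_on ball 0 1" and t: "t \<in> {0..<1}"
  define r where "r = (1 + t) / 2"
  have r: "0 < r" "r < 1" "t < r" "r - t = (1 - t) / 2" using t by (auto simp: r_def field_simps)
  let ?G = "\<lambda>\<theta>. norm (f (of_real r * cis \<theta>))"
  have [measurable]: "?G \<in> borel_measurable borel"
    by (intro borel_measurable_continuous_onI continuous_intros continuous_on_circle[OF hol]) (use r in auto)
  have "ennreal (norm (f (of_real t))) \<le> (\<integral>\<^sup>+\<theta>. ennreal (indicator {0..2*pi} \<theta> *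
           (r / (2 * pi * norm (of_real r * cis \<theta> - (of_real t - 0))) * norm (f (0 + of_real r * cis \<theta>)))) \<partial>lborel)"
    by (rule Cauchy_norm_le_circle_integral[OF hol]) (use r t in auto)
  also have "\<dots> \<le> (\<integral>\<^sup>+\<theta>. ennreal (indicator {0..2*pi} \<theta> / (2 * pi) * (2 / (1 - t) * ?G \<theta>)) \<partial>lborel)"
  proof (rule nn_integral_mono, rule ennreal_leI)
    fix \<theta> :: real
    have "(1 - t) / 2 \<le> norm (of_real r * cis \<theta> - of_real t)"
      using norm_triangle_ineq2[of "of_real r * cis \<theta>" "of_real t"] r t by (simp add: norm_mult)
    then have "r / norm (of_real r * cis \<theta> - of_real t) \<le> 1 / ((1 - t) / 2)"
      using r t by (intro frac_le) auto
    then have "indicator {0..2*pi} \<theta> / (2 * pi) * (r / norm (of_real r * cis \<theta> - of_real t) * ?G \<theta>) \<le> indicator {0..2*pi} \<theta> / (2 * pi) * (2 / (1 - t) * ?G \<theta>)"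
      by (intro mult_left_mono mult_right_mono) auto
    then show "indicator {0..2*pi} \<theta> * (r / (2 * pi * norm (of_real r * cis \<theta> - (of_real t - 0))) * norm (f (0 + of_real r * cis \<theta>)))
        \<le> indicator {0..2*pi} \<theta> / (2 * pi) * (2 / (1 - t) * ?G \<theta>)"
      by (simp add: mult_ac)
  qed
  finally have le: "ennreal (norm (f (of_real t))) \<le> (\<integral>\<^sup>+\<theta>. ennreal (indicator {0..2*pi} \<theta> / (2 * pi) * (2 / (1 - t) * ?G \<theta>)) \<partial>lborel)" .
  have "(\<integral>\<^sup>+\<theta>. ennreal (indicator {0..2*pi} \<theta> / (2 * pi) * 1) \<partial>lborel) = (\<integral>\<^sup>+\<theta>. ennreal (1 / (2 * pi)) * indicator {0..2*pi} \<theta> \<partial>lborel)"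
    by (intro nn_integral_cong) (auto simp: indicator_def)
  also have "\<dots> = ennreal 1" by (subst nn_integral_cmult_indicator) (auto simp: ennreal_mult[symmetric])
  finally have one: "(\<integral>\<^sup>+\<theta>. ennreal (indicator {0..2*pi} \<theta> / (2 * pi) * 1) \<partial>lborel) \<le> ennreal 1" by simp
  have "ennreal (norm (f (of_real t)) powr p) \<le> ennreal (1 powr (p - 1)) * (\<integral>\<^sup>+\<theta>. ennreal (indicator {0..2*pi} \<theta> / (2 * pi) * ((2 / (1 - t) * ?G \<theta>) powr p * 1 powr (1 - p))) \<partial>lborel)"
    by (rule weighted_Holder[OF p _ _ _ _ _ _ _ le one]) (use t in auto)
  also have "\<dots> = (\<integral>\<^sup>+\<theta>. ennreal ((2 / (1 - t)) powr p) * (ennreal (?G \<theta> powr p / (2 * pi)) * indicator {0..2*pi} \<theta>) \<partial>lborel)"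
  proof -
    have "(2 / (1 - t) * ?G \<theta>) powr p = (2 / (1 - t)) powr p * ?G \<theta> powr p" for \<theta>
      by (rule powr_mult)
    then have "indicator {0..2*pi} \<theta> / (2 * pi) * ((2 / (1 - t) * ?G \<theta>) powr p * 1 powr (1 - p))
       = (2 / (1 - t)) powr p * (?G \<theta> powr p / (2 * pi) * indicator {0..2*pi} \<theta>)" for \<theta>
      by (simp only:) simp
    then show ?thesis
      by (simp only:) (auto intro!: nn_integral_cong simp: ennreal_mult[symmetric] indicator_def)
  qed
  also have "\<dots> = ennreal ((2 / (1 - t)) powr p) * (\<integral>\<^sup>+\<theta>\<in>{0..2*pi}. ennreal (?G \<theta> powr p / (2 * pi)) \<partial>lborel)"
    by (rule nn_integral_cmult) measurable
  also have "\<dots> \<le> ennreal (2 powr p * (1 - t) powr (- 2 * p)) * Hardy_power p f"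
  proof (rule mult_mono)
    show "(\<integral>\<^sup>+\<theta>\<in>{0..2*pi}. ennreal (?G \<theta> powr p / (2 * pi)) \<partial>lborel) \<le> Hardy_power p f"
      unfolding Hardy_power_def using r by (intro SUP_upper) auto
    have "(2 / (1 - t)) powr p = 2 powr p * (1 - t) powr (-p)"
      using t by (simp add: powr_divide powr_minus_divide)
    also have "\<dots> \<le> 2 powr p * (1 - t) powr (-(2 * p))"
      using t p by (intro mult_left_mono powr_growth_mono) auto
    finally show "ennreal ((2 / (1 - t)) powr p) \<le> ennreal (2 powr p * (1 - t) powr (- 2 * p))"
      by (intro ennreal_leI) simp
  qed auto
  finally show "ennreal (norm (f (of_real t)) powr p) \<le> ennreal (2 powr p * (1 - t) powr (- 2 * p)) * Hardy_power p f" .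
qed simp

subsection \<open>The Hardy--Littlewood space on the radius\<close>

text \<open>Used twice for functions that are built block by block: Taylor coefficients spread over
  intervals, and trains of spikes.\<close>

lemma nn_integral_partition:
  fixes N :: "'a \<Rightarrow> nat"
  assumes [measurable]: "N \<in> measurable M (count_space UNIV)" "\<And>n. H n \<in> borel_measurable M"
  shows "(\<integral>\<^sup>+x. H (N x) x \<partial>M) = (\<Sum>n. \<integral>\<^sup>+x. H n x * indicator {x. N x = n} x \<partial>M)"
proof -
  have "H (N x) x = (\<Sum>n. H n x * indicator {x. N x = n} x)" for x
    by (subst suminf_finite[of "{N x}"]) auto
  then have "(\<integral>\<^sup>+x. H (N x) x \<partial>M) = (\<integral>\<^sup>+x. (\<Sum>n. H n x * indicator {x. N x = n} x) \<partial>M)" by simp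
  also have "\<dots> = (\<Sum>n. \<integral>\<^sup>+x. H n x * indicator {x. N x = n} x \<partial>M)"
    by (rule nn_integral_suminf) measurable
  finally show ?thesis .
qed

text \<open>The floor is at least 1 on \<open>(0,1]\<close>, so the truncated subtraction loses
  nothing and the blocks are numbered from 0.\<close>

lemma nat_floor_inverse_eq_iff:
  fixes y :: real
  assumes "0 < y" "y \<le> 1"
  shows "nat \<lfloor>1 / y\<rfloor> - 1 = n \<longleftrightarrow> y \<in> {1 / (real n + 2)<..1 / (real n + 1)}"
proof -
  have "1 \<le> 1 / y" using assms by simp
  then have "1 \<le> \<lfloor>1 / y\<rfloor>" by (simp add: le_floor_iff)
  then have "nat \<lfloor>1 / y\<rfloor> - 1 = n \<longleftrightarrow> \<lfloor>1 / y\<rfloor> = int n + 1" by linarith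
  also have "\<dots> \<longleftrightarrow> real n + 1 \<le> 1 / y \<and> 1 / y < real n + 2"
    by (simp add: floor_eq_iff add.commute)
  also have "\<dots> \<longleftrightarrow> y \<in> {1 / (real n + 2)<..1 / (real n + 1)}"
    using assms by (auto simp: field_simps)
  finally show ?thesis .
qed

text \<open>One term of the Hardy-Littlewood sum already bounds its coefficient. The resulting
  exponent \<open>(2 - p) / p\<close> of \<open>n + 1\<close> is rounded up to 1.\<close>

lemma powr_mult_Suc_le:
  fixes b v p :: real
  assumes p: "p > 1" and b: "b \<ge> 0" and v: "v \<ge> 0" and le: "b powr p * (real n + 1) powr (p - 2) \<le> v"
  shows "b \<le> v powr (1 / p) * (real n + 1)"
proof -
  have "(real n + 1) powr (p - 2) * (real n + 1) powr (2 - p) = 1"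
    by (subst powr_add[symmetric]) simp
  then have "b powr p = (b powr p * (real n + 1) powr (p - 2)) * (real n + 1) powr (2 - p)"
    by (simp only: mult.assoc mult_1_right)
  also have "\<dots> \<le> v * (real n + 1) powr p"
    using p le v b by (intro mult_mono powr_mono) auto
  finally have "(b powr p) powr (1 / p) \<le> (v * (real n + 1) powr p) powr (1 / p)"
    using p by (intro powr_mono2) auto
  then show ?thesis using p b v by (simp add: powr_powr powr_mult)
qed

lemma ennreal_le_suminf: "f n \<le> suminf f" for f :: "nat \<Rightarrow> ennreal"
  using sum_le_suminf[of f "{n}"] by simp

text \<open>Coefficients of size \<open>n + 1\<close> sum to \<open>(1 - t)^(-2)\<close>, the
  derivative of the geometric series; the exponent in \<open>radial_growth\<close> fits this case
  exactly.\<close>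

lemma radial_growth_HL:
  assumes p: "p > 1"
  shows "radial_growth p (HL_power p)"
  unfolding radial_growth_def
proof (intro exI[of _ 1] conjI allI impI ballI)
  fix f and t :: real assume hol: "f holomorphic_on ball 0 1" and t: "t \<in> {0..<1}"
  show "ennreal (norm (f (of_real t)) powr p) \<le> ennreal (1 * (1 - t) powr (- 2 * p)) * HL_power p f"
  proof (cases "HL_power p f")
    case top
    have "(1 - t) powr (- 2 * p) > 0" using t by simp
    then have "ennreal (1 * (1 - t) powr (- 2 * p)) * HL_power p f = top"
      unfolding top by (subst ennreal_mult_top) simp_all
    then show ?thesis by (simp only: top_greatest)
  next
    case (real v)
    have coeff: "norm (taylor_coeff f n) \<le> v powr (1 / p) * (real n + 1)" for n
    proof -
      have "ennreal (norm (taylor_coeff f n) powr p * (real n + 1) powr (p - 2)) \<le> HL_power p f"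
        unfolding HL_power_def by (rule ennreal_le_suminf)
      then have "norm (taylor_coeff f n) powr p * (real n + 1) powr (p - 2) \<le> v"
        unfolding real(2) by (subst (asm) ennreal_le_iff) (rule real(1))
      then show ?thesis
        by (intro powr_mult_Suc_le p real(1) norm_ge_zero)
    qed
    have geo: "(\<lambda>n. v powr (1 / p) * (real (Suc n) * t ^ n)) sums (v powr (1 / p) * (1 / (1 - t)\<^sup>2))"
      by (intro sums_mult geometric_deriv_sums) (use t in auto)
    have "norm (\<Sum>n. taylor_coeff f n * of_real t ^ n) \<le> (\<Sum>n. v powr (1 / p) * (real (Suc n) * t ^ n))"
    proof (rule norm_suminf_le)
      fix n
      have "norm (taylor_coeff f n) * t ^ n \<le> (v powr (1 / p) * (real n + 1)) * t ^ n"
        using t by (intro mult_right_mono coeff) auto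
      then show "norm (taylor_coeff f n * of_real t ^ n) \<le> v powr (1 / p) * (real (Suc n) * t ^ n)"
        using t by (simp add: norm_mult norm_power mult.assoc add.commute)
    qed (use geo in \<open>simp add: sums_iff\<close>)
    then have "norm (f (of_real t)) \<le> v powr (1 / p) * (1 / (1 - t)\<^sup>2)"
      using geo taylor_coeff_sums[OF hol, of "of_real t"] t by (simp add: sums_iff)
    also have "1 / (1 - t)\<^sup>2 = (1 - t) powr (-2)"
      using t powr_numeral[of "1 - t" num.One] by (simp add: powr_minus_divide)
    finally have "norm (f (of_real t)) powr p \<le> (v powr (1 / p) * (1 - t) powr (-2)) powr p"
      using p by (intro powr_mono2) auto
    also have "\<dots> = (1 - t) powr (- 2 * p) * v"
      using p real(1) by (simp only: powr_mult powr_powr) simp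
    finally show ?thesis using real by (simp add: ennreal_mult[symmetric] ennreal_leI)
  qed
qed simp

lemma radial_embedding_HL:
  assumes p: "p > 1"
  shows "radial_embedding p (HL_power p)"
  unfolding radial_embedding_def
proof (intro exI conjI allI impI)
  fix f assume hol: "f holomorphic_on ball 0 1"
  define b where "b n = norm (taylor_coeff f n)" for n
  have b0: "b n \<ge> 0" for n by (simp add: b_def)
  \<comment> \<open>Since \<open>(n + 1) (1 - x)^n \<le> 2 / (x + 1/(n+1))\<close>, spreading the \<open>n\<close>-th coefficient over the interval
      \<open>(1/(n+2), 1/(n+1)]\<close> turns the power series into an integral against the Hilbert kernel.\<close>
  define N where "N = (\<lambda>y::real. nat \<lfloor>1 / y\<rfloor> - 1)"
  have [measurable]: "N \<in> measurable borel (count_space UNIV)" unfolding N_def by measurable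
  define g where "g = (\<lambda>y. indicator {0<..1} y * (4 * b (N y) * (real (N y) + 1)))"
  have [measurable]: "g \<in> borel_measurable borel" unfolding g_def by measurable
  let ?J = "\<lambda>n::nat. {1 / (real n + 2)<..1 / (real n + 1)}"
  have J: "indicator {0<..1} y * indicator {x. N x = n} y = (indicator (?J n) y :: ennreal)" for n y
  proof (cases "0 < y \<and> y \<le> 1")
    case True
    then show ?thesis using nat_floor_inverse_eq_iff[of y n] by (simp add: N_def indicator_def)
  next
    case False
    have "1 / (real n + 1) \<le> 1" "0 < 1 / (real n + 2)" by auto
    then have "y \<notin> ?J n" using False unfolding greaterThanAtMost_iff by linarith
    then show ?thesis using False by (auto simp: indicator_def)
  qed
  have part: "(\<integral>\<^sup>+y. indicator {0<..1} y * H (N y) y \<partial>lborel) = (\<Sum>n. \<integral>\<^sup>+y. H n y * indicator (?J n) y \<partial>lborel)"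
    if [measurable]: "\<And>n. H n \<in> borel_measurable borel" for H :: "nat \<Rightarrow> real \<Rightarrow> ennreal"
  proof -
    have "(\<integral>\<^sup>+y. indicator {0<..1} y * H (N y) y \<partial>lborel) = (\<Sum>n. \<integral>\<^sup>+y. indicator {0<..1} y * H n y * indicator {x. N x = n} y \<partial>lborel)"
      by (rule nn_integral_partition[where H = "\<lambda>n y. indicator {0<..1} y * H n y"]) measurable
    also have "\<dots> = (\<Sum>n. \<integral>\<^sup>+y. H n y * indicator (?J n) y \<partial>lborel)"
      by (intro suminf_cong nn_integral_cong) (simp add: J[symmetric] mult_ac)
    finally show ?thesis .
  qed
  have len: "emeasure lborel (?J n) = ennreal (1 / ((real n + 1) * (real n + 2)))" for n
  proof -
    have "1 / (real n + 2) \<le> 1 / (real n + 1)" by (intro divide_left_mono) auto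
    moreover have "1 / (real n + 1) - 1 / (real n + 2) = 1 / ((real n + 1) * (real n + 2))"
      by (simp add: field_simps)
    ultimately show ?thesis by simp
  qed
  define F where "F = (\<lambda>x. if x \<le> 1 then norm (f (of_real (1 - x))) else 0)"
  have FI: "ennreal (F x) \<le> (\<integral>\<^sup>+y. ennreal (indicator {0<..} y * (g y / (x + y))) \<partial>lborel)" if x: "x > 0" for x
  proof (cases "x \<le> 1")
    case True
    have sums: "(\<lambda>n. taylor_coeff f n * of_real (1 - x) ^ n) sums f (of_real (1 - x))"
      using x True by (intro taylor_coeff_sums[OF hol]) (auto simp del: of_real_diff)
    have term_le: "ennreal (norm (taylor_coeff f n * of_real (1 - x) ^ n)) \<le> (\<integral>\<^sup>+y. ennreal (4 * b n * (real n + 1) / (x + y)) * indicator (?J n) y \<partial>lborel)" for n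
    proof -
      let ?d = "4 * b n * (real n + 1) / (x + 1 / (real n + 1))"
      \<comment> \<open>By Bernoulli's inequality \<open>(1 - x)^n\<close> decays at least like
        \<open>1 / (1 + n * x)\<close>. This discrete kernel becomes the Hilbert kernel when
        \<open>1 / (n + 1)\<close> is read as \<open>y\<close>.\<close>
      have "(1 - x) ^ n * (1 + real n * x) \<le> (1 - x) ^ n * (1 + x) ^ n"
        using x True Bernoulli_inequality[of x n] by (intro mult_left_mono) auto
      also have "\<dots> = (1 - x * x) ^ n" by (simp add: power_mult_distrib[symmetric] algebra_simps)
      also have "\<dots> \<le> 1" using x True by (intro power_le_one) (auto simp: mult_le_one)
      finally have B: "(1 - x) ^ n * (1 + real n * x) \<le> 1" .
      have "(1 - x) ^ n * ((real n + 1) * x + 1) = (1 - x) ^ n * (1 + real n * x) + (1 - x) ^ n * x"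
        by (simp add: algebra_simps)
      also have "\<dots> \<le> 1 + 1 * 1" using x True B by (intro add_mono mult_mono power_le_one) auto
      finally have B2: "(1 - x) ^ n * ((real n + 1) * x + 1) \<le> 2" by simp
      define k D where "k = real n + 1" and "D = k * x + 1"
      have k: "k > 0" by (simp add: k_def)
      have D: "D > 0" using x k by (simp add: D_def add_pos_pos)
      have "x + 1 / k = D / k" using k by (simp add: D_def field_simps)
      then have eq: "?d = 4 * b n * k\<^sup>2 / D" by (simp add: k_def[symmetric] power2_eq_square)
      have "(1 - x) ^ n \<le> 2 / D" using B2 D by (simp add: pos_le_divide_eq D_def k_def)
      then have "b n * (1 - x) ^ n \<le> b n * (2 / D)" by (rule mult_left_mono) (rule b0)
      \<comment> \<open>The factor 4 in \<open>g\<close> is made of the 2 just obtained and of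
        another 2 from \<open>n + 2 \<le> 2 * k\<close>: the length of the block is at least
        \<open>1 / (k * (2 * k))\<close>.\<close>
      also have "\<dots> = 4 * b n * k\<^sup>2 / D * (1 / (k * (2 * k)))"
        using k by (simp add: power2_eq_square)
      also have "\<dots> \<le> 4 * b n * k\<^sup>2 / D * (1 / ((real n + 1) * (real n + 2)))"
        using D b0 by (intro mult_left_mono divide_left_mono) (auto simp: k_def)
      finally have "b n * (1 - x) ^ n \<le> ?d * (1 / ((real n + 1) * (real n + 2)))" unfolding eq .
      moreover have "norm (taylor_coeff f n * of_real (1 - x) ^ n) = b n * (1 - x) ^ n"
        using x True by (simp add: norm_mult norm_power b_def del: of_real_diff)
      ultimately have "ennreal (norm (taylor_coeff f n * of_real (1 - x) ^ n)) \<le> ennreal (?d * (1 / ((real n + 1) * (real n + 2))))"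
        by (simp only: ennreal_leI)
      also have "\<dots> = (\<integral>\<^sup>+y. ennreal ?d * indicator (?J n) y \<partial>lborel)"
        using x b0 by (subst nn_integral_cmult_indicator) (auto simp: len ennreal_mult[symmetric] intro!: divide_nonneg_pos add_pos_pos)
      also have "\<dots> \<le> (\<integral>\<^sup>+y. ennreal (4 * b n * (real n + 1) / (x + y)) * indicator (?J n) y \<partial>lborel)"
      proof (rule nn_integral_mono)
        fix y :: real
        show "ennreal ?d * indicator (?J n) y \<le> ennreal (4 * b n * (real n + 1) / (x + y)) * indicator (?J n) y"
        proof (cases "y \<in> ?J n")
          case True
          then have y: "0 < y" "y \<le> 1 / (real n + 1)"
            by (auto elim: le_less_trans[rotated])
          then have "?d \<le> 4 * b n * (real n + 1) / (x + y)"
            using x b0 by (intro divide_left_mono) (auto intro!: mult_pos_pos add_pos_pos)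
          then show ?thesis using True by (simp add: ennreal_leI)
        qed simp
      qed
      finally show ?thesis .
    qed
    have "ennreal (norm (f (of_real (1 - x)))) \<le> (\<Sum>n. ennreal (norm (taylor_coeff f n * of_real (1 - x) ^ n)))"
    \<comment> \<open>If the series of norms diverged, the right-hand side would be
      infinite.\<close>
    proof (cases "summable (\<lambda>n. norm (taylor_coeff f n * of_real (1 - x) ^ n))")
      case True
      have "norm (f (of_real (1 - x))) \<le> (\<Sum>n. norm (taylor_coeff f n * of_real (1 - x) ^ n))"
        using summable_norm[OF True] sums by (simp add: sums_iff)
      then show ?thesis using True by (subst suminf_ennreal2) (auto intro: ennreal_leI)
    next
      case False
      then have "(\<Sum>n. ennreal (norm (taylor_coeff f n * of_real (1 - x) ^ n))) = top"
        by (metis norm_ge_zero summable_suminf_not_top)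
      then show ?thesis by simp
    qed
    also have "\<dots> \<le> (\<Sum>n. \<integral>\<^sup>+y. ennreal (4 * b n * (real n + 1) / (x + y)) * indicator (?J n) y \<partial>lborel)"
      by (intro suminf_le term_le) auto
    also have "\<dots> = (\<integral>\<^sup>+y. indicator {0<..1} y * ennreal (4 * b (N y) * (real (N y) + 1) / (x + y)) \<partial>lborel)"
      by (rule part[symmetric]) measurable
    also have "\<dots> = (\<integral>\<^sup>+y. ennreal (indicator {0<..} y * (g y / (x + y))) \<partial>lborel)"
      by (intro nn_integral_cong) (auto simp: g_def indicator_def)
    finally show ?thesis using True by (simp add: F_def)
  qed (simp add: F_def)
  define R where "R = (\<lambda>t. indicator {0..<1} t *\<^sub>R f (of_real t))"
  have [measurable]: "R \<in> borel_measurable borel" unfolding R_def by (rule measurable_radial[OF hol])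
  have "(\<integral>\<^sup>+t\<in>{0..<1}. ennreal (norm (f (of_real t)) powr p) \<partial>lborel)
     = (\<integral>\<^sup>+t. ennreal (norm (R t) powr p) * indicator {0..<1} t \<partial>lborel)"
    by (intro nn_integral_cong) (auto simp: indicator_def R_def)
  also have "\<dots> = (\<integral>\<^sup>+x. ennreal (norm (R (1 - x)) powr p) * indicator {0..<1} (1 - x) \<partial>lborel)"
    by (rule nn_integral_lborel_reflect[symmetric, where h = "\<lambda>t. ennreal (norm (R t) powr p) * indicator {0..<1} t"]) measurable
  also have "\<dots> \<le> (\<integral>\<^sup>+x. ennreal (F x powr p) * indicator {0<..} x \<partial>lborel)"
    by (intro nn_integral_mono) (auto simp: F_def R_def indicator_def)
  also have "\<dots> \<le> ennreal ((p / (p - 1) + p) powr p) * (\<integral>\<^sup>+y. ennreal (g y powr p) * indicator {0<..} y \<partial>lborel)"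
    by (rule Hilbert_inequality[OF p _ _ _ FI]) (auto simp: F_def g_def b0)
  also have "(\<integral>\<^sup>+y. ennreal (g y powr p) * indicator {0<..} y \<partial>lborel)
    = (\<integral>\<^sup>+y. indicator {0<..1} y * ennreal ((4 * b (N y) * (real (N y) + 1)) powr p) \<partial>lborel)"
    by (intro nn_integral_cong) (auto simp: g_def indicator_def)
  also have "\<dots> = (\<Sum>n. \<integral>\<^sup>+y. ennreal ((4 * b n * (real n + 1)) powr p) * indicator (?J n) y \<partial>lborel)"
    by (rule part) measurable
  also have "\<dots> \<le> (\<Sum>n. ennreal (4 powr p) * ennreal (b n powr p * (real n + 1) powr (p - 2)))"
  proof (rule suminf_le)
    fix n
    \<comment> \<open>The length of the block is of order \<open>(n + 1)^(-2)\<close> and turns the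
      exponent \<open>p\<close> of \<open>n + 1\<close> into the \<open>p - 2\<close> of the
      Hardy-Littlewood norm.\<close>
    have "(4 * b n * (real n + 1)) powr p * (1 / ((real n + 1) * (real n + 2))) \<le> (4 * b n * (real n + 1)) powr p * (1 / ((real n + 1) * (real n + 1)))"
      by (intro mult_left_mono divide_left_mono) auto
    also have "1 / ((real n + 1) * (real n + 1)) = (real n + 1) powr (-2)"
      by (simp add: powr_minus powr_numeral power2_eq_square divide_inverse)
    also have "(4 * b n * (real n + 1)) powr p * (real n + 1) powr (-2) = 4 powr p * (b n powr p * (real n + 1) powr (p - 2))"
      by (simp only: powr_mult powr_diff powr_minus divide_inverse mult_ac)
    finally show "(\<integral>\<^sup>+y. ennreal ((4 * b n * (real n + 1)) powr p) * indicator (?J n) y \<partial>lborel) \<le> ennreal (4 powr p) * ennreal (b n powr p * (real n + 1) powr (p - 2))"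
      by (subst nn_integral_cmult_indicator) (auto simp: len ennreal_mult[symmetric] intro!: ennreal_leI)
  qed auto
  also have "\<dots> = ennreal (4 powr p) * HL_power p f"
    by (simp add: HL_power_def b_def ennreal_suminf_cmult)
  finally show "(\<integral>\<^sup>+t\<in>{0..<1}. ennreal (norm (f (of_real t)) powr p) \<partial>lborel) \<le> ennreal ((p / (p - 1) + p) powr p * 4 powr p) * HL_power p f"
    by (simp add: ennreal_mult mult.assoc mult_left_mono)
qed simp

subsection \<open>The Dirichlet space on the radius\<close>

lemma deriv_submean_powr:
  assumes hol: "f holomorphic_on ball 0 1" and p: "p > 1" and u: "0 \<le> u" "u < 1"
  shows "ennreal (pi * ((1 - u) / 2)\<^sup>2) * ennreal (norm (deriv f (of_real u)) powr p)
      \<le> (\<integral>\<^sup>+z. ennreal (norm (deriv f z) powr p) * indicator (ball (of_real u) ((1 - u) / 2)) z \<partial>lborel)"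
proof (rule area_submean_powr[OF _ _ p])
  have "ball (of_real u :: complex) ((1 - u) / 2) \<subseteq> ball 0 1"
  proof
    fix z :: complex assume "z \<in> ball (of_real u) ((1 - u) / 2)"
    then have "norm (z - of_real u) < (1 - u) / 2" by (simp add: dist_norm norm_minus_commute)
    then have "norm z < 1" using norm_triangle_ineq[of "z - of_real u" "of_real u"] u by simp
    then show "z \<in> ball 0 1" by simp
  qed
  moreover have "deriv f holomorphic_on ball 0 1" using hol by (intro holomorphic_deriv) auto
  ultimately show "deriv f holomorphic_on ball (of_real u) ((1 - u) / 2)" by (metis holomorphic_on_subset)
qed (use u in simp)

text \<open>On the disc around \<open>u\<close> with half the distance to the boundary as radius,
  the weight \<open>1 - norm z\<close> is comparable to \<open>1 - u\<close>.\<close>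

lemma ball_half_gap:
  fixes z :: complex
  assumes "0 \<le> u" "u < 1" "z \<in> ball (of_real u) ((1 - u) / 2)"
  shows "(1 - u) / 2 < 1 - norm z" "1 - norm z < 3 * ((1 - u) / 2)" "norm z < 1"
proof -
  have "norm (z - of_real u) < (1 - u) / 2" using assms by (simp add: dist_norm norm_minus_commute)
  then show "(1 - u) / 2 < 1 - norm z" "1 - norm z < 3 * ((1 - u) / 2)" "norm z < 1"
    using norm_triangle_ineq[of "z - of_real u" "of_real u"] norm_triangle_ineq2[of "of_real u" z] assms
    by (simp_all add: norm_minus_commute)
qed

lemma Dirichlet_integral_le:
  "(\<integral>\<^sup>+z\<in>ball 0 1. ennreal (norm (deriv f z) powr p * (1 - norm z) powr (p - 1)) \<partial>lborel) \<le> ennreal pi * Dirichlet_power p f"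
proof -
  let ?I = "\<integral>\<^sup>+z\<in>ball 0 1. ennreal (norm (deriv f z) powr p * (1 - norm z) powr (p - 1)) \<partial>lborel"
  have "?I = ennreal pi * (ennreal (1 / pi) * ?I)"
    by (simp add: mult.assoc[symmetric] ennreal_mult[symmetric])
  also have "\<dots> \<le> ennreal pi * Dirichlet_power p f"
    unfolding Dirichlet_power_def by (intro mult_left_mono) (auto intro: add_increasing)
  finally show ?thesis .
qed

text \<open>On the disc of radius \<open>\<rho> = (1 - u) / 2\<close> the weight is at least
  \<open>\<rho>^(p-1)\<close>, so the area submean inequality bounds the \<open>p\<close>-th power
  of the derivative by \<open>\<rho>^(-1-p) * v\<close>. Taking the root leaves
  \<open>\<rho>\<close> with exponent \<open>-(1 + p) / p\<close>, which is at least
  \<open>-2\<close>.\<close>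

lemma norm_deriv_le_Dirichlet:
  assumes hol: "f holomorphic_on ball 0 1" and p: "p > 1" and u: "0 \<le> u" "u < 1"
    and v: "v \<ge> 0" "Dirichlet_power p f = ennreal v"
  shows "norm (deriv f (of_real u)) \<le> 4 * (1 - u) powr (-2) * v powr (1 / p)"
proof -
  define \<rho> where "\<rho> = (1 - u) / 2"
  have \<rho>: "0 < \<rho>" "\<rho> < 1" using u by (auto simp: \<rho>_def)
  let ?I = "\<integral>\<^sup>+z\<in>ball 0 1. ennreal (norm (deriv f z) powr p * (1 - norm z) powr (p - 1)) \<partial>lborel"
  define a where "a = norm (deriv f (of_real u)) powr p"
  have [measurable]: "(\<lambda>z. ennreal (norm (deriv f z) powr p * (1 - norm z) powr (p - 1)) * indicator (ball 0 1) z) \<in> borel_measurable borel"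
    by (rule measurable_Dirichlet_integrand[OF hol]) (use p in simp)
  have "ennreal (pi * \<rho>\<^sup>2) * ennreal a \<le> (\<integral>\<^sup>+z. ennreal (norm (deriv f z) powr p) * indicator (ball (of_real u) \<rho>) z \<partial>lborel)"
    using deriv_submean_powr[OF hol p u] by (simp add: \<rho>_def a_def)
  also have "\<dots> \<le> (\<integral>\<^sup>+z. ennreal (\<rho> powr (1 - p)) * (ennreal (norm (deriv f z) powr p * (1 - norm z) powr (p - 1)) * indicator (ball 0 1) z) \<partial>lborel)"
  proof (rule nn_integral_mono)
    fix z :: complex
    show "ennreal (norm (deriv f z) powr p) * indicator (ball (of_real u) \<rho>) z \<le>
      ennreal (\<rho> powr (1 - p)) * (ennreal (norm (deriv f z) powr p * (1 - norm z) powr (p - 1)) * indicator (ball 0 1) z)"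
    proof (cases "z \<in> ball (of_real u) \<rho>")
      case True
      note gap = ball_half_gap[OF u True[unfolded \<rho>_def], folded \<rho>_def]
      have "1 = \<rho> powr (1 - p) * \<rho> powr (p - 1)" using \<rho> by (simp add: powr_add[symmetric])
      also have "\<dots> \<le> \<rho> powr (1 - p) * (1 - norm z) powr (p - 1)"
        using gap \<rho> p by (intro mult_left_mono powr_mono2) auto
      finally have "norm (deriv f z) powr p * 1 \<le> norm (deriv f z) powr p * (\<rho> powr (1 - p) * (1 - norm z) powr (p - 1))"
        by (rule mult_left_mono) simp
      then show ?thesis using gap by (simp add: ennreal_mult[symmetric] ennreal_leI mult_ac indicator_def)
    qed simp
  qed
  also have "\<dots> = ennreal (\<rho> powr (1 - p)) * ?I" by (rule nn_integral_cmult) measurable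
  also have "\<dots> \<le> ennreal (\<rho> powr (1 - p)) * (ennreal pi * Dirichlet_power p f)"
    by (intro mult_left_mono Dirichlet_integral_le) simp
  finally have "ennreal (pi * \<rho>\<^sup>2 * a) \<le> ennreal (\<rho> powr (1 - p) * (pi * v))"
    unfolding v(2) using v(1) by (simp add: ennreal_mult[symmetric] a_def)
  then have "pi * \<rho>\<^sup>2 * a \<le> \<rho> powr (1 - p) * (pi * v)"
    using v(1) by (subst (asm) ennreal_le_iff) auto
  then have "a \<le> \<rho> powr (1 - p) / \<rho>\<^sup>2 * v" using \<rho> by (simp add: field_simps)
  also have "\<rho> powr (1 - p) / \<rho>\<^sup>2 = \<rho> powr (- 1 - p)"
    using \<rho> by (simp add: powr_diff powr_minus power2_eq_square field_simps)
  finally have "a powr (1 / p) \<le> (\<rho> powr (- 1 - p) * v) powr (1 / p)"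
    using p by (intro powr_mono2) (auto simp: a_def)
  also have "a powr (1 / p) = norm (deriv f (of_real u))" using p by (simp add: a_def powr_powr)
  also have "(\<rho> powr (- 1 - p) * v) powr (1 / p) = \<rho> powr ((- 1 - p) / p) * v powr (1 / p)"
    by (simp add: powr_mult powr_powr)
  also have "\<dots> \<le> \<rho> powr (-2) * v powr (1 / p)"
    using \<rho> p by (intro mult_right_mono powr_mono') (auto simp: field_simps)
  also have "\<rho> powr (-2) = 4 * (1 - u) powr (-2)"
    using u powr_numeral[of "1 - u" "num.Bit0 num.One"] powr_numeral[of \<rho> "num.Bit0 num.One"] \<rho>
    by (simp add: powr_minus_divide \<rho>_def power_divide)
  finally show ?thesis .
qed

lemma radial_growth_Dirichlet:
  assumes p: "p > 1"
  shows "radial_growth p (Dirichlet_power p)"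
  unfolding radial_growth_def
proof (intro exI[of _ "5 powr p"] conjI allI impI ballI)
  fix f and t :: real assume hol: "f holomorphic_on ball 0 1" and t: "t \<in> {0..<1}"
  show "ennreal (norm (f (of_real t)) powr p) \<le> ennreal (5 powr p * (1 - t) powr (- 2 * p)) * Dirichlet_power p f"
  proof (cases "Dirichlet_power p f")
    case top
    have "ennreal (5 powr p * (1 - t) powr (- 2 * p)) * Dirichlet_power p f = top"
      unfolding top using t by (subst ennreal_mult_top) simp_all
    then show ?thesis by (simp only: top_greatest)
  next
    case (real v)
    define w where "w = v powr (1 / p)"
    have w: "w \<ge> 0" by (simp add: w_def)
    have f0: "norm (f 0) \<le> w"
    proof -
      have "ennreal (norm (f 0) powr p) \<le> Dirichlet_power p f"
        unfolding Dirichlet_power_def by (intro add_increasing2) auto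
      then have "norm (f 0) powr p \<le> v" unfolding real(2) by (subst (asm) ennreal_le_iff) (rule real(1))
      then have "(norm (f 0) powr p) powr (1 / p) \<le> w" unfolding w_def using p by (intro powr_mono2) auto
      then show ?thesis using p by (simp add: powr_powr)
    qed
    define B where "B = 4 * (1 - t) powr (-2) * w"
    have "norm (f (of_real t) - f (of_real 0)) \<le> B * norm (of_real t - of_real 0 :: complex)"
    proof (rule field_differentiable_bound[of "closed_segment (of_real 0) (of_real t)" _ "deriv f"])
      fix z :: complex assume "z \<in> closed_segment (of_real 0) (of_real t)"
      then obtain s where s: "z = of_real s" "0 \<le> s" "s \<le> t"
        using t unfolding closed_segment_of_real by (auto simp: closed_segment_eq_real_ivl)
      then have "z \<in> ball 0 1" using t by simp
      then show "(f has_field_derivative deriv f z) (at z within closed_segment (of_real 0) (of_real t))"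
        using holomorphic_derivI[OF hol] by (auto intro: has_field_derivative_at_within)
      have "norm (deriv f z) \<le> 4 * (1 - s) powr (-2) * w"
        unfolding s(1) w_def using s t by (intro norm_deriv_le_Dirichlet[OF hol p _ _ real]) auto
      also have "\<dots> \<le> B" unfolding B_def using s t w by (intro mult_right_mono mult_left_mono powr_mono2') auto
      finally show "norm (deriv f z) \<le> B" .
    qed auto
    also have "\<dots> \<le> B * 1" using t w by (intro mult_left_mono) (auto simp: B_def)
    finally have "norm (f (of_real t)) \<le> norm (f 0) + B"
      using norm_triangle_ineq2[of "f (of_real t)" "f 0"] by simp
    also have "\<dots> \<le> 1 * w + B" using f0 by simp
    also have "\<dots> \<le> (1 - t) powr (-2) * w + B"
    proof -
      have "1 \<le> (1 - t) powr (-2)" using powr_growth_mono[of t 0 2] t by simp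
      then show ?thesis using w by (intro add_right_mono mult_right_mono) auto
    qed
    \<comment> \<open>The constant 5 is 4 from the bound on the derivative along the segment plus 1
      from \<open>f 0\<close>.\<close>
    also have "\<dots> = 5 * (1 - t) powr (-2) * w" by (simp add: B_def)
    finally have "norm (f (of_real t)) powr p \<le> (5 * (1 - t) powr (-2) * w) powr p"
      using p by (intro powr_mono2) auto
    also have "\<dots> = 5 powr p * (1 - t) powr (- 2 * p) * v"
      using p real(1) by (simp only: w_def powr_mult powr_powr) simp
    finally show ?thesis unfolding real(2) using real(1) by (simp only: ennreal_mult[symmetric] ennreal_leI mult_nonneg_nonneg powr_ge_zero)
  qed
qed simp

text \<open>The area submean inequality at each \<open>u\<close> followed by Tonelli. It brings in
  the weight \<open>(1 - norm z)^(p-2)\<close>, and the set of those \<open>u\<close> whose disc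
  contains \<open>z\<close> has length at most \<open>2 * (1 - norm z)\<close>, which restores the
  exponent \<open>p - 1\<close>. The 18 is this 2 times the 9 of the constant
  \<open>?c\<close>.\<close>

lemma Dirichlet_radial_integral:
  assumes hol: "f holomorphic_on ball 0 1" and p: "p > 1"
  shows "(\<integral>\<^sup>+u. ennreal ((1 - u) powr p * norm (deriv f (of_real u)) powr p) * indicator {0..<1} u \<partial>lborel)
     \<le> ennreal (18 * 2 powr p) * Dirichlet_power p f"
proof -
  define W where "W = (\<lambda>z. ennreal (norm (deriv f z) powr p * (1 - norm z) powr (p - 2)) * indicator (ball 0 1) z)"
  have [measurable]: "W \<in> borel_measurable borel"
    unfolding W_def by (rule measurable_Dirichlet_integrand[OF hol]) (use p in simp)
  have [measurable]: "(\<lambda>z. ennreal (norm (deriv f z) powr p * (1 - norm z) powr (p - 1)) * indicator (ball 0 1) z) \<in> borel_measurable borel"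
    by (rule measurable_Dirichlet_integrand[OF hol]) (use p in simp)
  let ?c = "9 * 2 powr p / pi"
  \<comment> \<open>Membership of \<open>z\<close> in the disc about \<open>u\<close> is relaxed to
    a condition on \<open>u\<close> and \<open>norm z\<close>, whose section in \<open>u\<close> is
    an interval.\<close>
  let ?A = "{a :: real \<times> complex. 0 \<le> fst a \<and> fst a < 1 \<and> 1 - fst a < 2 * (1 - norm (snd a))}"
  have "ennreal ((1 - u) powr p * norm (deriv f (of_real u)) powr p) * indicator {0..<1} u
     \<le> (\<integral>\<^sup>+z. ennreal ?c * (W z * indicator ?A (u, z)) \<partial>lborel)" for u :: real
  proof (cases "u \<in> {0..<1}")
    case True
    then have u: "0 \<le> u" "u < 1" by auto
    define \<rho> where "\<rho> = (1 - u) / 2"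
    have \<rho>: "0 < \<rho>" using u by (auto simp: \<rho>_def)
    let ?k = "(1 - u) powr p / (pi * \<rho>\<^sup>2)"
    have k: "?k * (pi * \<rho>\<^sup>2) = (1 - u) powr p" using \<rho> by simp
    have "ennreal ((1 - u) powr p * norm (deriv f (of_real u)) powr p)
       = ennreal (?k * (pi * \<rho>\<^sup>2) * norm (deriv f (of_real u)) powr p)"
      by (simp only: k)
    also have "\<dots> = ennreal ?k * (ennreal (pi * \<rho>\<^sup>2) * ennreal (norm (deriv f (of_real u)) powr p))"
      by (subst ennreal_mult, simp, simp, subst ennreal_mult, simp, simp, rule mult.assoc)
    also have "\<dots> \<le> ennreal ?k * (\<integral>\<^sup>+z. ennreal (norm (deriv f z) powr p) * indicator (ball (of_real u) \<rho>) z \<partial>lborel)"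
      unfolding \<rho>_def by (intro mult_left_mono deriv_submean_powr[OF hol p u]) simp
    also have "(\<integral>\<^sup>+z. ennreal (norm (deriv f z) powr p) * indicator (ball (of_real u) \<rho>) z \<partial>lborel)
       = (\<integral>\<^sup>+z. ennreal (norm (indicator (ball 0 1) z *\<^sub>R deriv f z) powr p) * indicator (ball (of_real u) \<rho>) z \<partial>lborel)"
    proof (rule nn_integral_cong)
      fix z :: complex
      show "ennreal (norm (deriv f z) powr p) * indicator (ball (of_real u) \<rho>) z = ennreal (norm (indicator (ball 0 1) z *\<^sub>R deriv f z) powr p) * indicator (ball (of_real u) \<rho>) z"
        using ball_half_gap(3)[OF u, of z] by (cases "z \<in> ball (of_real u) \<rho>") (simp_all add: \<rho>_def)
    qed
    also have "ennreal ?k * \<dots> = (\<integral>\<^sup>+z. ennreal ?k * (ennreal (norm (indicator (ball 0 1) z *\<^sub>R deriv f z) powr p) * indicator (ball (of_real u) \<rho>) z) \<partial>lborel)"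
    proof -
      define q where "q = (\<lambda>z. indicator (ball 0 1) z *\<^sub>R deriv f z)"
      have [measurable]: "q \<in> borel_measurable borel" unfolding q_def
        by (intro borel_measurable_continuous_on_indicator holomorphic_on_imp_continuous_on holomorphic_deriv hol) auto
      have [measurable]: "ball (of_real u :: complex) \<rho> \<in> sets borel" by simp
      show ?thesis unfolding q_def[symmetric] fun_cong[OF q_def, symmetric]
        by (rule nn_integral_cmult[symmetric]) measurable
    qed
    also have "\<dots> \<le> (\<integral>\<^sup>+z. ennreal ?c * (W z * indicator ?A (u, z)) \<partial>lborel)"
    proof (rule nn_integral_mono)
      fix z :: complex
      show "ennreal ?k * (ennreal (norm (indicator (ball 0 1) z *\<^sub>R deriv f z) powr p) * indicator (ball (of_real u) \<rho>) z) \<le> ennreal ?c * (W z * indicator ?A (u, z))"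
      proof (cases "z \<in> ball (of_real u) \<rho>")
        case True
        note gap = ball_half_gap[OF u True[unfolded \<rho>_def], folded \<rho>_def]
        define d where "d = 1 - norm z"
        have d: "\<rho> < d" "d < 3 * \<rho>" "0 < d" using gap \<rho> by (auto simp: d_def)
        have "2 * \<rho> = 1 - u" by (simp add: \<rho>_def)
        then have "?k = (2 * \<rho>) powr p / (pi * \<rho>\<^sup>2)" by (simp only:)
        \<comment> \<open>From \<open>\<rho> < d < 3 * \<rho>\<close>: the numerator grows when
          \<open>\<rho>\<close> becomes \<open>d\<close>, the denominator shrinks when it becomes
          \<open>d / 3\<close>. Hence the 9.\<close>
        also have "\<dots> \<le> (2 * d) powr p / (pi * (d / 3)\<^sup>2)"
          using d \<rho> p by (intro frac_le powr_mono2 mult_left_mono power_mono) auto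
        also have "\<dots> = ?c * d powr (p - 2)"
        proof -
          have "d powr (p - 2) = d powr p / d\<^sup>2" using d by (simp add: powr_diff)
          then show ?thesis by (simp add: powr_mult power_divide)
        qed
        finally have "?k * norm (deriv f z) powr p \<le> ?c * d powr (p - 2) * norm (deriv f z) powr p"
          by (rule mult_right_mono) simp
        then have "ennreal (?k * norm (deriv f z) powr p) \<le> ennreal (?c * (norm (deriv f z) powr p * d powr (p - 2)))"
          by (intro ennreal_leI) (simp only: mult.assoc mult.commute[of "d powr (p - 2)"])
        moreover have "(u, z) \<in> ?A" "z \<in> ball 0 1" using u d gap by (simp_all add: d_def \<rho>_def)
        ultimately show ?thesis using True
          by (simp only: W_def indicator_simps d_def[symmetric] ennreal_mult powr_ge_zero mult_nonneg_nonneg mult_1_right scaleR_one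
              divide_nonneg_nonneg zero_le_numeral pi_ge_zero zero_le_power2)
      qed simp
    qed
    finally show ?thesis using True by simp
  qed simp
  then have "(\<integral>\<^sup>+u. ennreal ((1 - u) powr p * norm (deriv f (of_real u)) powr p) * indicator {0..<1} u \<partial>lborel)
     \<le> (\<integral>\<^sup>+u. \<integral>\<^sup>+z. ennreal ?c * (W z * indicator ?A (u, z)) \<partial>lborel \<partial>lborel)"
    by (rule nn_integral_mono)
  also have "\<dots> = (\<integral>\<^sup>+z. \<integral>\<^sup>+u. ennreal ?c * (W z * indicator ?A (u, z)) \<partial>lborel \<partial>lborel)"
    by (rule pair_sigma_finite.Fubini') (auto simp: pair_sigma_finite_def lborel.sigma_finite_measure_axioms split_beta')
  also have "\<dots> \<le> (\<integral>\<^sup>+z. ennreal (2 * ?c) * (ennreal (norm (deriv f z) powr p * (1 - norm z) powr (p - 1)) * indicator (ball 0 1) z) \<partial>lborel)"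
  proof (rule nn_integral_mono)
    fix z :: complex
    have "(\<integral>\<^sup>+u. ennreal ?c * (W z * indicator ?A (u, z)) \<partial>lborel) \<le> (\<integral>\<^sup>+u. ennreal ?c * W z * indicator {1 - 2 * (1 - norm z)..1} u \<partial>lborel)"
      by (intro nn_integral_mono) (auto simp: indicator_def)
    also have "\<dots> = ennreal ?c * W z * emeasure lborel {1 - 2 * (1 - norm z)..1}"
      by (rule nn_integral_cmult_indicator) simp
    also have "\<dots> = ennreal (2 * ?c) * (ennreal (norm (deriv f z) powr p * (1 - norm z) powr (p - 1)) * indicator (ball 0 1) z)"
    proof (cases "norm z < 1")
      case True
      have "(1 - norm z) powr (p - 1) = (1 - norm z) powr (p - 2) * (1 - norm z)"
        using True powr_add[of "1 - norm z" "p - 2" 1] by simp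
      then show ?thesis using True
        by (simp add: W_def ennreal_mult[symmetric] mult_ac)
    qed (simp add: W_def)
    finally show "(\<integral>\<^sup>+u. ennreal ?c * (W z * indicator ?A (u, z)) \<partial>lborel)
       \<le> ennreal (2 * ?c) * (ennreal (norm (deriv f z) powr p * (1 - norm z) powr (p - 1)) * indicator (ball 0 1) z)" .
  qed
  also have "\<dots> = ennreal (2 * ?c) * (\<integral>\<^sup>+z\<in>ball 0 1. ennreal (norm (deriv f z) powr p * (1 - norm z) powr (p - 1)) \<partial>lborel)"
    by (rule nn_integral_cmult) measurable
  also have "\<dots> \<le> ennreal (2 * ?c) * (ennreal pi * Dirichlet_power p f)"
    by (intro mult_left_mono Dirichlet_integral_le) simp
  also have "\<dots> = ennreal (18 * 2 powr p) * Dirichlet_power p f"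
    by (simp add: mult.assoc[symmetric] ennreal_mult[symmetric])
  finally show ?thesis .
qed

text \<open>The increment of \<open>f\<close> along the radius is at most the integral of the
  derivative over \<open>y \<ge> x\<close> in the variable \<open>y = 1 - s\<close>. This Hardy
  operator is dominated by the Hilbert kernel applied to \<open>2 * y\<close> times the derivative,
  whose \<open>p\<close>-th power is integrable by the preceding lemma. The value \<open>f 0\<close>
  is treated apart.\<close>

lemma radial_embedding_Dirichlet:
  assumes p: "p > 1"
  shows "radial_embedding p (Dirichlet_power p)"
  unfolding radial_embedding_def
proof (intro exI conjI allI impI)
  fix f assume hol: "f holomorphic_on ball 0 1"
  define h where "h = (\<lambda>s. norm (indicator {0..<1} s *\<^sub>R deriv f (of_real s)))"
  have "deriv f holomorphic_on ball 0 1" using hol by (intro holomorphic_deriv) auto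
  have [measurable]: "h \<in> borel_measurable borel"
    unfolding h_def by (rule measurable_compose[OF measurable_radial[OF \<open>deriv f holomorphic_on ball 0 1\<close>] borel_measurable_norm])
  have h0: "h s \<ge> 0" for s by (simp add: h_def)
  define g where "g = (\<lambda>y. indicator {0<..1} y * (2 * y * h (1 - y)))"
  have [measurable]: "g \<in> borel_measurable borel" unfolding g_def by measurable
  define F where "F = (\<lambda>x. if x \<le> 1 then norm (f (of_real (1 - x)) - f 0) else 0)"
  have FI: "ennreal (F x) \<le> (\<integral>\<^sup>+y. ennreal (indicator {0<..} y * (g y / (x + y))) \<partial>lborel)" if x: "x > 0" for x
  proof (cases "x \<le> 1")
    case True
    have vd: "((\<lambda>s. f (of_real s)) has_vector_derivative deriv f (of_real s)) (at s within {0..1 - x})"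
      if s: "s \<in> {0..1 - x}" for s
    proof -
      have "(of_real s :: complex) \<in> ball 0 1" using s x by auto
      then have "(f has_field_derivative deriv f (of_real s)) (at (of_real s))"
        by (rule holomorphic_derivI[OF hol open_ball])
      then show ?thesis
        by (rule has_vector_derivative_at_within[OF has_vector_derivative_real_field])
    qed
    have hi: "((\<lambda>s. deriv f (of_real s)) has_integral (f (of_real (1 - x)) - f (of_real 0))) {0..1 - x}"
      by (rule fundamental_theorem_of_calculus) (use vd True in auto)
    have "continuous_on {0..1 - x} (\<lambda>s. norm (deriv f (of_real s)))"
      using x by (intro continuous_intros continuous_on_compose2[OF holomorphic_on_imp_continuous_on[OF \<open>deriv f holomorphic_on ball 0 1\<close>]]) auto
    then have gi: "((\<lambda>s. norm (deriv f (of_real s))) has_integral integral {0..1 - x} (\<lambda>s. norm (deriv f (of_real s)))) {0..1 - x}"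
      using integrable_continuous_interval by blast
    have "norm (integral {0..1 - x} (\<lambda>s. deriv f (of_real s))) \<le> integral {0..1 - x} (\<lambda>s. norm (deriv f (of_real s)))"
      using hi gi by (intro Henstock_Kurzweil_Integration.integral_norm_bound_integral) auto
    then have "F x \<le> integral {0..1 - x} (\<lambda>s. norm (deriv f (of_real s)))"
      using hi True by (simp add: F_def integral_unique)
    then have "ennreal (F x) \<le> ennreal (integral {0..1 - x} (\<lambda>s. norm (deriv f (of_real s))))"
      by (rule ennreal_leI)
    also have "\<dots> = (\<integral>\<^sup>+s. ennreal (norm (deriv f (of_real s))) * indicator {0..1 - x} s \<partial>lborel)"
      using gi by (intro nn_integral_has_integral_lebesgue'[symmetric]) auto
    also have "\<dots> = (\<integral>\<^sup>+s. ennreal (h s) * indicator {0..1 - x} s \<partial>lborel)"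
      using x by (intro nn_integral_cong) (auto simp: h_def indicator_def)
    also have "\<dots> = (\<integral>\<^sup>+y. ennreal (h (1 - y)) * indicator {0..1 - x} (1 - y) \<partial>lborel)"
      by (rule nn_integral_lborel_reflect[symmetric, where h = "\<lambda>s. ennreal (h s) * indicator {0..1 - x} s"]) measurable
    also have "\<dots> \<le> (\<integral>\<^sup>+y. ennreal (indicator {0<..} y * (g y / (x + y))) \<partial>lborel)"
    proof (rule nn_integral_mono)
      fix y :: real
      show "ennreal (h (1 - y)) * indicator {0..1 - x} (1 - y) \<le> ennreal (indicator {0<..} y * (g y / (x + y)))"
      proof (cases "x \<le> y \<and> y \<le> 1")
        case y: True
        \<comment> \<open>For \<open>y \<ge> x\<close> one has \<open>x + y \<le> 2 * y\<close>;
          hence the weight \<open>2 * y\<close> in \<open>g\<close>.\<close>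
        have "h (1 - y) * 1 \<le> h (1 - y) * (2 * y / (x + y))"
          using x y by (intro mult_left_mono) (auto simp: h_def field_simps)
        then show ?thesis using x y by (auto simp: g_def indicator_def mult_ac intro!: ennreal_leI)
      qed (auto simp: indicator_def)
    qed
    finally show ?thesis .
  qed (simp add: F_def)
  define C where "C = (p / (p - 1) + p) powr p"
  have C0: "C \<ge> 0" by (simp add: C_def)
  define R where "R = (\<lambda>t. indicator {0..<1} t *\<^sub>R f (of_real t))"
  have [measurable]: "R \<in> borel_measurable borel" unfolding R_def by (rule measurable_radial[OF hol])
  define F' where "F' = (\<lambda>x. norm (R (1 - x) - f 0))"
  have [measurable]: "F' \<in> borel_measurable borel" unfolding F'_def by measurable
  have "(\<integral>\<^sup>+t\<in>{0..<1}. ennreal (norm (f (of_real t)) powr p) \<partial>lborel)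
     = (\<integral>\<^sup>+t. ennreal (norm (R t) powr p) * indicator {0..<1} t \<partial>lborel)"
    by (intro nn_integral_cong) (auto simp: indicator_def R_def)
  also have "\<dots> = (\<integral>\<^sup>+x. ennreal (norm (R (1 - x)) powr p) * indicator {0..<1} (1 - x) \<partial>lborel)"
    by (rule nn_integral_lborel_reflect[symmetric, where h = "\<lambda>t. ennreal (norm (R t) powr p) * indicator {0..<1} t"]) measurable
  also have "\<dots> \<le> (\<integral>\<^sup>+x. ennreal (2 powr p) * (ennreal (F' x powr p) * indicator {0<..1} x + ennreal (norm (f 0) powr p) * indicator {0<..1} x) \<partial>lborel)"
  proof (rule nn_integral_mono)
    fix x :: real
    show "ennreal (norm (R (1 - x)) powr p) * indicator {0..<1} (1 - x) \<le> ennreal (2 powr p) * (ennreal (F' x powr p) * indicator {0<..1} x + ennreal (norm (f 0) powr p) * indicator {0<..1} x)"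
      using ennreal_powr_add_le[of p "norm (R (1 - x))" "F' x" "norm (f 0)" 1] norm_triangle_ineq[of "R (1 - x) - f 0" "f 0"] p
      by (auto simp: indicator_def F'_def)
  qed
  also have "\<dots> = ennreal (2 powr p) * ((\<integral>\<^sup>+x. ennreal (F' x powr p) * indicator {0<..1} x \<partial>lborel) + ennreal (norm (f 0) powr p))"
    by (simp add: nn_integral_cmult nn_integral_add nn_integral_cmult_indicator)
  also have "(\<integral>\<^sup>+x. ennreal (F' x powr p) * indicator {0<..1} x \<partial>lborel) \<le> (\<integral>\<^sup>+x. ennreal (F x powr p) * indicator {0<..} x \<partial>lborel)"
    by (intro nn_integral_mono) (auto simp: F_def F'_def R_def indicator_def)
  also have "\<dots> \<le> ennreal C * (\<integral>\<^sup>+y. ennreal (g y powr p) * indicator {0<..} y \<partial>lborel)"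
    unfolding C_def by (rule Hilbert_inequality[OF p \<open>g \<in> borel_measurable borel\<close> _ _ FI]) (use h0 in \<open>auto simp: F_def g_def\<close>)
  also have "(\<integral>\<^sup>+y. ennreal (g y powr p) * indicator {0<..} y \<partial>lborel)
      = (\<integral>\<^sup>+y. ennreal (2 powr p) * (ennreal ((1 - (1 - y)) powr p * h (1 - y) powr p) * indicator {0..<1} (1 - y)) \<partial>lborel)"
    by (intro nn_integral_cong) (auto simp: g_def indicator_def powr_mult ennreal_mult[symmetric] mult_ac)
  also have "\<dots> = ennreal (2 powr p) * (\<integral>\<^sup>+y. ennreal ((1 - (1 - y)) powr p * h (1 - y) powr p) * indicator {0..<1} (1 - y) \<partial>lborel)"
    by (rule nn_integral_cmult) measurable
  also have "(\<integral>\<^sup>+y. ennreal ((1 - (1 - y)) powr p * h (1 - y) powr p) * indicator {0..<1} (1 - y) \<partial>lborel)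
     = (\<integral>\<^sup>+u. ennreal ((1 - u) powr p * h u powr p) * indicator {0..<1} u \<partial>lborel)"
    by (rule nn_integral_lborel_reflect[where h = "\<lambda>u. ennreal ((1 - u) powr p * h u powr p) * indicator {0..<1} u"]) measurable
  also have "\<dots> = (\<integral>\<^sup>+u. ennreal ((1 - u) powr p * norm (deriv f (of_real u)) powr p) * indicator {0..<1} u \<partial>lborel)"
    by (intro nn_integral_cong) (auto simp: h_def indicator_def)
  also have "\<dots> \<le> ennreal (18 * 2 powr p) * Dirichlet_power p f" by (rule Dirichlet_radial_integral[OF hol p])
  finally have "(\<integral>\<^sup>+t\<in>{0..<1}. ennreal (norm (f (of_real t)) powr p) \<partial>lborel)
     \<le> ennreal (2 powr p) * (ennreal C * (ennreal (2 powr p) * (ennreal (18 * 2 powr p) * Dirichlet_power p f)) + ennreal (norm (f 0) powr p))"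
    by (simp add: mult_left_mono add_right_mono)
  also have "ennreal (norm (f 0) powr p) \<le> Dirichlet_power p f"
    unfolding Dirichlet_power_def by (intro add_increasing2) auto
  also have "ennreal (2 powr p) * (ennreal C * (ennreal (2 powr p) * (ennreal (18 * 2 powr p) * Dirichlet_power p f)) + Dirichlet_power p f)
     = ennreal (2 powr p * (C * (2 powr p * (18 * 2 powr p)) + 1)) * Dirichlet_power p f"
  proof -
    have "ennreal (2 powr p * (C * (2 powr p * (18 * 2 powr p)) + 1)) = ennreal (2 powr p) * (ennreal C * (ennreal (2 powr p) * ennreal (18 * 2 powr p)) + 1)"
      using C0 by (simp add: ennreal_mult)
    then show ?thesis by (simp add: distrib_right distrib_left mult_ac)
  qed
  finally show "(\<integral>\<^sup>+t\<in>{0..<1}. ennreal (norm (f (of_real t)) powr p) \<partial>lborel)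
     \<le> ennreal (2 powr p * (C * (2 powr p * (18 * 2 powr p)) + 1)) * Dirichlet_power p f"
    by (simp add: mult_left_mono add_left_mono)
qed simp

subsection \<open>Duality\<close>

text \<open>The converse of Hoelder's inequality, by hand: extremal functions for truncations of
  \<open>g\<close> are normalised and superposed with weights that decay more slowly than their
  pairings with \<open>g\<close> grow. Finiteness of the measure makes the truncated integrals
  finite.\<close>

lemma Landau_duality:
  fixes g :: "'a \<Rightarrow> real"
  assumes p: "p > 1" "1 / p + 1 / q = 1"
    and fin: "emeasure M (space M) < top"
    and [measurable]: "g \<in> borel_measurable M"
    and g: "\<And>x. x \<in> space M \<Longrightarrow> g x \<ge> 0"
    and inf: "(\<integral>\<^sup>+x. ennreal (g x powr q) \<partial>M) = top"
  obtains f where "f \<in> borel_measurable M" "\<And>x. f x \<ge> 0" "(\<integral>\<^sup>+x. ennreal (f x powr p) \<partial>M) \<le> 1"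
    "(\<integral>\<^sup>+x. ennreal (f x * g x) \<partial>M) = top"
proof -
  have q: "q > 1"
  proof -
    have "1 / q = 1 - 1 / p" using p by simp
    then have "0 < 1 / q" "1 / q < 1" using p(1) by auto
    then show ?thesis by (simp add: zero_less_divide_iff)
  qed
  have pq: "(q - 1) * p = q" "1 - 1 / p = 1 / q"
  proof -
    show "1 - 1 / p = 1 / q" using p by simp
    then show "(q - 1) * p = q" using p(1) q by (simp add: field_simps)
  qed
  define gk where "gk = (\<lambda>k::nat. \<lambda>x. min (g x) (real k))"
  have [measurable]: "gk k \<in> borel_measurable M" for k unfolding gk_def by measurable
  have gk: "0 \<le> gk k x" "gk k x \<le> g x" "gk k x \<le> real k" if "x \<in> space M" for k x
    using g[OF that] by (auto simp: gk_def)
  define I where "I = (\<lambda>k. \<integral>\<^sup>+x. ennreal (gk k x powr q) \<partial>M)"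
  have Ifin: "I k < top" for k
  proof -
    have "I k \<le> (\<integral>\<^sup>+x. ennreal (real k powr q) \<partial>M)"
      unfolding I_def using q gk by (intro nn_integral_mono ennreal_leI powr_mono2) auto
    also have "\<dots> < top" using fin by (simp add: ennreal_mult_less_top)
    finally show ?thesis .
  qed
  have Isup: "(SUP k. I k) = top"
  proof -
    have "(SUP k. I k) = (\<integral>\<^sup>+x. (SUP k. ennreal (gk k x powr q)) \<partial>M)"
      unfolding I_def
    proof (rule nn_integral_monotone_convergence_SUP_AE[symmetric])
      fix k
      show "AE x in M. ennreal (gk k x powr q) \<le> ennreal (gk (Suc k) x powr q)"
        using q gk by (intro AE_I2 ennreal_leI powr_mono2) (auto simp: gk_def)
    qed measurable
    also have "\<dots> \<ge> (\<integral>\<^sup>+x. ennreal (g x powr q) \<partial>M)"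
    proof (rule nn_integral_mono)
      fix x assume "x \<in> space M"
      obtain k :: nat where "g x \<le> real k" using real_arch_simple by blast
      then have "gk k x = g x" by (simp add: gk_def)
      then show "ennreal (g x powr q) \<le> (SUP k. ennreal (gk k x powr q))"
        by (intro SUP_upper2[of k]) auto
    qed
    finally show ?thesis using inf by (simp add: top_unique)
  qed
  have "\<exists>k. ennreal ((4 ^ j) powr q) \<le> I k" for j :: nat
  proof (rule ccontr)
    assume "\<not> (\<exists>k. ennreal ((4 ^ j) powr q) \<le> I k)"
    then have "(SUP k. I k) \<le> ennreal ((4 ^ j) powr q)" by (intro SUP_least) (auto simp: not_le intro: less_imp_le)
    then show False using Isup by (simp add: top_unique)
  qed
  \<comment> \<open>With \<open>(4 ^ j) powr q\<close> the extremal function of the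
    \<open>j\<close>-th truncation pairs with \<open>g\<close> to at least \<open>4 ^ j\<close>,
    which outweighs the factor \<open>2 ^ (- j - 1)\<close> used below.\<close>
  then obtain K where K: "\<And>j. ennreal ((4 ^ j) powr q) \<le> I (K j)" by metis
  define a where "a j = enn2real (I (K j))" for j
  have Ia: "I (K j) = ennreal (a j)" for j using Ifin[of "K j"] by (simp add: a_def)
  have a: "(4 ^ j) powr q \<le> a j" for j
    using K[of j] unfolding Ia by (subst (asm) ennreal_le_iff) (auto simp: a_def)
  have a0: "a j > 0" for j using a[of j] by (rule less_le_trans[rotated]) simp
  \<comment> \<open>The equality case of Hoelder's inequality for the truncation, normalised in
    \<open>L^p\<close>.\<close>
  define F where "F j x = gk (K j) x powr (q - 1) / a j powr (1 / p)" for j x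
  have [measurable]: "F j \<in> borel_measurable M" for j unfolding F_def by measurable
  have F0: "F j x \<ge> 0" for j x by (simp add: F_def)
  have Fp: "F j x powr p = gk (K j) x powr q / a j" if "x \<in> space M" for j x
    using gk[OF that] a0[of j] p pq by (simp add: F_def powr_divide powr_powr)
  have IF: "(\<integral>\<^sup>+x. ennreal (F j x powr p) \<partial>M) = 1" for j
  proof -
    have "(\<integral>\<^sup>+x. ennreal (F j x powr p) \<partial>M) = (\<integral>\<^sup>+x. ennreal (1 / a j) * ennreal (gk (K j) x powr q) \<partial>M)"
      using a0[of j] by (intro nn_integral_cong) (simp add: Fp ennreal_mult[symmetric])
    also have "\<dots> = ennreal (1 / a j) * I (K j)" by (simp add: nn_integral_cmult I_def)
    also have "\<dots> = 1" unfolding Ia using a0[of j] by (simp add: ennreal_mult[symmetric])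
    finally show ?thesis .
  qed
  have Fg: "ennreal (4 ^ j) \<le> (\<integral>\<^sup>+x. ennreal (F j x * g x) \<partial>M)" for j
  proof -
    have "4 ^ j = ((4 ^ j) powr q) powr (1 / q)" using q by (simp add: powr_powr)
    also have "\<dots> \<le> a j powr (1 / q)" using a[of j] q by (intro powr_mono2) auto
    also have "\<dots> = 1 / a j powr (1 / p) * a j" using a0[of j] pq(2) by (simp add: powr_diff flip: pq(2))
    finally have "ennreal (4 ^ j) \<le> ennreal (1 / a j powr (1 / p)) * I (K j)"
      unfolding Ia using a0[of j] by (simp add: ennreal_mult[symmetric] ennreal_leI)
    also have "\<dots> = (\<integral>\<^sup>+x. ennreal (1 / a j powr (1 / p)) * ennreal (gk (K j) x powr q) \<partial>M)"
      by (simp add: nn_integral_cmult I_def)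
    also have "\<dots> \<le> (\<integral>\<^sup>+x. ennreal (F j x * g x) \<partial>M)"
    proof (rule nn_integral_mono)
      fix x assume x: "x \<in> space M"
      have "gk (K j) x powr q = gk (K j) x powr (q - 1) * gk (K j) x"
        using gk(1)[OF x, of "K j"] q powr_mult_base[of "gk (K j) x" "q - 1"] by (simp add: mult.commute)
      also have "\<dots> \<le> gk (K j) x powr (q - 1) * g x" using gk[OF x] by (intro mult_left_mono) auto
      finally have "1 / a j powr (1 / p) * gk (K j) x powr q \<le> F j x * g x"
        using a0[of j] by (simp add: F_def divide_right_mono)
      then show "ennreal (1 / a j powr (1 / p)) * ennreal (gk (K j) x powr q) \<le> ennreal (F j x * g x)"
        by (simp add: ennreal_mult[symmetric] ennreal_leI)
    qed
    finally show ?thesis .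
  qed
  \<comment> \<open>The \<open>p\<close>-th powers are superposed instead of the functions
    themselves. The integral of \<open>h\<close> is then computed termwise, and
    \<open>h powr (1 / p)\<close> dominates a multiple of every \<open>F j\<close>.\<close>
  define h where "h x = (\<Sum>j. ennreal ((1 / 2) ^ Suc j) * ennreal (F j x powr p))" for x
  have [measurable]: "h \<in> borel_measurable M" unfolding h_def by measurable
  have Ih: "(\<integral>\<^sup>+x. h x \<partial>M) = 1"
  proof -
    have "(\<integral>\<^sup>+x. h x \<partial>M) = (\<Sum>j. ennreal ((1 / 2) ^ Suc j))"
      unfolding h_def by (subst nn_integral_suminf) (auto simp: nn_integral_cmult IF)
    also have "\<dots> = ennreal (\<Sum>j. (1 / 2) ^ Suc j)"
      by (rule suminf_ennreal2) (auto simp: sums_summable[OF power_half_series])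
    also have "\<dots> = 1" using power_half_series by (simp add: sums_iff)
    finally show ?thesis .
  qed
  \<comment> \<open>\<open>enn2real\<close> would send an infinite value of \<open>h\<close> to 0
    and spoil the domination; this happens only on a null set.\<close>
  have hfin: "AE x in M. h x \<noteq> top" using nn_integral_PInf_AE[of h M] by (simp add: Ih)
  define f where "f x = enn2real (h x) powr (1 / p)" for x
  have [measurable]: "f \<in> borel_measurable M" unfolding f_def by measurable
  have "f x powr p = enn2real (h x)" for x using p by (simp add: f_def powr_powr)
  then have "(\<integral>\<^sup>+x. ennreal (f x powr p) \<partial>M) \<le> (\<integral>\<^sup>+x. h x \<partial>M)"
    by (intro nn_integral_mono) (auto simp: ennreal_enn2real_if)
  then have fp: "(\<integral>\<^sup>+x. ennreal (f x powr p) \<partial>M) \<le> 1" by (simp add: Ih)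
  have "ennreal (2 ^ j / 2) \<le> (\<integral>\<^sup>+x. ennreal (f x * g x) \<partial>M)" for j
  proof -
    have "ennreal (2 ^ j / 2) = ennreal ((1 / 2) ^ Suc j) * ennreal (4 ^ j)"
    proof -
      have "(2::real) ^ j / 2 = (1 / 2) ^ Suc j * 4 ^ j"
        using power_mult_distrib[of "1/2::real" 4 j] by simp
      then show ?thesis by (simp only:) (rule ennreal_mult, simp_all)
    qed
    also have "\<dots> \<le> ennreal ((1 / 2) ^ Suc j) * (\<integral>\<^sup>+x. ennreal (F j x * g x) \<partial>M)"
      by (intro mult_left_mono Fg) simp
    also have "\<dots> = (\<integral>\<^sup>+x. ennreal ((1 / 2) ^ Suc j) * ennreal (F j x * g x) \<partial>M)"
      by (rule nn_integral_cmult[symmetric]) measurable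
    also have "\<dots> \<le> (\<integral>\<^sup>+x. ennreal (f x * g x) \<partial>M)"
    proof (rule nn_integral_mono_AE)
      show "AE x in M. ennreal ((1 / 2) ^ Suc j) * ennreal (F j x * g x) \<le> ennreal (f x * g x)"
        using hfin
      proof (rule AE_mp, intro AE_I2 impI)
        fix x assume x: "x \<in> space M" and fin: "h x \<noteq> top"
        define c :: real where "c = (1 / 2) ^ Suc j"
        have c: "0 < c" "c \<le> 1" by (auto simp: c_def intro!: power_le_one simp del: power_Suc)
        have "ennreal (c * F j x powr p) \<le> h x"
          unfolding h_def c_def
          by (subst ennreal_mult, simp, simp, rule ennreal_le_suminf[of "\<lambda>j. ennreal ((1 / 2) ^ Suc j) * ennreal (F j x powr p)"])
        also have "h x = ennreal (enn2real (h x))" using fin by (simp add: less_top)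
        finally have "c * F j x powr p \<le> enn2real (h x)" by (simp add: ennreal_le_iff)
        then have "(c * F j x powr p) powr (1 / p) \<le> f x"
          unfolding f_def using p c by (intro powr_mono2) auto
        then have "c powr (1 / p) * F j x \<le> f x" using p F0[of j x] by (simp add: powr_mult powr_powr)
        \<comment> \<open>A number in \<open>(0,1]\<close> is at most its \<open>p\<close>-th
          root.\<close>
        moreover have "c * F j x \<le> c powr (1 / p) * F j x"
          using c p powr_mono'[of "1 / p" 1 c] F0[of j x] by (intro mult_right_mono) auto
        ultimately have "c * F j x * g x \<le> f x * g x" using g[OF x] by (intro mult_right_mono) auto
        then show "ennreal ((1 / 2) ^ Suc j) * ennreal (F j x * g x) \<le> ennreal (f x * g x)"
          using c F0[of j x] g[OF x] unfolding c_def[symmetric] by (simp add: ennreal_mult[symmetric] ennreal_leI mult.assoc)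
      qed
    qed
    finally show ?thesis .
  qed
  then have fg: "(\<integral>\<^sup>+x. ennreal (f x * g x) \<partial>M) = top"
  proof (cases "\<integral>\<^sup>+x. ennreal (f x * g x) \<partial>M")
    case (real b)
    obtain j :: nat where "2 * b < 2 ^ j" using real_arch_pow[of 2 "2 * b"] by auto
    moreover assume "\<And>j. ennreal (2 ^ j / 2) \<le> (\<integral>\<^sup>+x. ennreal (f x * g x) \<partial>M)"
    then have "ennreal (2 ^ j / 2) \<le> ennreal b" using real by metis
    then have "2 ^ j / 2 \<le> b" using real(1) by (subst (asm) ennreal_le_iff) auto
    ultimately show ?thesis by simp
  qed
  show thesis by (rule that[of f]) (use fp fg in \<open>auto simp: f_def\<close>, measurable)
qed

subsection \<open>Moments\<close>

abbreviation odd_moment :: "(real \<Rightarrow> real) \<Rightarrow> nat \<Rightarrow> real" where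
  "odd_moment \<omega> n \<equiv> moment \<omega> (real (2 * n + 1))"

text \<open>A radial weight is arbitrary outside \<open>[0,1)\<close>, so it is measurable only
  after being cut off.\<close>

lemma measurable_weight_on_unit [measurable (raw)]:
  "radial_weight \<omega> \<Longrightarrow> (\<lambda>t. indicator {0..<1} t *\<^sub>R \<omega> t) \<in> borel_measurable lebesgue"
  by (auto simp: radial_weight_def set_integrable_def dest: borel_measurable_integrable)

lemma set_integrable_bounded_factor:
  fixes f :: "real \<Rightarrow> 'a :: {real_normed_field, banach, second_countable_topology}"
  assumes f: "set_integrable lebesgue S f" and [measurable]: "b \<in> borel_measurable borel"
    and le: "\<And>t. t \<in> S \<Longrightarrow> norm (b t) \<le> 1"
  shows "set_integrable lebesgue S (\<lambda>t. b t * f t)"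
proof (rule set_integrable_bound[OF f])
  have [measurable]: "b \<in> borel_measurable lebesgue" using measurable_completion[of b lborel borel] by simp
  have "(\<lambda>t. indicator S t *\<^sub>R f t) \<in> borel_measurable lebesgue"
    using f by (simp add: set_integrable_def)
  then have "(\<lambda>t. b t * (indicator S t *\<^sub>R f t)) \<in> borel_measurable lebesgue" by measurable
  then show "set_borel_measurable lebesgue S (\<lambda>t. b t * f t)"
    by (simp add: set_borel_measurable_def)
  show "AE t in lebesgue. t \<in> S \<longrightarrow> norm (b t * f t) \<le> norm (f t)"
    using le by (auto simp: norm_mult intro!: mult_left_le_one_le)
qed

lemma moment_integrable:
  assumes \<omega>: "radial_weight \<omega>" and x: "x \<ge> 0"
  shows "set_integrable lebesgue {0..<1} (\<lambda>r. r powr x * \<omega> r)"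
  using \<omega> x by (intro set_integrable_bounded_factor) (auto simp: radial_weight_def powr_le1)

text \<open>Only the mass beyond \<open>\<rho>\<close> is kept. As \<open>\<rho>\<close> may be
  arbitrarily close to 1 and the tail is positive there, the moments decay more slowly than any
  geometric sequence.\<close>

lemma moment_ge:
  assumes \<omega>: "radial_weight \<omega>" and x: "x \<ge> 0" and \<rho>: "0 \<le> \<rho>" "\<rho> < 1"
  shows "\<rho> powr x * weight_tail \<omega> \<rho> \<le> moment \<omega> x"
proof -
  have int: "set_integrable lebesgue {0..<1} \<omega>" using \<omega> by (simp add: radial_weight_def)
  have int': "set_integrable lebesgue {\<rho>..<1} \<omega>"
    by (rule set_integrable_subset[OF int]) (use \<rho> in auto)
  have "\<rho> powr x * weight_tail \<omega> \<rho> = (LINT s|lebesgue. \<rho> powr x * (indicator {\<rho>..<1} s *\<^sub>R \<omega> s))"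
    unfolding weight_tail_def set_lebesgue_integral_def by simp
  also have "\<dots> \<le> (LINT s|lebesgue. indicator {0..<1} s *\<^sub>R (s powr x * \<omega> s))"
  proof (rule integral_mono)
    show "integrable lebesgue (\<lambda>s. \<rho> powr x * (indicator {\<rho>..<1} s *\<^sub>R \<omega> s))"
      using int' by (intro integrable_mult_right) (simp add: set_integrable_def)
    show "integrable lebesgue (\<lambda>s. indicator {0..<1} s *\<^sub>R (s powr x * \<omega> s))"
      using moment_integrable[OF \<omega> x] by (simp add: set_integrable_def)
    fix s :: real
    show "\<rho> powr x * (indicator {\<rho>..<1} s *\<^sub>R \<omega> s) \<le> indicator {0..<1} s *\<^sub>R (s powr x * \<omega> s)"
      using \<omega> \<rho> x by (auto simp: indicator_def radial_weight_def intro!: mult_right_mono powr_mono2)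
  qed
  also have "\<dots> = moment \<omega> x" by (simp add: moment_def set_lebesgue_integral_def)
  finally show ?thesis .
qed

lemma odd_moment_ge:
  assumes "radial_weight \<omega>" "0 < \<rho>" "\<rho> < 1"
  shows "\<rho> ^ (2 * n + 1) * weight_tail \<omega> \<rho> \<le> odd_moment \<omega> n"
  using moment_ge[of \<omega> "real (2 * n + 1)" \<rho>] powr_realpow[of \<rho> "2 * n + 1"] assms by simp

lemma odd_moment_pos:
  assumes \<omega>: "radial_weight \<omega>"
  shows "odd_moment \<omega> n > 0"
proof -
  have "0 < weight_tail \<omega> (1 / 2)" using \<omega> by (simp add: radial_weight_def)
  then have "0 < (1 / 2) ^ (2 * n + 1) * weight_tail \<omega> (1 / 2)" by (intro mult_pos_pos) auto
  also have "\<dots> \<le> odd_moment \<omega> n" by (intro odd_moment_ge \<omega>) auto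
  finally show ?thesis .
qed

lemma summable_power_div_odd_moment:
  assumes \<omega>: "radial_weight \<omega>" and x: "0 \<le> x" "x < 1"
  shows "summable (\<lambda>n. x ^ n / odd_moment \<omega> n)"
proof -
  obtain \<rho> where \<rho>: "0 < \<rho>" "\<rho> < 1" "x < \<rho>\<^sup>2"
  proof
    \<comment> \<open>The moment of index \<open>2 * n + 1\<close> is of order at least
      \<open>\<rho>^(2 * n)\<close>, so it is \<open>\<rho>^2\<close> that must exceed
      \<open>x\<close>; the midpoint of \<open>x\<close> and 1 does.\<close>
    let ?\<rho> = "sqrt ((1 + x) / 2)"
    show "0 < ?\<rho>" "?\<rho> < 1" "x < ?\<rho>\<^sup>2" using x by auto
  qed
  define T where "T = weight_tail \<omega> \<rho>"
  have T: "T > 0" using \<omega> \<rho> by (auto simp: T_def radial_weight_def)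
  have "summable (\<lambda>n. 1 / (\<rho> * T) * (x / \<rho>\<^sup>2) ^ n)"
    using x \<rho> by (intro summable_mult summable_geometric) (auto simp: field_simps)
  then show ?thesis
  proof (rule summable_comparison_test')
    fix n :: nat
    have "x ^ n / odd_moment \<omega> n \<le> x ^ n / (\<rho> ^ (2 * n + 1) * T)"
      using odd_moment_ge[OF \<omega> \<rho>(1,2), of n] T \<rho> x odd_moment_pos[OF \<omega>, of n]
      by (intro divide_left_mono mult_pos_pos) (simp_all add: T_def)
    also have "\<dots> = 1 / (\<rho> * T) * (x / \<rho>\<^sup>2) ^ n"
      by (simp add: power_divide power_mult)
    finally show "norm (x ^ n / odd_moment \<omega> n) \<le> 1 / (\<rho> * T) * (x / \<rho>\<^sup>2) ^ n"
      using x odd_moment_pos[OF \<omega>, of n] by simp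
  qed
qed

subsection \<open>Power series of the operator\<close>

text \<open>The coefficient of \<open>(t * z)^n\<close> in the averaged kernel: integrating the
  \<open>n\<close>-th power and dividing by \<open>z\<close> contributes
  \<open>1 / (n + 1)\<close>.\<close>

definition kernel_coeff :: "(real \<Rightarrow> real) \<Rightarrow> nat \<Rightarrow> real" where
  "kernel_coeff \<omega> n = 1 / (2 * (real n + 1) * odd_moment \<omega> n)"

lemma kernel_coeff_pos: "radial_weight \<omega> \<Longrightarrow> kernel_coeff \<omega> n > 0"
  unfolding kernel_coeff_def using odd_moment_pos[of \<omega> n] by (intro divide_pos_pos mult_pos_pos) auto

lemma summable_kernel_coeff:
  assumes \<omega>: "radial_weight \<omega>" and x: "0 \<le> x" "x < 1"
  shows "summable (\<lambda>n. kernel_coeff \<omega> n * x ^ n)"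
proof (rule summable_comparison_test'[OF summable_power_div_odd_moment[OF \<omega> x]])
  fix n :: nat
  have "odd_moment \<omega> n * 1 \<le> odd_moment \<omega> n * (2 * (real n + 1))"
    using odd_moment_pos[OF \<omega>, of n] by (intro mult_left_mono) auto
  then have "x ^ n / (2 * (real n + 1) * odd_moment \<omega> n) \<le> x ^ n / odd_moment \<omega> n"
    using odd_moment_pos[OF \<omega>, of n] x by (intro divide_left_mono mult_pos_pos) (auto simp: mult.commute)
  then show "norm (kernel_coeff \<omega> n * x ^ n) \<le> x ^ n / odd_moment \<omega> n"
    using odd_moment_pos[OF \<omega>, of n] x by (simp add: kernel_coeff_def)
qed

lemma hilbert_kernel_sums:
  assumes \<omega>: "radial_weight \<omega>" and t: "0 \<le> t" "t < 1" and z: "norm z < 1"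
  shows "(\<lambda>n. of_real (kernel_coeff \<omega> n) * (of_real t * z) ^ n) sums hilbert_kernel \<omega> t z"
proof -
  define b :: "nat \<Rightarrow> complex" where "b n = of_real (t ^ n / (2 * odd_moment \<omega> n))" for n :: nat
  \<comment> \<open>Coefficients of the primitive \<open>G\<close> vanishing at 0, shifted by one so
    that \<open>diffs c\<close> is again \<open>b\<close>.\<close>
  define c :: "nat \<Rightarrow> complex" where "c n = (if n = 0 then 0 else b (n - 1) / of_nat n)" for n
  have bk: "bergman_kernel \<omega> (of_real t) \<zeta> = (\<Sum>n. b n * \<zeta> ^ n)" for \<zeta>
    unfolding bergman_kernel_def b_def by (simp add: power_mult_distrib)
  have bc: "b n = of_nat (Suc n) * (of_real (kernel_coeff \<omega> n) * of_real t ^ n)" for n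
  proof -
    have "t ^ n / (2 * odd_moment \<omega> n) = (real n + 1) * (kernel_coeff \<omega> n * t ^ n)"
    proof -
      have "x / (2 * m) = k * (1 / (2 * k * m) * x)" if "k \<noteq> 0" for k m x :: real using that by simp
      from this[of "real n + 1"] show ?thesis by (simp only: kernel_coeff_def)
    qed
    then show ?thesis unfolding b_def by (simp only:) (simp add: add.commute)
  qed
  have diffs: "diffs c = b" by (simp add: diffs_def c_def fun_eq_iff del: of_nat_Suc)
  have cS: "c (Suc n) = of_real (kernel_coeff \<omega> n) * of_real t ^ n" for n
    by (simp add: c_def bc del: of_nat_Suc)
  have summ: "summable (\<lambda>n. c n * w ^ n)" if w: "norm w < 1" for w
  proof -
    have "summable (\<lambda>n. kernel_coeff \<omega> n * norm w ^ n)"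
      by (rule summable_kernel_coeff[OF \<omega>]) (use w in auto)
    then have "summable (\<lambda>n. c (Suc n) * w ^ n)"
    proof (rule summable_comparison_test')
      fix n
      have "kernel_coeff \<omega> n * (t ^ n * norm w ^ n) \<le> kernel_coeff \<omega> n * (1 * norm w ^ n)"
        using t kernel_coeff_pos[OF \<omega>, of n] by (intro mult_left_mono mult_right_mono power_le_one) auto
      then show "norm (c (Suc n) * w ^ n) \<le> kernel_coeff \<omega> n * norm w ^ n"
        using t kernel_coeff_pos[OF \<omega>, of n] by (simp add: cS norm_mult norm_power)
    qed
    then have "summable (\<lambda>n. c (Suc n) * w ^ Suc n)"
      using summable_mult2[of "\<lambda>n. c (Suc n) * w ^ n" w] by (simp add: mult_ac)
    then show ?thesis by (subst summable_Suc_iff[symmetric])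
  qed
  define G where "G w = (\<Sum>n. c n * w ^ n)" for w
  have G': "(G has_field_derivative bergman_kernel \<omega> (of_real t) w) (at w)" if w: "norm w < 1" for w
  proof -
    obtain k where k: "norm w < k" "k < 1" using dense[OF w] by blast
    then have "k > 0" using norm_ge_zero[of w] by linarith
    have "((\<lambda>w. \<Sum>n. c n * w ^ n) has_field_derivative (\<Sum>n. diffs c n * w ^ n)) (at w)"
      by (rule termdiffs_strong[where K = "of_real k"]) (use k \<open>k > 0\<close> summ in auto)
    then show ?thesis unfolding G_def[abs_def] bk diffs .
  qed
  have ci: "contour_integral (linepath 0 z) (bergman_kernel \<omega> (of_real t)) = G z - G 0"
  proof (rule contour_integral_unique)
    have "(bergman_kernel \<omega> (of_real t) has_contour_integral (G (pathfinish (linepath 0 z)) - G (pathstart (linepath 0 z)))) (linepath 0 z)"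
    proof (rule contour_integral_primitive[where S = "ball 0 1"])
      show "valid_path (linepath 0 z)" by (rule valid_path_linepath)
      show "path_image (linepath 0 z) \<subseteq> ball 0 1"
        unfolding path_image_linepath by (rule closed_segment_subset) (use z in auto)
    qed (use G' in \<open>auto intro: has_field_derivative_at_within\<close>)
    then show "(bergman_kernel \<omega> (of_real t) has_contour_integral G z - G 0) (linepath 0 z)" by simp
  qed
  have G0: "G 0 = 0" unfolding G_def by (simp add: c_def)
  have sumc: "summable (\<lambda>n. c (Suc n) * z ^ n)"
  proof (rule summable_comparison_test'[OF summable_kernel_coeff[OF \<omega>, of "norm z"]])
    fix n :: nat
    have "kernel_coeff \<omega> n * (t ^ n * norm z ^ n) \<le> kernel_coeff \<omega> n * (1 * norm z ^ n)"
      using t kernel_coeff_pos[OF \<omega>, of n] by (intro mult_left_mono mult_right_mono power_le_one) auto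
    then show "norm (c (Suc n) * z ^ n) \<le> kernel_coeff \<omega> n * norm z ^ n"
      using t kernel_coeff_pos[OF \<omega>, of n] by (simp add: cS norm_mult norm_power)
  qed (use z in auto)
  have Gz: "G z = z * (\<Sum>n. c (Suc n) * z ^ n)"
  proof -
    have "(\<lambda>n. z * (c (Suc n) * z ^ n)) sums (z * (\<Sum>n. c (Suc n) * z ^ n))"
      by (intro sums_mult summable_sums sumc)
    then have "(\<lambda>n. c (Suc n) * z ^ Suc n) sums (z * (\<Sum>n. c (Suc n) * z ^ n))"
      by (simp add: mult_ac)
    then have "(\<lambda>n. c n * z ^ n) sums (z * (\<Sum>n. c (Suc n) * z ^ n))"
      by (subst (asm) sums_Suc_iff) (simp add: c_def)
    then show ?thesis by (simp add: G_def sums_iff)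
  qed
  have "hilbert_kernel \<omega> t z = (\<Sum>n. c (Suc n) * z ^ n)"
  proof (cases "z = 0")
    case True
    have "bergman_kernel \<omega> (of_real t) 0 = b 0" unfolding bk using powser_zero[of b] by simp
    also have "b 0 = c (Suc 0)" by (simp add: c_def)
    also have "\<dots> = (\<Sum>n. c (Suc n) * 0 ^ n)" using powser_zero[of "\<lambda>n. c (Suc n)"] by simp
    finally show ?thesis using True by (simp add: hilbert_kernel_def)
  next
    case False
    then show ?thesis by (simp add: hilbert_kernel_def ci G0 Gz)
  qed
  then show ?thesis using sumc by (simp add: sums_iff cS power_mult_distrib mult_ac)
qed

text \<open>On \<open>[0,1)\<close> the powers \<open>t^n\<close> are at most 1, so the series is
  dominated by \<open>kernel_coeff \<omega> n * norm z ^ n\<close> times the integrable function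
  \<open>|g \<omega>|\<close>. Integrability of \<open>g \<omega>\<close> thus settles every
  \<open>z\<close> in the disc at once.\<close>

lemma H_op_series:
  assumes \<omega>: "radial_weight \<omega>" and g: "set_integrable lebesgue {0..<1} (\<lambda>t. g t * of_real (\<omega> t))"
    and z: "norm z < 1"
  shows "set_integrable lebesgue {0..<1} (\<lambda>t. g t * hilbert_kernel \<omega> t z * of_real (\<omega> t))"
    and "(\<lambda>n. (of_real (kernel_coeff \<omega> n) * (LINT t:{0..<1}|lebesgue. of_real (t ^ n) * (g t * of_real (\<omega> t)))) * z ^ n)
      sums (LINT t:{0..<1}|lebesgue. g t * hilbert_kernel \<omega> t z * of_real (\<omega> t))"
proof -
  define P where "P n = (\<lambda>t. indicator {0..<1} t *\<^sub>R (of_real (t ^ n) * (g t * of_real (\<omega> t))))" for n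
  define a where "a n = of_real (kernel_coeff \<omega> n) * z ^ n" for n
  have Pint: "integrable lebesgue (P n)" for n
    unfolding P_def set_integrable_def[symmetric]
    by (rule set_integrable_bounded_factor[OF g]) (auto simp: norm_power intro!: power_le_one)
  have fint: "integrable lebesgue (\<lambda>t. a n * P n t)" for n
    using Pint by simp
  have Pnorm: "norm (P n t) \<le> norm (P 0 t)" for n t
    by (auto simp: P_def indicator_def norm_mult norm_power intro!: mult_left_le_one_le power_le_one)
  have an: "norm (a n) = kernel_coeff \<omega> n * norm z ^ n" for n
    using kernel_coeff_pos[OF \<omega>, of n] by (simp add: a_def norm_mult norm_power)
  have suma: "summable (\<lambda>n. norm (a n))"
    unfolding an by (rule summable_kernel_coeff[OF \<omega>]) (use z in auto)
  have sum1: "summable (\<lambda>n. norm (a n * P n t))" for t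
    by (rule summable_comparison_test'[OF summable_mult2[OF suma, of "norm (P 0 t)"]])
       (auto simp: norm_mult intro!: mult_left_mono Pnorm)
  have sum2: "summable (\<lambda>n. LINT t|lebesgue. norm (a n * P n t))"
  proof (rule summable_comparison_test'[OF summable_mult2[OF suma, of "LINT t|lebesgue. norm (P 0 t)"]])
    fix n
    have "(LINT t|lebesgue. norm (a n * P n t)) \<le> (LINT t|lebesgue. norm (a n) * norm (P 0 t))"
      using Pint by (intro integral_mono) (auto simp: norm_mult intro!: mult_left_mono Pnorm)
    then show "norm (LINT t|lebesgue. norm (a n * P n t)) \<le> norm (a n) * (LINT t|lebesgue. norm (P 0 t))"
      by simp
  qed
  have eq: "(\<Sum>n. a n * P n t) = indicator {0..<1} t *\<^sub>R (g t * hilbert_kernel \<omega> t z * of_real (\<omega> t))" for t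
  proof (cases "t \<in> {0..<1}")
    case True
    then have "(\<lambda>n. g t * of_real (\<omega> t) * (of_real (kernel_coeff \<omega> n) * (of_real t * z) ^ n)) sums (g t * of_real (\<omega> t) * hilbert_kernel \<omega> t z)"
      using z by (intro sums_mult hilbert_kernel_sums[OF \<omega>]) auto
    then show ?thesis using True by (simp add: sums_iff P_def a_def power_mult_distrib mult_ac)
  qed (simp add: P_def)
  show "set_integrable lebesgue {0..<1} (\<lambda>t. g t * hilbert_kernel \<omega> t z * of_real (\<omega> t))"
    unfolding set_integrable_def eq[symmetric] by (rule integrable_suminf[OF fint]) (use sum1 sum2 in auto)
  have "(\<lambda>n. LINT t|lebesgue. a n * P n t) sums (LINT t|lebesgue. (\<Sum>n. a n * P n t))"
    by (rule sums_integral[OF fint]) (use sum1 sum2 in auto)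
  then show "(\<lambda>n. (of_real (kernel_coeff \<omega> n) * (LINT t:{0..<1}|lebesgue. of_real (t ^ n) * (g t * of_real (\<omega> t)))) * z ^ n)
      sums (LINT t:{0..<1}|lebesgue. g t * hilbert_kernel \<omega> t z * of_real (\<omega> t))"
    unfolding eq set_lebesgue_integral_def P_def[symmetric] by (simp add: a_def fun_cong[OF P_def, symmetric] mult_ac)
qed

definition H_fun :: "(real \<Rightarrow> real) \<Rightarrow> (real \<Rightarrow> complex) \<Rightarrow> complex \<Rightarrow> complex" where
  "H_fun \<omega> g z = (LINT t:{0..<1}|lebesgue. g t * hilbert_kernel \<omega> t z * of_real (\<omega> t))"

lemma H_op_eq_Some:
  assumes "radial_weight \<omega>" "set_integrable lebesgue {0..<1} (\<lambda>t. g t * of_real (\<omega> t))"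
  shows "H_op \<omega> g = Some (H_fun \<omega> g)"
  using H_op_series(1)[OF assms] by (simp add: H_op_def H_fun_def fun_eq_iff)

lemma H_tilde_op_eq_H_op: "H_tilde_op \<omega> f = H_op \<omega> (\<lambda>t. of_real (norm (f t)))"
  by (simp add: H_op_def H_tilde_op_def)

lemma H_fun_holomorphic:
  assumes "radial_weight \<omega>" "set_integrable lebesgue {0..<1} (\<lambda>t. g t * of_real (\<omega> t))"
  shows "H_fun \<omega> g holomorphic_on ball 0 1"
  by (rule power_series_holomorphic[where a = "\<lambda>n. of_real (kernel_coeff \<omega> n) * (LINT t:{0..<1}|lebesgue. of_real (t ^ n) * (g t * of_real (\<omega> t)))"])
     (use H_op_series(2)[OF assms] in \<open>simp add: H_fun_def\<close>)

text \<open>At \<open>z = 0\<close> the kernel is the nonzero constant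
  \<open>kernel_coeff \<omega> 0\<close>, so being defined at that one point forces
  integrability.\<close>

lemma H_op_Some_imp_integrable:
  assumes \<omega>: "radial_weight \<omega>" and eq: "H_op \<omega> g = Some h"
  shows "set_integrable lebesgue {0..<1} (\<lambda>t. g t * of_real (\<omega> t))"
proof -
  define k :: complex where "k = of_real (kernel_coeff \<omega> 0)"
  have k: "k \<noteq> 0" using kernel_coeff_pos[OF \<omega>, of 0] by (simp add: k_def)
  have hk: "hilbert_kernel \<omega> t 0 = k" if "0 \<le> t" "t < 1" for t
    using hilbert_kernel_sums[OF \<omega> that, of 0] powser_sums_zero_iff[of "\<lambda>n. of_real (kernel_coeff \<omega> n)" "hilbert_kernel \<omega> t 0"]
    by (simp add: k_def)
  have "\<forall>z\<in>ball 0 1. set_integrable lebesgue {0..<1} (\<lambda>t. g t * hilbert_kernel \<omega> t z * of_real (\<omega> t))"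
    using eq by (auto simp: H_op_def split: if_splits)
  then have "set_integrable lebesgue {0..<1} (\<lambda>t. g t * hilbert_kernel \<omega> t 0 * of_real (\<omega> t))" by simp
  then have "set_integrable lebesgue {0..<1} (\<lambda>t. (1 / k) * (g t * hilbert_kernel \<omega> t 0 * of_real (\<omega> t)))"
    by (rule set_integrable_mult_right)
  also have "?this \<longleftrightarrow> set_integrable lebesgue {0..<1} (\<lambda>t. g t * of_real (\<omega> t))"
    using k by (intro set_integrable_cong) (auto simp: hk)
  finally show ?thesis .
qed

subsection \<open>Construction of the perturbation\<close>

lemma nat_floor_inverse_gap_eq_iff:
  fixes t :: real
  assumes "0 \<le> t" "t < 1"
  shows "nat \<lfloor>1 / (1 - t)\<rfloor> - 1 = n \<longleftrightarrow> 1 - 1 / (real n + 1) \<le> t \<and> t < 1 - 1 / (real n + 2)"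
  using nat_floor_inverse_eq_iff[of "1 - t" n] assms by auto

text \<open>Every required upper bound is an estimate of masses, while the integral of
  \<open>\<eta> powr q\<close> depends on the heights. So the masses \<open>m n\<close> are fixed
  first, as small as the bounds demand, and then the heights \<open>h n\<close> are raised, the
  widths being \<open>m n / h n\<close>. The spike \<open>n\<close> begins at \<open>r n\<close> and
  stays inside \<open>[r n, r (Suc n))\<close>, which makes \<open>\<eta>\<close> bounded on each
  \<open>[0,r]\<close>.\<close>

lemma tiny_spike_weight:
  fixes \<delta> :: "nat \<Rightarrow> real" and \<tau> :: "real \<Rightarrow> real"
  assumes q: "q > 1" and \<delta>: "\<And>n. \<delta> n > 0"
    and K: "\<And>\<rho>. 0 < \<rho> \<Longrightarrow> \<rho> < 1 \<Longrightarrow> \<exists>K. \<forall>n. \<rho> ^ n \<le> K * \<delta> n"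
    and \<tau>: "\<And>r. 0 \<le> r \<Longrightarrow> r < 1 \<Longrightarrow> \<tau> r > 0"
    and \<tau>_anti: "\<And>r s. 0 \<le> r \<Longrightarrow> r \<le> s \<Longrightarrow> s < 1 \<Longrightarrow> \<tau> s \<le> \<tau> r"
  obtains \<eta> :: "real \<Rightarrow> real" where "\<eta> \<in> borel_measurable borel" "\<And>t. \<eta> t \<ge> 0"
    "\<And>n. (\<integral>\<^sup>+t\<in>{0..<1}. ennreal (t ^ n * (1 - t) powr (-2) * \<eta> t) \<partial>lborel) \<le> ennreal (\<delta> n)"
    "\<And>r. 0 \<le> r \<Longrightarrow> r < 1 \<Longrightarrow> (\<integral>\<^sup>+t\<in>{r..<1}. ennreal (\<eta> t) \<partial>lborel) \<le> ennreal (\<tau> r)"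
    "\<And>r. 0 \<le> r \<Longrightarrow> r < 1 \<Longrightarrow> \<exists>B. \<forall>t\<in>{0..r}. \<eta> t \<le> B"
    "(\<integral>\<^sup>+t\<in>{0..<1}. ennreal (\<eta> t powr q) \<partial>lborel) = top"
proof -
  define r where "r n = 1 - 1 / (real n + 1)" for n :: nat
  have r: "0 \<le> r n" "r n < r (Suc n)" "r (Suc n) < 1" "0 < r (Suc n)" for n
    by (auto simp: r_def field_simps)
  \<comment> \<open>The constant belongs to the right end of the \<open>n\<close>-th block, so one
    mass per spike will serve all the moments simultaneously.\<close>
  have "\<exists>K>0. \<forall>m. r (Suc n) ^ m \<le> K * \<delta> m" for n
  proof -
    obtain K0 where K0: "\<And>m. r (Suc n) ^ m \<le> K0 * \<delta> m" using K[of "r (Suc n)"] r by blast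
    have "0 < K0 * \<delta> 0" using K0[of 0] by simp
    then have "K0 > 0" using \<delta>[of 0] by (simp add: zero_less_mult_iff)
    then show ?thesis using K0 by blast
  qed
  then obtain k where k: "\<And>n. k n > 0" "\<And>n m. r (Suc n) ^ m \<le> k n * \<delta> m" by metis
  \<comment> \<open>The halves make the spikes summable. The first bound is for the tails; the
    second cancels \<open>k n\<close> and the factor \<open>(n + 2)^2\<close>, which bounds
    \<open>(1 - t)^(-2)\<close> on the block.\<close>
  define m where "m n = (1 / 2) ^ Suc n * min (\<tau> (r (Suc n))) (1 / ((real n + 2)\<^sup>2 * k n))" for n
  have m: "m n > 0" for n
    unfolding m_def using k(1)[of n] \<tau>[of "r (Suc n)"] r[of n] by (intro mult_pos_pos) auto
  have "\<exists>h>0. m n / h \<le> r (Suc n) - r n \<and> 1 \<le> m n * h powr (q - 1)" for n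
  proof -
    \<comment> \<open>The first entry lets the spike contribute at least 1 to the integral of the
      \<open>q\<close>-th power, since that contribution is \<open>m n * h powr (q - 1)\<close>. The
      second makes the spike fit into its block.\<close>
    define h where "h = max ((1 / m n) powr (1 / (q - 1))) (m n / (r (Suc n) - r n))"
    have h: "h > 0" using m[of n] by (simp add: h_def less_max_iff_disj)
    have "m n / (r (Suc n) - r n) \<le> h" by (simp add: h_def)
    then have "m n / h \<le> r (Suc n) - r n" using h r(2)[of n] by (simp add: field_simps)
    moreover have "((1 / m n) powr (1 / (q - 1))) powr (q - 1) \<le> h powr (q - 1)"
      using q by (intro powr_mono2) (auto simp: h_def)
    then have "1 / m n \<le> h powr (q - 1)" using q m[of n] by (simp add: powr_powr)
    then have "1 \<le> m n * h powr (q - 1)" using m[of n] by (simp add: field_simps)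
    ultimately show ?thesis using h by blast
  qed
  then obtain h where h: "\<And>n. h n > 0" "\<And>n. m n / h n \<le> r (Suc n) - r n" "\<And>n. 1 \<le> m n * h n powr (q - 1)"
    by metis
  define N :: "real \<Rightarrow> nat" where "N t = nat \<lfloor>1 / (1 - t)\<rfloor> - 1" for t
  have [measurable]: "N \<in> measurable borel (count_space UNIV)" unfolding N_def by measurable
  have N: "N t = n \<longleftrightarrow> r n \<le> t \<and> t < r (Suc n)" if "0 \<le> t" "t < 1" for t n
    using nat_floor_inverse_gap_eq_iff[OF that, of n] by (simp add: N_def r_def add.commute)
  define J where "J n = {r n..<r n + m n / h n}" for n
  have J: "r n \<le> t" "t < r (Suc n)" "0 \<le> t" "t < 1" "N t = n" if "t \<in> J n" for t n
  proof -
    show 1: "r n \<le> t" "t < r (Suc n)" using that h(2)[of n] by (auto simp: J_def)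
    then show 2: "0 \<le> t" "t < 1" using r[of n] by linarith+
    show "N t = n" using N[OF 2] 1 by simp
  qed
  have [measurable]: "J n \<in> sets borel" for n by (simp add: J_def)
  define \<eta> where "\<eta> t = (if 0 \<le> t \<and> t < 1 \<and> t < r (N t) + m (N t) / h (N t) then h (N t) else 0)" for t
  have [measurable]: "\<eta> \<in> borel_measurable borel" unfolding \<eta>_def by measurable
  have \<eta>0: "\<eta> t \<ge> 0" for t using h(1)[of "N t"] by (simp add: \<eta>_def)
  have \<eta>J: "\<eta> t = h n" if "t \<in> J n" for t n
    using J[OF that] that by (auto simp: \<eta>_def J_def)
  have \<eta>notJ: "\<eta> t = 0" if "0 \<le> t" "t < 1" "t \<notin> J (N t)" for t
    using that N[of t "N t"] by (auto simp: \<eta>_def J_def)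
  have len: "emeasure lborel (J n) = ennreal (m n / h n)" for n
    using m[of n] h(1)[of n] by (simp add: J_def less_imp_le)
  have split: "(\<integral>\<^sup>+t. \<psi> t (\<eta> t) * indicator {0..<1} t \<partial>lborel) = (\<Sum>n. \<integral>\<^sup>+t. \<psi> t (h n) * indicator (J n) t \<partial>lborel)"
    if [measurable]: "\<And>c. (\<lambda>t. \<psi> t c) \<in> borel_measurable borel" and 0: "\<And>t. \<psi> t 0 = 0" for \<psi> :: "real \<Rightarrow> real \<Rightarrow> ennreal"
  proof -
    have "(\<integral>\<^sup>+t. \<psi> t (\<eta> t) * indicator {0..<1} t \<partial>lborel) = (\<integral>\<^sup>+t. \<psi> t (h (N t)) * indicator (J (N t)) t \<partial>lborel)"
    proof (rule nn_integral_cong)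
      fix t :: real
      show "\<psi> t (\<eta> t) * indicator {0..<1} t = \<psi> t (h (N t)) * indicator (J (N t)) t"
      proof (cases "t \<in> J (N t)")
        case True then show ?thesis using J[OF True] \<eta>J[OF True] by simp
      next
        case False then show ?thesis using \<eta>notJ[of t] 0 by (auto simp: indicator_def)
      qed
    qed
    also have "\<dots> = (\<Sum>n. \<integral>\<^sup>+t. \<psi> t (h n) * indicator (J n) t * indicator {t. N t = n} t \<partial>lborel)"
      by (rule nn_integral_partition[where H = "\<lambda>n t. \<psi> t (h n) * indicator (J n) t"]) measurable
    also have "\<dots> = (\<Sum>n. \<integral>\<^sup>+t. \<psi> t (h n) * indicator (J n) t \<partial>lborel)"
      using J by (intro suminf_cong nn_integral_cong) (auto simp: indicator_def)
    finally show ?thesis .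
  qed
  have const: "(\<integral>\<^sup>+t. ennreal c * indicator (J n) t \<partial>lborel) = ennreal (c * (m n / h n))" if "c \<ge> 0" for c n
    using that m[of n] h(1)[of n] by (subst nn_integral_cmult_indicator) (auto simp: len ennreal_mult[symmetric])
  have half: "(\<Sum>n. ennreal ((1 / 2) ^ Suc n * c)) = ennreal c" if "c \<ge> 0" for c
  proof -
    have "(\<lambda>n. (1 / 2) ^ Suc n * c) sums (1 * c)" by (intro sums_mult2 power_half_series)
    then show ?thesis using that by (subst suminf_ennreal2) (auto simp: sums_iff)
  qed
  show thesis
  proof (rule that[of \<eta>])
    fix i :: nat
    have "(\<integral>\<^sup>+t\<in>{0..<1}. ennreal (t ^ i * (1 - t) powr (-2) * \<eta> t) \<partial>lborel)
        = (\<Sum>n. \<integral>\<^sup>+t. ennreal (t ^ i * (1 - t) powr (-2) * h n) * indicator (J n) t \<partial>lborel)"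
      by (rule split) auto
    also have "\<dots> \<le> (\<Sum>n. ennreal ((1 / 2) ^ Suc n * \<delta> i))"
    proof (rule suminf_le)
      fix n
      let ?c = "r (Suc n) ^ i * (real n + 2)\<^sup>2 * h n"
      have "(\<integral>\<^sup>+t. ennreal (t ^ i * (1 - t) powr (-2) * h n) * indicator (J n) t \<partial>lborel) \<le> (\<integral>\<^sup>+t. ennreal ?c * indicator (J n) t \<partial>lborel)"
      proof (rule nn_integral_mono)
        fix t
        show "ennreal (t ^ i * (1 - t) powr (-2) * h n) * indicator (J n) t \<le> ennreal ?c * indicator (J n) t"
        proof (cases "t \<in> J n")
          case True
          note J' = J[OF True]
          have "(1 - t) powr (-2) \<le> (1 / (real n + 2)) powr (-2)"
            using J' by (intro powr_mono2') (auto simp: r_def add.commute)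
          also have "\<dots> = (real n + 2)\<^sup>2"
            by (simp add: powr_minus powr_divide)
          finally have "t ^ i * (1 - t) powr (-2) * h n \<le> ?c"
            using J' h(1)[of n] r[of n] by (intro mult_mono power_mono) auto
          then show ?thesis using True by (simp add: ennreal_leI)
        qed simp
      qed
      also have "\<dots> = ennreal (?c * (m n / h n))"
        by (rule const) (use h(1)[of n] r[of n] in auto)
      also have "?c * (m n / h n) = r (Suc n) ^ i * ((real n + 2)\<^sup>2 * m n)"
        using h(1)[of n] by simp
      also have "\<dots> \<le> (k n * \<delta> i) * ((1 / 2) ^ Suc n / k n)"
      proof (rule mult_mono)
        have "m n \<le> (1 / 2) ^ Suc n * (1 / ((real n + 2)\<^sup>2 * k n))"
          unfolding m_def by (intro mult_left_mono) auto
        then have "(real n + 2)\<^sup>2 * m n \<le> (real n + 2)\<^sup>2 * ((1 / 2) ^ Suc n * (1 / ((real n + 2)\<^sup>2 * k n)))"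
          by (intro mult_left_mono) auto
        also have "\<dots> = (1 / 2) ^ Suc n / k n"
          by (simp add: add_nonneg_eq_0_iff)
        finally show "(real n + 2)\<^sup>2 * m n \<le> (1 / 2) ^ Suc n / k n" .
      qed (use k(1)[of n] k(2)[of n i] \<delta>[of i] m[of n] in \<open>auto simp: less_imp_le\<close>)
      also have "\<dots> = (1 / 2) ^ Suc n * \<delta> i" using k(1)[of n] by simp
      finally show "(\<integral>\<^sup>+t. ennreal (t ^ i * (1 - t) powr (-2) * h n) * indicator (J n) t \<partial>lborel) \<le> ennreal ((1 / 2) ^ Suc n * \<delta> i)"
        by (simp add: ennreal_leI)
    qed auto
    also have "\<dots> = ennreal (\<delta> i)" by (rule half) (use \<delta>[of i] in simp)
    finally show "(\<integral>\<^sup>+t\<in>{0..<1}. ennreal (t ^ i * (1 - t) powr (-2) * \<eta> t) \<partial>lborel) \<le> ennreal (\<delta> i)" .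
  next
    fix s :: real assume s: "0 \<le> s" "s < 1"
    have "(\<integral>\<^sup>+t\<in>{s..<1}. ennreal (\<eta> t) \<partial>lborel) = (\<integral>\<^sup>+t. (ennreal (\<eta> t) * indicator {s..<1} t) * indicator {0..<1} t \<partial>lborel)"
      using s by (intro nn_integral_cong) (auto simp: indicator_def)
    also have "\<dots> = (\<Sum>n. \<integral>\<^sup>+t. (ennreal (h n) * indicator {s..<1} t) * indicator (J n) t \<partial>lborel)"
      by (rule split[where \<psi> = "\<lambda>t c. ennreal c * indicator {s..<1} t"]) auto
    also have "\<dots> \<le> (\<Sum>n. ennreal ((1 / 2) ^ Suc n * \<tau> s))"
    proof (rule suminf_le)
      fix n
      show "(\<integral>\<^sup>+t. (ennreal (h n) * indicator {s..<1} t) * indicator (J n) t \<partial>lborel) \<le> ennreal ((1 / 2) ^ Suc n * \<tau> s)"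
      \<comment> \<open>Spikes ending before \<open>s\<close> do not count. For the others the mass
        was compared with the tail at \<open>r (Suc n)\<close>, which is at most the tail at
        \<open>s\<close>.\<close>
      proof (cases "s \<le> r (Suc n)")
        case True
        have "(\<integral>\<^sup>+t. (ennreal (h n) * indicator {s..<1} t) * indicator (J n) t \<partial>lborel) \<le> (\<integral>\<^sup>+t. ennreal (h n) * indicator (J n) t \<partial>lborel)"
          by (intro nn_integral_mono) (auto simp: indicator_def)
        also have "\<dots> = ennreal (m n)" using const[of "h n" n] h(1)[of n] by simp
        also have "m n \<le> (1 / 2) ^ Suc n * \<tau> (r (Suc n))" unfolding m_def by (intro mult_left_mono) auto
        also have "\<dots> \<le> (1 / 2) ^ Suc n * \<tau> s" using True s r[of n] by (intro mult_left_mono \<tau>_anti) auto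
        finally show ?thesis by (simp add: ennreal_leI)
      next
        case False
        have "(ennreal (h n) * indicator {s..<1} t) * indicator (J n) t = 0" for t
          using False J(2)[of t n] by (cases "t \<in> J n") auto
        then show ?thesis by (simp only: nn_integral_const mult_zero_left zero_le)
      qed
    qed auto
    also have "\<dots> = ennreal (\<tau> s)" by (rule half) (use \<tau>[OF s] in simp)
    finally show "(\<integral>\<^sup>+t\<in>{s..<1}. ennreal (\<eta> t) \<partial>lborel) \<le> ennreal (\<tau> s)" .
    show "\<exists>B. \<forall>t\<in>{0..s}. \<eta> t \<le> B"
    proof (intro exI ballI)
      fix t assume t: "t \<in> {0..s}"
      have "1 / (1 - t) \<le> 1 / (1 - s)" using t s by (intro divide_left_mono mult_pos_pos) auto
      then have "N t \<le> N s" unfolding N_def by (intro diff_le_mono nat_mono floor_mono)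
      then have "h (N t) \<le> (\<Sum>n\<le>N s. h n)"
        using h(1) by (intro member_le_sum) (auto intro: less_imp_le)
      moreover have "\<eta> t \<le> h (N t)" using h(1)[of "N t"] by (auto simp: \<eta>_def)
      ultimately show "\<eta> t \<le> (\<Sum>n\<le>N s. h n)" by simp
    qed
  next
    have "(\<integral>\<^sup>+t\<in>{0..<1}. ennreal (\<eta> t powr q) \<partial>lborel) = (\<Sum>n. \<integral>\<^sup>+t. ennreal (h n powr q) * indicator (J n) t \<partial>lborel)"
      by (rule split) (use q in auto)
    also have "\<dots> \<ge> (\<Sum>n::nat. 1)"
    proof (rule suminf_le)
      fix n
      have "h n powr q * (m n / h n) = m n * h n powr (q - 1)"
        using h(1)[of n] by (simp add: powr_diff)
      then show "1 \<le> (\<integral>\<^sup>+t. ennreal (h n powr q) * indicator (J n) t \<partial>lborel)"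
        using h(3)[of n] by (simp add: const)
    qed auto
    \<comment> \<open>Each of the infinitely many spikes contributes at least 1.\<close>
    moreover have "(\<Sum>n::nat. 1 :: ennreal) = top"
      using summable_suminf_not_top[of "\<lambda>n::nat. 1"] by (auto simp: summable_const_iff)
    ultimately show "(\<integral>\<^sup>+t\<in>{0..<1}. ennreal (\<eta> t powr q) \<partial>lborel) = top" by (simp add: top_unique)
  qed (use \<eta>0 in auto)
qed

section \<open>Integrability criteria and linear combinations\<close>

lemma borel_measurable_lebesgueI: "f \<in> borel_measurable borel \<Longrightarrow> f \<in> borel_measurable lebesgue"
  by (rule measurable_completion) simp

text \<open>Young's inequality in place of Hoelder's: a bound in terms of the two integrals is all
  that is asked for, and here it is simply their sum.\<close>

lemma Young_integrable:
  fixes g :: "real \<Rightarrow> complex"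
  assumes p: "p > 1" "q > 1" "1 / p + 1 / q = 1"
    and g: "set_borel_measurable lebesgue S g" and \<nu>: "set_borel_measurable lebesgue S \<nu>"
    and pos: "\<And>t. t \<in> S \<Longrightarrow> \<nu> t \<ge> 0"
    and Ig: "(\<integral>\<^sup>+t\<in>S. ennreal (norm (g t) powr p) \<partial>lebesgue) \<le> ennreal a"
    and I\<nu>: "(\<integral>\<^sup>+t\<in>S. ennreal (\<nu> t powr q) \<partial>lebesgue) \<le> ennreal b" and ab: "a \<ge> 0" "b \<ge> 0"
  shows "set_integrable lebesgue S (\<lambda>t. g t * of_real (\<nu> t))"
    and "(\<integral>\<^sup>+t\<in>S. ennreal (norm (g t * of_real (\<nu> t))) \<partial>lebesgue) \<le> ennreal (a + b)"
proof -
  define G where "G t = indicator S t *\<^sub>R g t" for t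
  define W where "W t = indicator S t *\<^sub>R \<nu> t" for t
  have [measurable]: "G \<in> borel_measurable lebesgue" "W \<in> borel_measurable lebesgue"
    using g \<nu> by (simp_all add: set_borel_measurable_def G_def[abs_def] W_def[abs_def])
  have "(\<integral>\<^sup>+t. ennreal (norm (G t * of_real (W t))) \<partial>lebesgue) \<le> (\<integral>\<^sup>+t. ennreal (norm (G t) powr p) + ennreal (W t powr q) \<partial>lebesgue)"
  proof (rule nn_integral_mono)
    fix t
    have W0: "W t \<ge> 0" using pos by (auto simp: W_def indicator_def)
    have "norm (G t) * W t \<le> norm (G t) powr p / p + W t powr q / q"
      using p W0 by (intro Youngs_inequality) auto
    also have "\<dots> \<le> norm (G t) powr p / 1 + W t powr q / 1"
      using p by (intro add_mono divide_left_mono) auto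
    finally show "ennreal (norm (G t * of_real (W t))) \<le> ennreal (norm (G t) powr p) + ennreal (W t powr q)"
      using W0 by (simp add: norm_mult ennreal_plus[symmetric] ennreal_leI del: ennreal_plus)
  qed
  also have "\<dots> = (\<integral>\<^sup>+t. ennreal (norm (G t) powr p) \<partial>lebesgue) + (\<integral>\<^sup>+t. ennreal (W t powr q) \<partial>lebesgue)"
    by (rule nn_integral_add) measurable
  also have "(\<integral>\<^sup>+t. ennreal (norm (G t) powr p) \<partial>lebesgue) = (\<integral>\<^sup>+t\<in>S. ennreal (norm (g t) powr p) \<partial>lebesgue)"
    using p by (intro nn_integral_cong) (auto simp: G_def indicator_def)
  also have "(\<integral>\<^sup>+t. ennreal (W t powr q) \<partial>lebesgue) = (\<integral>\<^sup>+t\<in>S. ennreal (\<nu> t powr q) \<partial>lebesgue)"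
    using p by (intro nn_integral_cong) (auto simp: W_def indicator_def)
  also have "(\<integral>\<^sup>+t\<in>S. ennreal (norm (g t) powr p) \<partial>lebesgue) + (\<integral>\<^sup>+t\<in>S. ennreal (\<nu> t powr q) \<partial>lebesgue) \<le> ennreal a + ennreal b"
    by (intro add_mono Ig I\<nu>)
  finally have le: "(\<integral>\<^sup>+t. ennreal (norm (G t * of_real (W t))) \<partial>lebesgue) \<le> ennreal (a + b)"
    using ab by simp
  then have "integrable lebesgue (\<lambda>t. G t * of_real (W t))"
    by (intro integrableI_bounded) (auto intro: le_less_trans)
  moreover have eq: "(\<lambda>t. G t * of_real (W t)) = (\<lambda>t. indicator S t *\<^sub>R (g t * of_real (\<nu> t)))"
    by (auto simp: G_def W_def indicator_def)
  ultimately show "set_integrable lebesgue S (\<lambda>t. g t * of_real (\<nu> t))"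
    by (simp add: set_integrable_def)
  have "(\<integral>\<^sup>+t\<in>S. ennreal (norm (g t * of_real (\<nu> t))) \<partial>lebesgue) = (\<integral>\<^sup>+t. ennreal (norm (G t * of_real (W t))) \<partial>lebesgue)"
    by (intro nn_integral_cong) (auto simp: G_def W_def indicator_def)
  then show "(\<integral>\<^sup>+t\<in>S. ennreal (norm (g t * of_real (\<nu> t))) \<partial>lebesgue) \<le> ennreal (a + b)"
    using le by simp
qed

lemma set_integrable_norm_integral_le:
  fixes f :: "real \<Rightarrow> 'a :: {banach, second_countable_topology}"
  assumes f: "set_borel_measurable lebesgue S f"
    and le: "(\<integral>\<^sup>+t\<in>S. ennreal (norm (f t)) \<partial>lebesgue) \<le> ennreal a" and a: "a \<ge> 0"
  shows "set_integrable lebesgue S f" and "norm (LINT t:S|lebesgue. f t) \<le> a"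
proof -
  have eq: "(\<integral>\<^sup>+t\<in>S. ennreal (norm (f t)) \<partial>lebesgue) = (\<integral>\<^sup>+t. ennreal (norm (indicator S t *\<^sub>R f t)) \<partial>lebesgue)"
    by (intro nn_integral_cong) (auto simp: indicator_def)
  show 1: "set_integrable lebesgue S f"
    unfolding set_integrable_def using f le unfolding eq
    by (intro integrableI_bounded) (auto simp: set_borel_measurable_def intro: le_less_trans)
  have "ennreal (norm (LINT t:S|lebesgue. f t)) \<le> ennreal a"
    using integral_norm_bound_ennreal[OF 1[unfolded set_integrable_def]] le unfolding eq
    by (auto simp: set_lebesgue_integral_def)
  then show "norm (LINT t:S|lebesgue. f t) \<le> a" using a by (simp add: ennreal_le_iff)
qed

lemma H_fun_linear:
  assumes \<omega>: "radial_weight \<omega>" and z: "norm z < 1"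
    and g1: "set_integrable lebesgue {0..<1} (\<lambda>t. g1 t * of_real (\<omega> t))"
    and g2: "set_integrable lebesgue {0..<1} (\<lambda>t. g2 t * of_real (\<omega> t))"
  shows "H_fun \<omega> (\<lambda>t. x * g1 t + y * g2 t) z = x * H_fun \<omega> g1 z + y * H_fun \<omega> g2 z"
proof -
  note i = set_integrable_mult_right[of x, OF H_op_series(1)[OF \<omega> g1 z]] set_integrable_mult_right[of y, OF H_op_series(1)[OF \<omega> g2 z]]
  have "H_fun \<omega> (\<lambda>t. x * g1 t + y * g2 t) z
     = (LINT t:{0..<1}|lebesgue. x * (g1 t * hilbert_kernel \<omega> t z * of_real (\<omega> t)) + y * (g2 t * hilbert_kernel \<omega> t z * of_real (\<omega> t)))"
    unfolding H_fun_def by (simp add: algebra_simps)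
  also have "\<dots> = x * H_fun \<omega> g1 z + y * H_fun \<omega> g2 z"
    using i by (simp add: set_integral_add H_fun_def)
  finally show ?thesis .
qed

lemma quasilinear_lincomb:
  assumes V: "quasilinear_power p V"
    and hol: "f holomorphic_on ball 0 1" "g holomorphic_on ball 0 1" "h holomorphic_on ball 0 1"
    and eq: "\<And>z. z \<in> ball 0 1 \<Longrightarrow> h z = x * f z + y * g z"
    and le: "V f \<le> ennreal a" "V g \<le> ennreal b" and ab: "a \<ge> 0" "b \<ge> 0"
  shows "V h \<le> ennreal (2 powr p * (norm x powr p * a + norm y powr p * b))"
proof -
  have add: "\<And>f g h. f holomorphic_on ball 0 1 \<Longrightarrow> g holomorphic_on ball 0 1 \<Longrightarrow> h holomorphic_on ball 0 1 \<Longrightarrow>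
      (\<And>z. z \<in> ball 0 1 \<Longrightarrow> h z = f z + g z) \<Longrightarrow> V h \<le> ennreal (2 powr p) * (V f + V g)"
    and scale: "\<And>f h c. f holomorphic_on ball 0 1 \<Longrightarrow> h holomorphic_on ball 0 1 \<Longrightarrow>
      (\<And>z. z \<in> ball 0 1 \<Longrightarrow> h z = c * f z) \<Longrightarrow> V h \<le> ennreal (norm c powr p) * V f"
    using V by (auto simp: quasilinear_power_def)
  have hol': "(\<lambda>z. x * f z) holomorphic_on ball 0 1" "(\<lambda>z. y * g z) holomorphic_on ball 0 1"
    using hol by (auto intro: holomorphic_intros)
  have "V (\<lambda>z. x * f z) \<le> ennreal (norm x powr p) * V f" by (rule scale[OF hol(1) hol'(1)]) simp
  also have "\<dots> \<le> ennreal (norm x powr p) * ennreal a" by (intro mult_left_mono le) simp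
  finally have 1: "V (\<lambda>z. x * f z) \<le> ennreal (norm x powr p * a)" using ab by (simp add: ennreal_mult)
  have "V (\<lambda>z. y * g z) \<le> ennreal (norm y powr p) * V g" by (rule scale[OF hol(2) hol'(2)]) simp
  also have "\<dots> \<le> ennreal (norm y powr p) * ennreal b" by (intro mult_left_mono le) simp
  finally have 2: "V (\<lambda>z. y * g z) \<le> ennreal (norm y powr p * b)" using ab by (simp add: ennreal_mult)
  have "V h \<le> ennreal (2 powr p) * (V (\<lambda>z. x * f z) + V (\<lambda>z. y * g z))"
    by (rule add[OF hol' hol(3)]) (use eq in simp)
  also have "\<dots> \<le> ennreal (2 powr p) * (ennreal (norm x powr p * a) + ennreal (norm y powr p * b))"
    by (intro mult_left_mono add_mono 1 2) simp
  also have "\<dots> = ennreal (2 powr p * (norm x powr p * a + norm y powr p * b))"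
    using ab by (simp add: ennreal_mult)
  finally show ?thesis .
qed

subsection \<open>Perturbing the weight\<close>

text \<open>A coefficient of the difference of the operators: \<open>\<mu>\<close> and
  \<open>\<epsilon>\<close> are moments of \<open>\<nu>\<close> and \<open>\<eta>\<close>, while
  \<open>P\<close> and \<open>E\<close> are those of \<open>g \<nu>\<close> and
  \<open>g \<eta>\<close>. The part with \<open>E\<close> has one moment in the denominator and uses
  \<open>\<delta> \<le> \<mu> * c\<close>. The part with \<open>P\<close> comes from the difference
  of the reciprocals, has two, and \<open>P\<close> is only bounded; it uses
  \<open>\<delta> \<le> \<mu>\<^sup>2 * c\<close>.\<close>

lemma perturbed_coeff_bound:
  fixes P E :: complex and n :: nat
  assumes \<mu>: "\<mu> > 0" and \<epsilon>: "0 \<le> \<epsilon>" "\<epsilon> \<le> \<delta>" and E: "norm E \<le> A * \<delta>" and P: "norm P \<le> L"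
    and A: "A \<ge> 0" and \<delta>: "\<delta> \<le> \<mu> * c" "\<delta> \<le> \<mu>\<^sup>2 * c"
  shows "norm (of_real (1 / (2 * (real n + 1) * (\<mu> + \<epsilon>))) * (P + E) - of_real (1 / (2 * (real n + 1) * \<mu>)) * P) \<le> (A + L) * c"
proof -
  have L: "L \<ge> 0" using P norm_ge_zero[of P] by linarith
  have \<delta>0: "\<delta> \<ge> 0" using \<epsilon> by simp
  then have "0 \<le> \<mu> * c" using \<delta>(1) by linarith
  then have c: "0 \<le> c" using \<mu> by (simp add: zero_le_mult_iff)
  define s where "s = 1 / (2 * (real n + 1))"
  have s: "0 \<le> s" "s \<le> 1" by (auto simp: s_def)
  have "of_real (1 / (2 * (real n + 1) * (\<mu> + \<epsilon>))) * (P + E) - of_real (1 / (2 * (real n + 1) * \<mu>)) * P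
     = of_real s * (of_real (1 / (\<mu> + \<epsilon>)) * E - of_real (\<epsilon> / (\<mu> * (\<mu> + \<epsilon>))) * P)"
  proof -
    have "1 / (\<mu> + \<epsilon>) - 1 / \<mu> = - (\<epsilon> / (\<mu> * (\<mu> + \<epsilon>)))" using \<mu> \<epsilon> by (simp add: field_simps)
    then have "of_real (1 / (\<mu> + \<epsilon>)) - of_real (1 / \<mu>) = - (of_real (\<epsilon> / (\<mu> * (\<mu> + \<epsilon>))) :: complex)"
      by (metis of_real_diff of_real_minus)
    then have e: "of_real (1 / \<mu>) = (of_real (1 / (\<mu> + \<epsilon>)) + of_real (\<epsilon> / (\<mu> * (\<mu> + \<epsilon>))) :: complex)"
      by (simp only: diff_eq_eq minus_add_distrib) (simp add: algebra_simps)
    have "of_real (1 / (2 * (real n + 1) * (\<mu> + \<epsilon>))) = (of_real s * of_real (1 / (\<mu> + \<epsilon>)) :: complex)"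
      "of_real (1 / (2 * (real n + 1) * \<mu>)) = (of_real s * of_real (1 / \<mu>) :: complex)"
      by (simp_all add: s_def)
    then show ?thesis unfolding e by (simp only:) (simp only: algebra_simps)
  qed
  also have "norm \<dots> \<le> 1 * (norm (of_real (1 / (\<mu> + \<epsilon>)) * E) + norm (of_real (\<epsilon> / (\<mu> * (\<mu> + \<epsilon>))) * P))"
    unfolding norm_mult[of "of_real s"] using s by (intro mult_mono norm_triangle_ineq4) auto
  also have "norm (of_real (1 / (\<mu> + \<epsilon>)) * E) = 1 / (\<mu> + \<epsilon>) * norm E"
    unfolding norm_mult norm_of_real using \<mu> \<epsilon> by simp
  also have "1 / (\<mu> + \<epsilon>) * norm E \<le> 1 / \<mu> * (A * (\<mu> * c))"
    using \<mu> \<epsilon> A E \<delta> by (intro mult_mono divide_left_mono order_trans[OF E] mult_left_mono) auto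
  also have "\<dots> = A * c" using \<mu> by simp
  also have "norm (of_real (\<epsilon> / (\<mu> * (\<mu> + \<epsilon>))) * P) = \<epsilon> / (\<mu> * (\<mu> + \<epsilon>)) * norm P"
    unfolding norm_mult norm_of_real using \<mu> \<epsilon> by simp
  also have "\<dots> \<le> (\<mu>\<^sup>2 * c) / \<mu>\<^sup>2 * L"
  proof (intro mult_mono P frac_le)
    show "\<mu>\<^sup>2 \<le> \<mu> * (\<mu> + \<epsilon>)" using \<mu> \<epsilon> by (simp add: power2_eq_square)
  qed (use \<mu> \<epsilon> \<delta> \<delta>0 c in auto)
  also have "\<dots> = L * c" using \<mu> by simp
  finally show ?thesis by (simp add: distrib_right)
qed

text \<open>\<open>H_fun\<close> of the new weight is that of \<open>\<nu>\<close>, bounded by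
  hypothesis, plus a series with cubically decaying coefficients. The growth condition on
  \<open>g\<close> enters only in the integrals against \<open>\<eta>\<close>, whose spikes were
  measured with the weight \<open>(1 - t)^(-2)\<close>. No analyticity of \<open>g\<close> is
  assumed, so that absolute values of analytic functions are covered.\<close>

lemma perturbed_operator_bounded:
  fixes \<nu> \<eta> :: "real \<Rightarrow> real"
  assumes p: "p > 1" "q > 1" "1 / p + 1 / q = 1"
    and V: "quasilinear_power p V" "bounded_on_small_series V"
    and \<nu>: "radial_weight \<nu>" and \<omega>: "radial_weight (\<lambda>t. \<nu> t + \<eta> t)"
    and \<nu>q: "(\<integral>\<^sup>+t\<in>{0..<1}. ennreal (\<nu> t powr q) \<partial>lebesgue) < top"
    and bdd: "\<And>g. set_borel_measurable lebesgue {0..<1} g \<Longrightarrow> (\<integral>\<^sup>+t\<in>{0..<1}. ennreal (norm (g t) powr p) \<partial>lebesgue) \<le> 1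
        \<Longrightarrow> V (H_fun \<nu> g) \<le> ennreal B0"
    and \<eta>: "\<eta> \<in> borel_measurable borel" "\<And>t. \<eta> t \<ge> 0"
    and \<eta>\<delta>: "\<And>n. (\<integral>\<^sup>+t\<in>{0..<1}. ennreal (t ^ n * (1 - t) powr (-2) * \<eta> t) \<partial>lborel) \<le> ennreal (\<delta> n)"
    and \<delta>: "\<And>n. 0 < \<delta> n" "\<And>n. \<delta> n \<le> odd_moment \<nu> n * (1 / (real n + 1) ^ 3)" "\<And>n. \<delta> n \<le> (odd_moment \<nu> n)\<^sup>2 * (1 / (real n + 1) ^ 3)"
    and A: "A > 0"
  shows "\<exists>B. \<forall>g. set_borel_measurable lebesgue {0..<1} g \<longrightarrow> (\<forall>t\<in>{0..<1}. norm (g t) \<le> A * (1 - t) powr (-2)) \<longrightarrow>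
     (\<integral>\<^sup>+t\<in>{0..<1}. ennreal (norm (g t) powr p) \<partial>lebesgue) \<le> ennreal (A powr p) \<longrightarrow>
     set_integrable lebesgue {0..<1} (\<lambda>t. g t * of_real (\<nu> t + \<eta> t)) \<and> V (H_fun (\<lambda>t. \<nu> t + \<eta> t) g) \<le> ennreal B"
proof -
  let ?\<omega> = "\<lambda>t. \<nu> t + \<eta> t"
  note [measurable] = \<eta>(1)
  define b where "b = enn2real (\<integral>\<^sup>+t\<in>{0..<1}. ennreal (\<nu> t powr q) \<partial>lebesgue)"
  have b: "b \<ge> 0" "(\<integral>\<^sup>+t\<in>{0..<1}. ennreal (\<nu> t powr q) \<partial>lebesgue) = ennreal b"
    using \<nu>q by (simp_all add: b_def)
  define L where "L = A powr p + b"
  have L: "L \<ge> 0" using b by (simp add: L_def)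
  obtain Bs where Bs: "\<And>f e. f holomorphic_on ball 0 1 \<Longrightarrow> (\<And>z. z \<in> ball 0 1 \<Longrightarrow> (\<lambda>n. e n * z ^ n) sums f z) \<Longrightarrow>
      (\<And>n. norm (e n) \<le> 1 / (real n + 1) ^ 3) \<Longrightarrow> V f \<le> ennreal Bs"
    using V(2) unfolding bounded_on_small_series_def by metis
  have \<eta>_leb: "\<eta> \<in> borel_measurable lebesgue" by (rule borel_measurable_lebesgueI[OF \<eta>(1)])
  have \<nu>_meas: "set_borel_measurable lebesgue {0..<1} \<nu>"
    using measurable_weight_on_unit[OF \<nu>] by (simp add: set_borel_measurable_def)
  show ?thesis
  proof (intro exI allI impI conjI)
    fix g :: "real \<Rightarrow> complex"
    assume g: "set_borel_measurable lebesgue {0..<1} g" and gle: "\<forall>t\<in>{0..<1}. norm (g t) \<le> A * (1 - t) powr (-2)"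
      and gp: "(\<integral>\<^sup>+t\<in>{0..<1}. ennreal (norm (g t) powr p) \<partial>lebesgue) \<le> ennreal (A powr p)"
    define G where "G t = indicator {0..<1} t *\<^sub>R g t" for t
    have [measurable]: "G \<in> borel_measurable lebesgue" using g by (simp add: set_borel_measurable_def G_def[abs_def])
    have pow_meas: "(\<lambda>t::real. t ^ n) \<in> borel_measurable lebesgue" for n
      by (rule borel_measurable_lebesgueI) simp
    have Young: "set_integrable lebesgue {0..<1} (\<lambda>t. g t * of_real (\<nu> t))"
      "(\<integral>\<^sup>+t\<in>{0..<1}. ennreal (norm (g t * of_real (\<nu> t))) \<partial>lebesgue) \<le> ennreal L"
      unfolding L_def using \<nu> b by (intro Young_integrable[OF p g \<nu>_meas _ gp]; simp add: radial_weight_def)+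
    define P where "P n = (LINT t:{0..<1}|lebesgue. of_real (t ^ n) * (g t * of_real (\<nu> t)))" for n
    define E where "E n = (LINT t:{0..<1}|lebesgue. of_real (t ^ n) * (g t * of_real (\<eta> t)))" for n
    have Pint: "set_integrable lebesgue {0..<1} (\<lambda>t. of_real (t ^ n) * (g t * of_real (\<nu> t)))" for n
      by (rule set_integrable_bounded_factor[OF Young(1)]) (auto simp: norm_power intro!: power_le_one)
    have Pn: "norm (P n) \<le> L" for n
      unfolding P_def
    proof (rule set_integrable_norm_integral_le(2)[OF _ _ L])
      show "set_borel_measurable lebesgue {0..<1} (\<lambda>t. of_real (t ^ n) * (g t * of_real (\<nu> t)))"
        using Pint[of n] by (simp add: set_integrable_def set_borel_measurable_def)
      have "(\<integral>\<^sup>+t\<in>{0..<1}. ennreal (norm (of_real (t ^ n) * (g t * of_real (\<nu> t)))) \<partial>lebesgue)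
         \<le> (\<integral>\<^sup>+t\<in>{0..<1}. ennreal (norm (g t * of_real (\<nu> t))) \<partial>lebesgue)"
        by (intro nn_integral_mono)
           (auto simp: indicator_def norm_mult norm_power intro!: ennreal_leI mult_left_le_one_le power_le_one)
      then show "(\<integral>\<^sup>+t\<in>{0..<1}. ennreal (norm (of_real (t ^ n) * (g t * of_real (\<nu> t)))) \<partial>lebesgue) \<le> ennreal L"
        using Young(2) by (rule order_trans)
    qed
    have E_meas: "set_borel_measurable lebesgue {0..<1} (\<lambda>t. of_real (t ^ n) * (g t * of_real (\<eta> t)))" for n
    proof -
      have "(\<lambda>t. of_real (t ^ n) * (G t * of_real (\<eta> t))) \<in> borel_measurable lebesgue"
        using \<eta>_leb pow_meas[of n] by measurable
      also have "(\<lambda>t. of_real (t ^ n) * (G t * of_real (\<eta> t))) = (\<lambda>t. indicator {0..<1} t *\<^sub>R (of_real (t ^ n) * (g t * of_real (\<eta> t))))"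
        by (auto simp: G_def indicator_def)
      finally show ?thesis by (simp add: set_borel_measurable_def)
    qed
    have E_le: "(\<integral>\<^sup>+t\<in>{0..<1}. ennreal (norm (of_real (t ^ n) * (g t * of_real (\<eta> t)))) \<partial>lebesgue) \<le> ennreal (A * \<delta> n)" for n
    proof -
      have "(\<integral>\<^sup>+t\<in>{0..<1}. ennreal (norm (of_real (t ^ n) * (g t * of_real (\<eta> t)))) \<partial>lebesgue)
         \<le> (\<integral>\<^sup>+t. ennreal A * (ennreal (t ^ n * (1 - t) powr (-2) * \<eta> t) * indicator {0..<1} t) \<partial>lebesgue)"
      proof (rule nn_integral_mono)
        fix t :: real
        show "ennreal (norm (of_real (t ^ n) * (g t * of_real (\<eta> t)))) * indicator {0..<1} t
          \<le> ennreal A * (ennreal (t ^ n * (1 - t) powr (-2) * \<eta> t) * indicator {0..<1} t)"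
        proof (cases "t \<in> {0..<1}")
          case True
          have "t ^ n * (norm (g t) * \<eta> t) \<le> t ^ n * ((A * (1 - t) powr (-2)) * \<eta> t)"
            using True gle \<eta>(2)[of t] by (intro mult_left_mono mult_right_mono) auto
          then have "norm (of_real (t ^ n) * (g t * of_real (\<eta> t))) \<le> A * (t ^ n * (1 - t) powr (-2) * \<eta> t)"
            using True \<eta>(2)[of t] by (simp add: norm_mult norm_power mult_ac)
          then show ?thesis using True A \<eta>(2)[of t] by (simp add: ennreal_mult[symmetric] ennreal_leI)
        qed simp
      qed
      also have "\<dots> = (\<integral>\<^sup>+t. ennreal A * (ennreal (t ^ n * (1 - t) powr (-2) * \<eta> t) * indicator {0..<1} t) \<partial>lborel)"
        by (rule nn_integral_completion)
      also have "\<dots> = ennreal A * (\<integral>\<^sup>+t\<in>{0..<1}. ennreal (t ^ n * (1 - t) powr (-2) * \<eta> t) \<partial>lborel)"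
        by (rule nn_integral_cmult) measurable
      also have "\<dots> \<le> ennreal A * ennreal (\<delta> n)" by (intro mult_left_mono \<eta>\<delta>) simp
      finally show ?thesis using A \<delta>(1)[of n] by (simp add: ennreal_mult)
    qed
    have Eint: "set_integrable lebesgue {0..<1} (\<lambda>t. of_real (t ^ n) * (g t * of_real (\<eta> t)))" for n
      by (rule set_integrable_norm_integral_le(1)[OF E_meas E_le]) (use A \<delta>(1)[of n] in simp)
    have En: "norm (E n) \<le> A * \<delta> n" for n
      unfolding E_def by (rule set_integrable_norm_integral_le(2)[OF E_meas E_le]) (use A \<delta>(1)[of n] in simp)
    show int: "set_integrable lebesgue {0..<1} (\<lambda>t. g t * of_real (\<nu> t + \<eta> t))"
      using set_integral_add(1)[OF Young(1) Eint[of 0, simplified]] by (simp add: distrib_left)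
    have PE: "(LINT t:{0..<1}|lebesgue. of_real (t ^ n) * (g t * of_real (\<nu> t + \<eta> t))) = P n + E n" for n
      unfolding P_def E_def using set_integral_add(2)[OF Pint[of n] Eint[of n]] by (simp add: distrib_left)
    define \<epsilon> where "\<epsilon> n = (LINT t:{0..<1}|lebesgue. t powr real (2 * n + 1) * \<eta> t)" for n
    \<comment> \<open>The weighted bound on \<open>\<eta>\<close> with \<open>t^n\<close> also
      controls its moment of index \<open>2 * n + 1\<close>, because \<open>t^(n + 1)\<close> is at
      most 1 and \<open>(1 - t)^(-2)\<close> at least 1.\<close>
    have \<epsilon>_pt: "t powr real (2 * n + 1) \<le> t ^ n * (1 - t) powr (-2)" if "t \<in> {0..<1}" for t n
    proof (cases "t = 0")
      case False
      then have "t powr real (2 * n + 1) = t ^ (2 * n + 1)" using that by (intro powr_realpow) auto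
      also have "\<dots> = t ^ n * t ^ (n + 1)" by (simp add: power_add[symmetric] mult_2)
      also have "\<dots> \<le> t ^ n * 1" using that by (intro mult_left_mono power_le_one) auto
      also have "\<dots> \<le> t ^ n * (1 - t) powr (-2)"
        using that powr_growth_mono[of t 0 2] by (intro mult_left_mono) auto
      finally show ?thesis .
    qed simp
    have \<epsilon>_meas: "set_borel_measurable lebesgue {0..<1} (\<lambda>t. t powr real (2 * n + 1) * \<eta> t)" for n
      unfolding set_borel_measurable_def using \<eta>(1) by (intro borel_measurable_lebesgueI) measurable
    have \<epsilon>_le: "(\<integral>\<^sup>+t\<in>{0..<1}. ennreal (norm (t powr real (2 * n + 1) * \<eta> t)) \<partial>lebesgue) \<le> ennreal (\<delta> n)" for n
    proof -
      have "(\<integral>\<^sup>+t\<in>{0..<1}. ennreal (norm (t powr real (2 * n + 1) * \<eta> t)) \<partial>lebesgue)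
         \<le> (\<integral>\<^sup>+t\<in>{0..<1}. ennreal (t ^ n * (1 - t) powr (-2) * \<eta> t) \<partial>lborel)"
        unfolding nn_integral_completion
      proof (rule nn_integral_mono)
        fix t :: real
        show "ennreal (norm (t powr real (2 * n + 1) * \<eta> t)) * indicator {0..<1} t \<le> ennreal (t ^ n * (1 - t) powr (-2) * \<eta> t) * indicator {0..<1} t"
          using \<epsilon>_pt[of t n] \<eta>(2)[of t] by (cases "t \<in> {0..<1}") (auto simp: abs_mult intro!: ennreal_leI mult_right_mono)
      qed
      then show ?thesis using \<eta>\<delta>[of n] by (rule order_trans)
    qed
    have \<epsilon>: "0 \<le> \<epsilon> n" "\<epsilon> n \<le> \<delta> n" for n
    proof -
      show "0 \<le> \<epsilon> n" unfolding \<epsilon>_def set_lebesgue_integral_def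
        using \<eta>(2) by (intro integral_nonneg_AE) (auto simp: indicator_def)
      have "norm (\<epsilon> n) \<le> \<delta> n" unfolding \<epsilon>_def
        by (rule set_integrable_norm_integral_le(2)[OF \<epsilon>_meas \<epsilon>_le]) (use \<delta>(1)[of n] in simp)
      then show "\<epsilon> n \<le> \<delta> n" by simp
    qed
    have mom: "odd_moment ?\<omega> n = odd_moment \<nu> n + \<epsilon> n" for n
    proof -
      have "set_integrable lebesgue {0..<1} (\<lambda>t. t powr real (2 * n + 1) * \<eta> t)"
        by (rule set_integrable_norm_integral_le(1)[OF \<epsilon>_meas \<epsilon>_le]) (use \<delta>(1)[of n] in simp)
      then show ?thesis
        using set_integral_add(2)[OF moment_integrable[OF \<nu>, of "real (2 * n + 1)"]]
        by (simp add: moment_def \<epsilon>_def distrib_left del: of_nat_add of_nat_mult of_nat_Suc)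
    qed
    define e where "e n = of_real (kernel_coeff ?\<omega> n) * (P n + E n) - of_real (kernel_coeff \<nu> n) * P n" for n
    have e: "norm (e n) \<le> (A + L) * (1 / (real n + 1) ^ 3)" for n
      unfolding e_def kernel_coeff_def mom
      by (rule perturbed_coeff_bound[OF odd_moment_pos[OF \<nu>] \<epsilon> En Pn _ \<delta>(2,3)]) (use A in simp)
    have AL: "A + L > 0" using A L by simp
    \<comment> \<open>Dividing by \<open>A + L\<close> brings the coefficients below
      \<open>1 / (n + 1)^3\<close>, the normalisation in
      \<open>bounded_on_small_series\<close>.\<close>
    define D where "D z = (H_fun ?\<omega> g z - H_fun \<nu> g z) / of_real (A + L)" for z
    have hol\<omega>: "H_fun ?\<omega> g holomorphic_on ball 0 1" by (rule H_fun_holomorphic[OF \<omega>]) (use int in simp)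
    have hol\<nu>: "H_fun \<nu> g holomorphic_on ball 0 1" by (rule H_fun_holomorphic[OF \<nu> Young(1)])
    have holD: "D holomorphic_on ball 0 1"
      unfolding D_def[abs_def] using AL by (intro holomorphic_intros hol\<omega> hol\<nu>) (auto simp del: of_real_add)
    have VD: "V D \<le> ennreal Bs"
    proof (rule Bs[OF holD, of "\<lambda>n. e n / of_real (A + L)"])
      fix z :: complex assume "z \<in> ball 0 1"
      then have z: "norm z < 1" by simp
      have "(\<lambda>n. (of_real (kernel_coeff ?\<omega> n) * (P n + E n)) * z ^ n - (of_real (kernel_coeff \<nu> n) * P n) * z ^ n) sums (H_fun ?\<omega> g z - H_fun \<nu> g z)"
        using H_op_series(2)[OF \<omega> int z] H_op_series(2)[OF \<nu> Young(1) z]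
        unfolding PE P_def[symmetric] H_fun_def[symmetric] by (rule sums_diff)
      then have "(\<lambda>n. ((of_real (kernel_coeff ?\<omega> n) * (P n + E n)) * z ^ n - (of_real (kernel_coeff \<nu> n) * P n) * z ^ n) / of_real (A + L)) sums D z"
        unfolding D_def by (rule sums_divide)
      then show "(\<lambda>n. e n / of_real (A + L) * z ^ n) sums D z"
        by (simp add: e_def left_diff_distrib)
    next
      fix n
      show "norm (e n / of_real (A + L)) \<le> 1 / (real n + 1) ^ 3"
        using e[of n] AL by (simp add: norm_divide pos_divide_le_eq mult.commute del: of_real_add)
    qed
    \<comment> \<open>Normalised to the unit ball of \<open>L^p\<close>, where the hypothesis on
      \<open>\<nu>\<close> applies.\<close>
    define u where "u t = g t / of_real A" for t
    have u_meas: "set_borel_measurable lebesgue {0..<1} u"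
    proof -
      have "(\<lambda>t. G t / of_real A) \<in> borel_measurable lebesgue" by measurable
      also have "(\<lambda>t. G t / of_real A) = (\<lambda>t. indicator {0..<1} t *\<^sub>R u t)" by (auto simp: G_def u_def indicator_def)
      finally show ?thesis by (simp add: set_borel_measurable_def)
    qed
    have u_int: "set_integrable lebesgue {0..<1} (\<lambda>t. u t * of_real (\<nu> t))"
      using set_integrable_mult_right[of "1 / of_real A", OF Young(1)] by (simp add: u_def)
    have "(\<integral>\<^sup>+t\<in>{0..<1}. ennreal (norm (u t) powr p) \<partial>lebesgue) \<le> 1"
    proof -
      have "(\<integral>\<^sup>+t\<in>{0..<1}. ennreal (norm (u t) powr p) \<partial>lebesgue) = (\<integral>\<^sup>+t. ennreal (1 / A powr p) * ennreal (norm (G t) powr p) \<partial>lebesgue)"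
        using A p by (intro nn_integral_cong) (auto simp: G_def u_def indicator_def norm_divide powr_divide ennreal_mult[symmetric])
      also have "\<dots> = ennreal (1 / A powr p) * (\<integral>\<^sup>+t. ennreal (norm (G t) powr p) \<partial>lebesgue)"
        by (rule nn_integral_cmult) measurable
      also have "(\<integral>\<^sup>+t. ennreal (norm (G t) powr p) \<partial>lebesgue) = (\<integral>\<^sup>+t\<in>{0..<1}. ennreal (norm (g t) powr p) \<partial>lebesgue)"
        using p by (intro nn_integral_cong) (auto simp: G_def indicator_def)
      also have "ennreal (1 / A powr p) * \<dots> \<le> ennreal (1 / A powr p) * ennreal (A powr p)"
        by (intro mult_left_mono gp) simp
      also have "\<dots> = 1" using A by (simp add: ennreal_mult[symmetric])
      finally show ?thesis .
    qed
    then have "V (H_fun \<nu> u) \<le> ennreal B0" by (rule bdd[OF u_meas])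
    \<comment> \<open>\<open>B0\<close> and \<open>Bs\<close> are arbitrary reals and
      \<open>ennreal\<close> sends negative ones to 0; the estimate for linear combinations asks for
      nonnegative bounds.\<close>
    then have Vu: "V (H_fun \<nu> u) \<le> ennreal (max 0 B0)" by (auto intro: order_trans ennreal_leI)
    have VD': "V D \<le> ennreal (max 0 Bs)" using VD by (auto intro: order_trans ennreal_leI)
    have "g = (\<lambda>t. of_real A * u t + 0 * u t)" using A by (auto simp: u_def)
    then have Hg: "H_fun \<nu> g z = of_real A * H_fun \<nu> u z" if "z \<in> ball 0 1" for z
      using H_fun_linear[OF \<nu> _ u_int u_int, of z "of_real A" 0] that by simp
    have "H_fun ?\<omega> g z = of_real A * H_fun \<nu> u z + of_real (A + L) * D z" if "z \<in> ball 0 1" for z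
      using AL Hg[OF that] by (simp add: D_def del: of_real_add)
    then show "V (H_fun ?\<omega> g) \<le> ennreal (2 powr p * (norm (of_real A :: complex) powr p * max 0 B0 + norm (of_real (A + L) :: complex) powr p * max 0 Bs))"
      by (intro quasilinear_lincomb[OF V(1) H_fun_holomorphic[OF \<nu> u_int] holD hol\<omega> _ Vu VD']) auto
  qed
qed

subsection \<open>Boundedness of the operators\<close>

lemma space_properties:
  assumes p: "p > 1" and N: "N \<in> {H_inf_norm p, Hardy_norm p, Dirichlet_norm p, HL_norm p}"
  obtains V where "norm_power p N V" "quasilinear_power p V" "bounded_on_small_series V"
    "radial_embedding p V" "radial_growth p V"
proof -
  have p0: "p > 0" using p by simp
  consider "N = H_inf_norm p" | "N = Hardy_norm p" | "N = Dirichlet_norm p" | "N = HL_norm p" using N by auto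
  then show thesis
  proof cases
    case 1 then show ?thesis
      using that[OF _ quasilinear_H_inf[OF p] bounded_on_small_series_H_inf[OF p] radial_embedding_H_inf[OF p0] radial_growth_H_inf[OF p]]
        norm_power_H_inf[OF p0] by simp
  next
    case 2 then show ?thesis
      using that[OF _ quasilinear_Hardy[OF p] bounded_on_small_series_Hardy[OF p] radial_embedding_Hardy[OF p] radial_growth_Hardy[OF p]]
        norm_power_Hardy[OF p0] by simp
  next
    case 3 then show ?thesis
      using that[OF _ quasilinear_Dirichlet[OF p] bounded_on_small_series_Dirichlet[OF p] radial_embedding_Dirichlet[OF p] radial_growth_Dirichlet[OF p]]
        norm_power_Dirichlet[OF p0] by simp
  next
    case 4 then show ?thesis
      using that[OF _ quasilinear_HL[OF p] bounded_on_small_series_HL[OF p] radial_embedding_HL[OF p] radial_growth_HL[OF p]]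
        norm_power_HL[OF p0] by simp
  qed
qed

lemma Lp_space_iff:
  "g \<in> Lp_space p S \<longleftrightarrow> set_borel_measurable lebesgue S g \<and> (\<integral>\<^sup>+t\<in>S. ennreal (norm (g t) powr p) \<partial>lebesgue) < top"
  by (auto simp: Lp_space_def Lp_norm_def enn_powr_def less_top)

lemma Lp_norm_le_1_iff:
  "p > 0 \<Longrightarrow> Lp_norm p S g \<le> 1 \<longleftrightarrow> (\<integral>\<^sup>+t\<in>S. ennreal (norm (g t) powr p) \<partial>lebesgue) \<le> 1"
  using enn_powr_le_iff[of p 1] by (simp add: Lp_norm_def)

lemma H_op_or_H_tilde_op:
  assumes "Q \<in> {H_op, H_tilde_op}"
  shows "Q \<omega> g = H_op \<omega> (if Q = H_op then g else (\<lambda>t. of_real (norm (g t))))"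
  using assms by (auto simp: H_tilde_op_eq_H_op)

text \<open>Boundedness fails already because the operator is undefined at some function. The
  contrapositive is what later puts \<open>\<nu>\<close> into \<open>L^q\<close>.\<close>

lemma not_bounded_from_Lp:
  assumes p: "p > 1" "1 / p + 1 / q = 1" and \<omega>: "radial_weight \<omega>" and Q: "Q \<in> {H_op, H_tilde_op}"
    and inf: "(\<integral>\<^sup>+t\<in>{0..<1}. ennreal (\<omega> t powr q) \<partial>lebesgue) = top"
  shows "\<not> bounded_from_Lp p (Q \<omega>) N"
proof
  assume bdd: "bounded_from_Lp p (Q \<omega>) N"
  let ?M = "lebesgue_on {0..<1::real}"
  have \<omega>_meas: "\<omega> \<in> borel_measurable ?M"
    using measurable_weight_on_unit[OF \<omega>] by (subst borel_measurable_restrict_space_iff) auto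
  obtain f where f: "f \<in> borel_measurable ?M" "\<And>t. f t \<ge> 0" "(\<integral>\<^sup>+t. ennreal (f t powr p) \<partial>?M) \<le> 1"
    "(\<integral>\<^sup>+t. ennreal (f t * \<omega> t) \<partial>?M) = top"
  proof (rule Landau_duality[OF p _ \<omega>_meas])
    show "emeasure ?M (space ?M) < top" by (simp add: emeasure_restrict_space)
    show "\<And>t. t \<in> space ?M \<Longrightarrow> \<omega> t \<ge> 0" using \<omega> by (auto simp: radial_weight_def)
    show "(\<integral>\<^sup>+t. ennreal (\<omega> t powr q) \<partial>?M) = top"
      using inf by (simp add: nn_integral_restrict_space)
  qed (rule that)
  define g where "g t = complex_of_real (f t)" for t
  have "(\<lambda>t. indicator {0..<1} t *\<^sub>R f t) \<in> borel_measurable lebesgue"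
    using f(1) by (subst (asm) borel_measurable_restrict_space_iff) auto
  then have "(\<lambda>t. complex_of_real (indicator {0..<1} t *\<^sub>R f t)) \<in> borel_measurable lebesgue"
    by measurable
  also have "(\<lambda>t. complex_of_real (indicator {0..<1} t *\<^sub>R f t)) = (\<lambda>t. indicator {0..<1} t *\<^sub>R g t)"
    by (auto simp: g_def indicator_def)
  finally have g_meas: "set_borel_measurable lebesgue {0..<1} g" by (simp add: set_borel_measurable_def)
  have "(\<integral>\<^sup>+t\<in>{0..<1}. ennreal (norm (g t) powr p) \<partial>lebesgue) \<le> 1"
    using f(2,3) by (simp add: nn_integral_restrict_space g_def)
  then have "g \<in> Lp_space p {0..<1}" using g_meas by (auto simp: Lp_space_iff intro: le_less_trans)
  then obtain h where "Q \<omega> g = Some h" using bdd by (auto simp: bounded_from_Lp_def bounded_op_def)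
  \<comment> \<open>The dual function is nonnegative, so both operators act on it alike.\<close>
  moreover have "(\<lambda>t. of_real (norm (g t))) = g" using f(2) by (auto simp: g_def)
  ultimately have "H_op \<omega> g = Some h" by (simp add: H_op_or_H_tilde_op[OF Q] split: if_splits)
  then have "set_integrable lebesgue {0..<1} (\<lambda>t. g t * of_real (\<omega> t))" by (rule H_op_Some_imp_integrable[OF \<omega>])
  then have "(\<integral>\<^sup>+t. ennreal (norm (indicator {0..<1} t *\<^sub>R (g t * of_real (\<omega> t)))) \<partial>lebesgue) < top"
    by (simp add: set_integrable_def integrable_iff_bounded)
  also have "(\<integral>\<^sup>+t. ennreal (norm (indicator {0..<1} t *\<^sub>R (g t * of_real (\<omega> t)))) \<partial>lebesgue) = (\<integral>\<^sup>+t\<in>{0..<1}. ennreal (f t * \<omega> t) \<partial>lebesgue)"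
    using f(2) \<omega> by (intro nn_integral_cong) (auto simp: g_def indicator_def norm_mult radial_weight_def)
  also have "\<dots> = top" using f(4) by (simp add: nn_integral_restrict_space)
  finally show False by simp
qed

text \<open>After this the choice of \<open>Q\<close> is forgotten: the conclusion is about
  \<open>H_fun \<nu>\<close> on the whole unit ball, whichever operator was assumed bounded.\<close>

lemma bounded_from_Lp_imp_H_fun_bound:
  assumes p: "p > 1" "q > 1" "1 / p + 1 / q = 1" and \<nu>: "radial_weight \<nu>" and Q: "Q \<in> {H_op, H_tilde_op}"
    and N: "norm_power p N V" and V: "quasilinear_power p V"
    and \<nu>q: "(\<integral>\<^sup>+t\<in>{0..<1}. ennreal (\<nu> t powr q) \<partial>lebesgue) < top"
    and bdd: "bounded_from_Lp p (Q \<nu>) N"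
  shows "\<exists>B. \<forall>g. set_borel_measurable lebesgue {0..<1} g \<longrightarrow> (\<integral>\<^sup>+t\<in>{0..<1}. ennreal (norm (g t) powr p) \<partial>lebesgue) \<le> 1
     \<longrightarrow> V (H_fun \<nu> g) \<le> ennreal B"
proof -
  define b where "b = enn2real (\<integral>\<^sup>+t\<in>{0..<1}. ennreal (\<nu> t powr q) \<partial>lebesgue)"
  have b: "b \<ge> 0" "(\<integral>\<^sup>+t\<in>{0..<1}. ennreal (\<nu> t powr q) \<partial>lebesgue) = ennreal b"
    using \<nu>q by (simp_all add: b_def)
  have \<nu>_meas: "set_borel_measurable lebesgue {0..<1} \<nu>"
    using measurable_weight_on_unit[OF \<nu>] by (simp add: set_borel_measurable_def)
  let ?ok = "\<lambda>g::real \<Rightarrow> complex. set_borel_measurable lebesgue {0..<1} g \<and> (\<integral>\<^sup>+t\<in>{0..<1}. ennreal (norm (g t) powr p) \<partial>lebesgue) \<le> 1"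
  have int: "set_integrable lebesgue {0..<1} (\<lambda>t. g t * of_real (\<nu> t))" if "?ok g" for g
    by (rule Young_integrable(1)[OF p _ \<nu>_meas, where a = 1 and b = b]) (use that \<nu> b in \<open>auto simp: radial_weight_def\<close>)
  define S where "S = (SUP f\<in>{f \<in> Lp_space p {0..<1}. Lp_norm p {0..<1} f \<le> 1}. N (the (Q \<nu> f)))"
  have S: "S < top" using bdd by (simp add: S_def bounded_from_Lp_def bounded_op_def)
  define B0 where "B0 = enn2real S powr p"
  \<comment> \<open>For \<open>H_tilde_op\<close> the hypothesis reaches
    \<open>H_fun \<nu> g\<close> only when \<open>g\<close> equals its absolute value.\<close>
  have pos: "V (H_fun \<nu> g) \<le> ennreal B0" if g: "?ok g" and nonneg: "Q = H_op \<or> (\<lambda>t. of_real (norm (g t))) = g" for g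
  proof -
    have mem: "g \<in> Lp_space p {0..<1}" "Lp_norm p {0..<1} g \<le> 1"
      using g p by (auto simp: Lp_space_iff Lp_norm_le_1_iff intro: le_less_trans)
    have Qg: "Q \<nu> g = Some (H_fun \<nu> g)"
      using nonneg H_op_eq_Some[OF \<nu> int[OF g]] by (auto simp: H_op_or_H_tilde_op[OF Q])
    have "N (the (Q \<nu> g)) \<le> S" unfolding S_def using mem by (intro SUP_upper) auto
    then have "N (H_fun \<nu> g) \<le> ennreal (enn2real S)" using S by (simp add: Qg)
    then show ?thesis
      using N H_fun_holomorphic[OF \<nu> int[OF g]] by (simp add: norm_power_def B0_def)
  qed
  show ?thesis
  proof (intro exI allI impI)
    fix g :: "real \<Rightarrow> complex"
    assume g: "set_borel_measurable lebesgue {0..<1} g" "(\<integral>\<^sup>+t\<in>{0..<1}. ennreal (norm (g t) powr p) \<partial>lebesgue) \<le> 1"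
    define G where "G t = indicator {0..<1} t *\<^sub>R g t" for t
    have [measurable]: "G \<in> borel_measurable lebesgue" using g by (simp add: set_borel_measurable_def G_def[abs_def])
    have part: "?ok (\<lambda>t. of_real (\<phi> (g t)))" "(\<lambda>t. complex_of_real (norm (complex_of_real (\<phi> (g t))))) = (\<lambda>t. of_real (\<phi> (g t)))"
      if [measurable]: "\<phi> \<in> borel_measurable borel" and 0: "\<And>z. 0 \<le> \<phi> z" and le: "\<And>z. \<phi> z \<le> norm z" for \<phi> :: "complex \<Rightarrow> real"
    proof -
      have "(\<lambda>t. complex_of_real (\<phi> (G t))) \<in> borel_measurable lebesgue" by measurable
      also have "(\<lambda>t. complex_of_real (\<phi> (G t))) = (\<lambda>t. indicator {0..<1} t *\<^sub>R of_real (\<phi> (g t)))"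
        using 0[of 0] le[of 0] by (auto simp: G_def indicator_def)
      finally have "set_borel_measurable lebesgue {0..<1} (\<lambda>t. complex_of_real (\<phi> (g t)))" by (simp add: set_borel_measurable_def)
      moreover have "(\<integral>\<^sup>+t\<in>{0..<1}. ennreal (norm (complex_of_real (\<phi> (g t))) powr p) \<partial>lebesgue) \<le> (\<integral>\<^sup>+t\<in>{0..<1}. ennreal (norm (g t) powr p) \<partial>lebesgue)"
        using 0 le p by (intro nn_integral_mono mult_right_mono ennreal_leI powr_mono2) auto
      ultimately show "?ok (\<lambda>t. of_real (\<phi> (g t)))" using g(2) by auto
      show "(\<lambda>t. complex_of_real (norm (complex_of_real (\<phi> (g t))))) = (\<lambda>t. of_real (\<phi> (g t)))" using 0 by simp
    qed
    \<comment> \<open>The sublinear operator only sees \<open>norm \<circ> g\<close>, so \<open>g\<close> is split into four nonnegative parts.\<close>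
    define g1 g2 g3 g4 where "g1 t = complex_of_real (max 0 (Re (g t)))" and "g2 t = complex_of_real (max 0 (- Re (g t)))"
      and "g3 t = complex_of_real (max 0 (Im (g t)))" and "g4 t = complex_of_real (max 0 (- Im (g t)))" for t
    have ok: "?ok g1" "?ok g2" "?ok g3" "?ok g4"
      and nonneg: "(\<lambda>t. of_real (norm (g1 t))) = g1" "(\<lambda>t. of_real (norm (g2 t))) = g2" "(\<lambda>t. of_real (norm (g3 t))) = g3" "(\<lambda>t. of_real (norm (g4 t))) = g4"
      unfolding g1_def[abs_def] g2_def[abs_def] g3_def[abs_def] g4_def[abs_def]
      using part[of "\<lambda>z. max 0 (Re z)"] part[of "\<lambda>z. max 0 (- Re z)"] part[of "\<lambda>z. max 0 (Im z)"] part[of "\<lambda>z. max 0 (- Im z)"]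
        abs_Re_le_cmod abs_Im_le_cmod by (simp_all add: abs_le_iff)
    let ?R = "\<lambda>t. 1 * g1 t + (-1) * g2 t" and ?I = "\<lambda>t. 1 * g3 t + (-1) * g4 t"
    have R: "?R t = of_real (Re (g t))" and I: "?I t = of_real (Im (g t))" for t
      by (auto simp: g1_def g2_def g3_def g4_def max_def)
    have geq: "g = (\<lambda>t. 1 * ?R t + \<i> * ?I t)" unfolding R I by (auto simp: complex_eq_iff)
    have intR: "set_integrable lebesgue {0..<1} (\<lambda>t. ?R t * of_real (\<nu> t))" "set_integrable lebesgue {0..<1} (\<lambda>t. ?I t * of_real (\<nu> t))"
      using set_integral_diff(1)[OF int[OF ok(1)] int[OF ok(2)]] set_integral_diff(1)[OF int[OF ok(3)] int[OF ok(4)]]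
      by (simp_all add: left_diff_distrib)
    have VR: "V (H_fun \<nu> ?R) \<le> ennreal (2 powr p * (norm (1::complex) powr p * B0 + norm (-1::complex) powr p * B0))"
    proof (rule quasilinear_lincomb[OF V H_fun_holomorphic[OF \<nu> int[OF ok(1)]] H_fun_holomorphic[OF \<nu> int[OF ok(2)]] H_fun_holomorphic[OF \<nu> intR(1)]])
      fix z :: complex assume "z \<in> ball 0 1"
      then show "H_fun \<nu> ?R z = 1 * H_fun \<nu> g1 z + (-1) * H_fun \<nu> g2 z"
        by (intro H_fun_linear \<nu> int ok) simp
    qed (use pos ok nonneg in \<open>auto simp: B0_def\<close>)
    have VI: "V (H_fun \<nu> ?I) \<le> ennreal (2 powr p * (norm (1::complex) powr p * B0 + norm (-1::complex) powr p * B0))"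
    proof (rule quasilinear_lincomb[OF V H_fun_holomorphic[OF \<nu> int[OF ok(3)]] H_fun_holomorphic[OF \<nu> int[OF ok(4)]] H_fun_holomorphic[OF \<nu> intR(2)]])
      fix z :: complex assume "z \<in> ball 0 1"
      then show "H_fun \<nu> ?I z = 1 * H_fun \<nu> g3 z + (-1) * H_fun \<nu> g4 z"
        by (intro H_fun_linear \<nu> int ok) simp
    qed (use pos ok nonneg in \<open>auto simp: B0_def\<close>)
    let ?B = "2 powr p * (norm (1::complex) powr p * B0 + norm (-1::complex) powr p * B0)"
    have B: "?B \<ge> 0" by (simp add: B0_def)
    have holg: "H_fun \<nu> g holomorphic_on ball 0 1" by (rule H_fun_holomorphic[OF \<nu> int]) (use g in auto)
    have eq: "H_fun \<nu> g z = 1 * H_fun \<nu> ?R z + \<i> * H_fun \<nu> ?I z" if "z \<in> ball 0 1" for z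
      using H_fun_linear[OF \<nu> _ intR, of z 1 \<i>] that unfolding geq[symmetric] by simp
    show "V (H_fun \<nu> g) \<le> ennreal (2 powr p * (norm (1::complex) powr p * ?B + norm \<i> powr p * ?B))"
      by (rule quasilinear_lincomb[where f = "H_fun \<nu> ?R" and g = "H_fun \<nu> ?I" and h = "H_fun \<nu> g" and x = 1 and y = \<i> and a = ?B and b = ?B,
            OF V H_fun_holomorphic[OF \<nu> intR(1)] H_fun_holomorphic[OF \<nu> intR(2)] holg eq VR VI B B])
  qed
qed

section \<open>Lower bounds for moments, sums of weights, and the final assembly\<close>

text \<open>\<open>\<sigma> ^ n\<close> is the smallest of the first \<open>n + 1\<close> terms of
  the geometric series.\<close>

lemma Suc_mult_power_le:
  fixes \<sigma> :: real
  assumes "0 \<le> \<sigma>" "\<sigma> < 1"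
  shows "(real n + 1) * \<sigma> ^ n \<le> 1 / (1 - \<sigma>)"
proof -
  have "(\<Sum>i<Suc n. \<sigma> ^ n) \<le> (\<Sum>i<Suc n. \<sigma> ^ i)"
    using assms by (intro sum_mono power_decreasing) auto
  then have "(real n + 1) * \<sigma> ^ n \<le> (\<Sum>i<Suc n. \<sigma> ^ i)" by (simp add: algebra_simps)
  also have "\<dots> = (1 - \<sigma> ^ Suc n) / (1 - \<sigma>)"
    using one_diff_power_eq[of \<sigma> "Suc n"] assms by (simp add: field_simps)
  also have "\<dots> \<le> 1 / (1 - \<sigma>)" using assms by (intro divide_right_mono) auto
  finally show ?thesis .
qed

lemma power_le_odd_moment:
  assumes \<nu>: "radial_weight \<nu>" and \<rho>: "0 < \<rho>" "\<rho> < 1"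
  shows "\<exists>K. \<forall>n. \<rho> ^ n \<le> K * (min (odd_moment \<nu> n) ((odd_moment \<nu> n)\<^sup>2) / (real n + 1) ^ 3)"
proof -
  \<comment> \<open>Of the eight factors \<open>\<sigma> ^ n\<close> in \<open>\<rho> ^ n\<close>,
    four pay for the square of the moment, which is at least a constant times
    \<open>\<sigma> ^ (4 * n)\<close>. Three absorb the cube of \<open>n + 1\<close>, and one is
    spare.\<close>
  define \<sigma> where "\<sigma> = root 8 \<rho>"
  have \<sigma>: "0 < \<sigma>" "\<sigma> < 1" "\<sigma> ^ 8 = \<rho>" using \<rho> by (auto simp: \<sigma>_def)
  define T where "T = weight_tail \<nu> \<sigma>"
  have T: "T > 0" using \<nu> \<sigma> by (auto simp: T_def radial_weight_def)
  have mT: "min T (T\<^sup>2) > 0" using T by simp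
  have "\<rho> ^ n \<le> (1 / ((1 - \<sigma>) ^ 3 * \<sigma>\<^sup>2 * min T (T\<^sup>2))) * (min (odd_moment \<nu> n) ((odd_moment \<nu> n)\<^sup>2) / (real n + 1) ^ 3)" for n
  proof -
    let ?\<mu> = "odd_moment \<nu> n"
    have \<mu>: "\<sigma> ^ (2 * n + 1) * T \<le> ?\<mu>" unfolding T_def by (rule odd_moment_ge[OF \<nu> \<sigma>(1,2)])
    have a: "\<sigma> ^ (4 * n + 2) * min T (T\<^sup>2) \<le> ?\<mu>"
    proof -
      have "\<sigma> ^ (4 * n + 2) * min T (T\<^sup>2) \<le> \<sigma> ^ (2 * n + 1) * T"
        using \<sigma> T by (intro mult_mono power_decreasing) auto
      then show ?thesis using \<mu> by linarith
    qed
    have b: "\<sigma> ^ (4 * n + 2) * min T (T\<^sup>2) \<le> ?\<mu>\<^sup>2"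
    proof -
      have "\<sigma> ^ (4 * n + 2) * min T (T\<^sup>2) \<le> \<sigma> ^ (4 * n + 2) * T\<^sup>2"
        using \<sigma> by (intro mult_left_mono) auto
      also have "\<dots> = (\<sigma> ^ (2 * n + 1) * T)\<^sup>2"
      proof -
        have "4 * n + 2 = (2 * n + 1) * 2" by simp
        then show ?thesis by (simp only: power_mult power_mult_distrib)
      qed
      also have "\<dots> \<le> ?\<mu>\<^sup>2" using \<mu> \<sigma> T by (intro power_mono) auto
      finally show ?thesis .
    qed
    have c: "\<sigma> ^ (4 * n) * \<sigma>\<^sup>2 * min T (T\<^sup>2) \<le> min ?\<mu> (?\<mu>\<^sup>2)"
      unfolding power_add[symmetric] using a b by (rule min.boundedI)
    have "(real n + 1) ^ 3 * \<rho> ^ n = ((real n + 1) * \<sigma> ^ n) ^ 3 * \<sigma> ^ n * \<sigma> ^ (4 * n)"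
    proof -
      have "\<rho> ^ n = \<sigma> ^ (8 * n)" using \<sigma>(3) by (simp add: power_mult)
      also have "\<dots> = (\<sigma> ^ n) ^ 3 * \<sigma> ^ n * \<sigma> ^ (4 * n)"
        by (simp add: power_mult[symmetric] power_add[symmetric] mult.commute)
      finally show ?thesis by (simp add: power_mult_distrib mult_ac)
    qed
    also have "\<dots> \<le> (1 / (1 - \<sigma>)) ^ 3 * 1 * \<sigma> ^ (4 * n)"
      using \<sigma> Suc_mult_power_le[of \<sigma> n] by (intro mult_mono power_mono power_le_one) auto
    finally have d: "(real n + 1) ^ 3 * \<rho> ^ n \<le> \<sigma> ^ (4 * n) / (1 - \<sigma>) ^ 3" by (simp add: power_divide)
    have "\<sigma> ^ (4 * n) \<le> min ?\<mu> (?\<mu>\<^sup>2) / (\<sigma>\<^sup>2 * min T (T\<^sup>2))"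
      using c mT \<sigma> by (simp only: pos_le_divide_eq mult_pos_pos zero_less_power mult.assoc)
    then have "\<sigma> ^ (4 * n) / (1 - \<sigma>) ^ 3 \<le> min ?\<mu> (?\<mu>\<^sup>2) / (\<sigma>\<^sup>2 * min T (T\<^sup>2)) / (1 - \<sigma>) ^ 3"
      using \<sigma> by (intro divide_right_mono) auto
    with d have "\<rho> ^ n * (real n + 1) ^ 3 \<le> min ?\<mu> (?\<mu>\<^sup>2) / (\<sigma>\<^sup>2 * min T (T\<^sup>2)) / (1 - \<sigma>) ^ 3"
      by (simp only: mult.commute)
    then have "\<rho> ^ n \<le> min ?\<mu> (?\<mu>\<^sup>2) / (\<sigma>\<^sup>2 * min T (T\<^sup>2)) / (1 - \<sigma>) ^ 3 / (real n + 1) ^ 3"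
      by (subst pos_le_divide_eq) auto
    then show ?thesis by (simp add: mult_ac)
  qed
  then show ?thesis by blast
qed

text \<open>The tail of \<open>\<eta>\<close> lies between 0 and that of \<open>\<nu>\<close>, so
  the tail of the sum is at least the tail of \<open>\<nu>\<close> and at most twice it.\<close>

lemma radial_weight_add:
  assumes \<nu>: "radial_weight \<nu>" and \<eta>: "\<eta> \<in> borel_measurable borel" "\<And>t. \<eta> t \<ge> 0"
    and tail: "\<And>r. 0 \<le> r \<Longrightarrow> r < 1 \<Longrightarrow> (\<integral>\<^sup>+t\<in>{r..<1}. ennreal (\<eta> t) \<partial>lborel) \<le> ennreal (weight_tail \<nu> r)"
  shows "radial_weight (\<lambda>t. \<nu> t + \<eta> t)"
    and "asymp_equiv_on {0..<1} (weight_tail (\<lambda>t. \<nu> t + \<eta> t)) (weight_tail \<nu>)"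
proof -
  have \<nu>_int: "set_integrable lebesgue {r..<1} \<nu>" if "0 \<le> r" for r
    by (rule set_integrable_subset[of _ "{0..<1}"]) (use \<nu> that in \<open>auto simp: radial_weight_def\<close>)
  have \<nu>_pos: "weight_tail \<nu> r > 0" if "0 \<le> r" "r < 1" for r using \<nu> that by (simp add: radial_weight_def)
  have \<eta>_meas: "set_borel_measurable lebesgue {r..<1} \<eta>" for r
    unfolding set_borel_measurable_def using \<eta>(1) by (intro borel_measurable_lebesgueI) measurable
  have \<eta>_le: "(\<integral>\<^sup>+t\<in>{r..<1}. ennreal (norm (\<eta> t)) \<partial>lebesgue) \<le> ennreal (weight_tail \<nu> r)" if "0 \<le> r" "r < 1" for r
    using tail[OF that] \<eta>(2) by (simp add: nn_integral_completion)
  have \<eta>_int: "set_integrable lebesgue {r..<1} \<eta>" and \<eta>_tail: "weight_tail \<eta> r \<le> weight_tail \<nu> r" if "0 \<le> r" "r < 1" for r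
    using set_integrable_norm_integral_le[OF \<eta>_meas \<eta>_le[OF that] less_imp_le[OF \<nu>_pos[OF that]]] by (auto simp: weight_tail_def)
  have \<eta>0: "weight_tail \<eta> r \<ge> 0" for r
    unfolding weight_tail_def set_lebesgue_integral_def using \<eta>(2) by (intro integral_nonneg_AE) (auto simp: indicator_def)
  have sum: "weight_tail (\<lambda>t. \<nu> t + \<eta> t) r = weight_tail \<nu> r + weight_tail \<eta> r" if "0 \<le> r" "r < 1" for r
    using set_integral_add(2)[OF \<nu>_int \<eta>_int] that by (simp add: weight_tail_def)
  show "radial_weight (\<lambda>t. \<nu> t + \<eta> t)"
    unfolding radial_weight_def
  proof (intro conjI ballI)
    show "set_integrable lebesgue {0..<1} (\<lambda>t. \<nu> t + \<eta> t)"
      using set_integral_add(1)[OF \<nu>_int \<eta>_int] by simp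
  next
    fix r :: real assume "r \<in> {0..<1}"
    then show "0 \<le> \<nu> r + \<eta> r" "0 < weight_tail (\<lambda>t. \<nu> t + \<eta> t) r"
      using \<nu> \<eta>(2)[of r] \<nu>_pos[of r] \<eta>0[of r] by (auto simp: sum radial_weight_def intro: add_pos_nonneg)
  qed
  show "asymp_equiv_on {0..<1} (weight_tail (\<lambda>t. \<nu> t + \<eta> t)) (weight_tail \<nu>)"
    unfolding asymp_equiv_on_def
  proof (intro exI[of _ 2] conjI ballI)
    fix r :: real assume r: "r \<in> {0..<1}"
    then show "inverse 2 * weight_tail \<nu> r \<le> weight_tail (\<lambda>t. \<nu> t + \<eta> t) r" "weight_tail (\<lambda>t. \<nu> t + \<eta> t) r \<le> 2 * weight_tail \<nu> r"
      using \<nu>_pos[of r] \<eta>0[of r] \<eta>_tail[of r] by (auto simp: sum)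
  qed simp
qed

lemma weight_tail_antimono:
  assumes \<nu>: "radial_weight \<nu>" and "0 \<le> r" "r \<le> s" "s < 1"
  shows "weight_tail \<nu> s \<le> weight_tail \<nu> r"
proof -
  have int: "set_integrable lebesgue {r..<1} \<nu>" if "0 \<le> r" for r
    by (rule set_integrable_subset[of _ "{0..<1}"]) (use \<nu> that in \<open>auto simp: radial_weight_def\<close>)
  show ?thesis unfolding weight_tail_def set_lebesgue_integral_def
    using assms int[of r] int[of s] by (intro integral_mono) (auto simp: set_integrable_def indicator_def radial_weight_def)
qed

text \<open>The embedding and the growth estimate turn a bound on \<open>NX f\<close> into the two
  size conditions of \<open>bound\<close>. Both depend on the modulus of \<open>f\<close> alone, so
  the same argument serves both operators.\<close>

lemma bounded_from_analyticI:
  assumes p: "p > 1" and NX: "norm_power p NX VX" and VX: "radial_embedding p VX" "radial_growth p VX"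
    and NY: "norm_power p NY VY" and \<omega>: "radial_weight \<omega>" and T: "T \<in> {H_op, H_tilde_op}"
    and bound: "\<And>A. A > 0 \<Longrightarrow> \<exists>B. \<forall>g. set_borel_measurable lebesgue {0..<1} g \<longrightarrow> (\<forall>t\<in>{0..<1}. norm (g t) \<le> A * (1 - t) powr (-2)) \<longrightarrow>
     (\<integral>\<^sup>+t\<in>{0..<1}. ennreal (norm (g t) powr p) \<partial>lebesgue) \<le> ennreal (A powr p) \<longrightarrow>
     set_integrable lebesgue {0..<1} (\<lambda>t. g t * of_real (\<omega> t)) \<and> VY (H_fun \<omega> g) \<le> ennreal B"
  shows "bounded_from_analytic NX (T \<omega>) NY"
proof -
  obtain C1 where C1: "C1 \<ge> 0" "\<And>f. f holomorphic_on ball 0 1 \<Longrightarrow> (\<integral>\<^sup>+t\<in>{0..<1}. ennreal (norm (f (of_real t)) powr p) \<partial>lborel) \<le> ennreal C1 * VX f"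
    using VX(1) unfolding radial_embedding_def by blast
  obtain C2 where C2: "C2 \<ge> 0" "\<And>f t. f holomorphic_on ball 0 1 \<Longrightarrow> t \<in> {0..<1} \<Longrightarrow>
      ennreal (norm (f (of_real t)) powr p) \<le> ennreal (C2 * (1 - t) powr (- 2 * p)) * VX f"
    using VX(2) unfolding radial_growth_def by blast
  \<comment> \<open>Stated for every level \<open>c\<close>, since the operator must map all of the
    space and not just its unit ball; this takes the place of scaling in \<open>NX\<close>.\<close>
  have key: "\<exists>B\<ge>0. \<forall>f\<in>analytic_space NX. NX f \<le> ennreal c \<longrightarrow>
      (\<exists>h. T \<omega> (\<lambda>t. f (of_real t)) = Some h \<and> h holomorphic_on ball 0 1 \<and> NY h \<le> ennreal B)" if c: "c \<ge> 0" for c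
  proof -
    \<comment> \<open>One constant for both conditions: \<open>A powr p\<close> dominates
      \<open>C1 * c powr p\<close> and \<open>C2 * c powr p\<close>, and the added ones keep
      \<open>A\<close> positive.\<close>
    define A where "A = (C1 + C2 + 1) powr (1 / p) * (c + 1)"
    have A: "A > 0" using C1(1) C2(1) c by (simp add: A_def)
    have Ap: "A powr p = (C1 + C2 + 1) * (c + 1) powr p"
      using C1(1) C2(1) c p by (simp add: A_def powr_mult powr_powr)
    have cp: "c powr p \<le> (c + 1) powr p" using c p by (intro powr_mono2) auto
    obtain B where B: "\<And>g. set_borel_measurable lebesgue {0..<1} g \<Longrightarrow> (\<And>t. t\<in>{0..<1} \<Longrightarrow> norm (g t) \<le> A * (1 - t) powr (-2)) \<Longrightarrow>
     (\<integral>\<^sup>+t\<in>{0..<1}. ennreal (norm (g t) powr p) \<partial>lebesgue) \<le> ennreal (A powr p) \<Longrightarrow>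
     set_integrable lebesgue {0..<1} (\<lambda>t. g t * of_real (\<omega> t)) \<and> VY (H_fun \<omega> g) \<le> ennreal B"
      using bound[OF A] by blast
    show ?thesis
    proof (intro exI[of _ "(max 0 B) powr (1 / p)"] conjI ballI impI)
      fix f assume "f \<in> analytic_space NX" and Nf: "NX f \<le> ennreal c"
      then have hol: "f holomorphic_on ball 0 1" by (simp add: analytic_space_def)
      have Vf: "VX f \<le> ennreal (c powr p)" using NX hol c Nf by (simp add: norm_power_def)
      define g where "g = (if T = H_op then (\<lambda>t. f (of_real t)) else (\<lambda>t. of_real (norm (f (of_real t)))))"
      have ng: "norm (g t) = norm (f (of_real t))" for t by (simp add: g_def)
      have "(\<lambda>t. indicator {0..<1} t *\<^sub>R g t) \<in> borel_measurable borel"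
      proof (cases "T = H_op")
        case True then show ?thesis using measurable_radial[OF hol] by (simp add: g_def)
      next
        case False
        have "(\<lambda>t. complex_of_real (norm (indicator {0..<1} t *\<^sub>R f (of_real t)))) \<in> borel_measurable borel"
          by (rule measurable_compose[OF measurable_compose[OF measurable_radial[OF hol] borel_measurable_norm] borel_measurable_of_real])
        also have "(\<lambda>t. complex_of_real (norm (indicator {0..<1} t *\<^sub>R f (of_real t)))) = (\<lambda>t. indicator {0..<1} t *\<^sub>R g t)"
          using False by (auto simp: g_def indicator_def)
        finally show ?thesis .
      qed
      then have meas: "set_borel_measurable lebesgue {0..<1} g"
        unfolding set_borel_measurable_def by (rule borel_measurable_lebesgueI)
      have growth: "norm (g t) \<le> A * (1 - t) powr (-2)" if t: "t \<in> {0..<1}" for t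
      proof -
        have "ennreal (norm (g t) powr p) \<le> ennreal (C2 * (1 - t) powr (- 2 * p)) * VX f"
          unfolding ng by (rule C2(2)[OF hol t])
        also have "\<dots> \<le> ennreal (C2 * (1 - t) powr (- 2 * p)) * ennreal (c powr p)"
          by (intro mult_left_mono Vf) simp
        also have "\<dots> = ennreal (C2 * (1 - t) powr (- 2 * p) * c powr p)"
          using C2(1) by (simp add: ennreal_mult)
        finally have "norm (g t) powr p \<le> C2 * (1 - t) powr (- 2 * p) * c powr p"
          using C2(1) by (simp add: ennreal_le_iff)
        also have "\<dots> = (C2 * c powr p) * (1 - t) powr (- 2 * p)" by simp
        also have "\<dots> \<le> A powr p * (1 - t) powr (- 2 * p)"
          unfolding Ap using C1(1) C2(1) c cp by (intro mult_right_mono mult_mono) auto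
        also have "\<dots> = (A * (1 - t) powr (-2)) powr p" by (simp add: powr_mult powr_powr)
        finally have "(norm (g t) powr p) powr (1 / p) \<le> ((A * (1 - t) powr (-2)) powr p) powr (1 / p)"
          by (rule powr_mono2[rotated 2]) (use p in auto)
        moreover have inv: "(x powr p) powr (1 / p) = x" if "x \<ge> 0" for x :: real
          using p that by (simp add: powr_powr)
        have "A * (1 - t) powr (-2) \<ge> 0" using A by simp
        ultimately show ?thesis by (simp only: inv norm_ge_zero)
      qed
      have "(\<integral>\<^sup>+t\<in>{0..<1}. ennreal (norm (g t) powr p) \<partial>lebesgue) \<le> ennreal C1 * VX f"
        using C1(2)[OF hol] by (simp add: ng nn_integral_completion)
      also have "\<dots> \<le> ennreal C1 * ennreal (c powr p)" by (intro mult_left_mono Vf) simp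
      also have "\<dots> = ennreal (C1 * c powr p)" using C1(1) by (simp add: ennreal_mult)
      also have "\<dots> \<le> ennreal (A powr p)"
        unfolding Ap using C1(1) C2(1) cp by (intro ennreal_leI mult_mono) auto
      finally have Bg: "set_integrable lebesgue {0..<1} (\<lambda>t. g t * of_real (\<omega> t))" "VY (H_fun \<omega> g) \<le> ennreal B"
        using B[OF meas growth] by auto
      have holg: "H_fun \<omega> g holomorphic_on ball 0 1" by (rule H_fun_holomorphic[OF \<omega> Bg(1)])
      have "VY (H_fun \<omega> g) \<le> ennreal (((max 0 B) powr (1 / p)) powr p)"
        using Bg(2) p by (auto simp: powr_powr intro: order_trans ennreal_leI)
      then have "NY (H_fun \<omega> g) \<le> ennreal ((max 0 B) powr (1 / p))"
        using NY holg by (simp add: norm_power_def)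
      moreover have "T \<omega> (\<lambda>t. f (of_real t)) = Some (H_fun \<omega> g)"
        using H_op_eq_Some[OF \<omega> Bg(1)] by (simp add: H_op_or_H_tilde_op[OF T] g_def split: if_splits)
      ultimately show "\<exists>h. T \<omega> (\<lambda>t. f (of_real t)) = Some h \<and> h holomorphic_on ball 0 1 \<and> NY h \<le> ennreal ((max 0 B) powr (1 / p))"
        using holg by blast
    qed simp
  qed
  show ?thesis
    unfolding bounded_from_analytic_def bounded_op_def
  proof (intro conjI ballI)
    fix f assume f: "f \<in> analytic_space NX"
    then have "NX f < top" by (simp add: analytic_space_def)
    then have "NX f \<le> ennreal (enn2real (NX f))" by simp
    then obtain B h where "T \<omega> (\<lambda>t. f (of_real t)) = Some h" "h holomorphic_on ball 0 1" "NY h \<le> ennreal B"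
      using key[of "enn2real (NX f)"] f by force
    then show "\<exists>g\<in>analytic_space NY. T \<omega> (\<lambda>t. f (of_real t)) = Some g"
      by (auto simp: analytic_space_def intro: le_less_trans)
  next
    obtain B where B: "\<And>f. f \<in> analytic_space NX \<Longrightarrow> NX f \<le> 1 \<Longrightarrow> NY (the (T \<omega> (\<lambda>t. f (of_real t)))) \<le> ennreal B"
      using key[of 1] by force
    have "(SUP f\<in>{f \<in> analytic_space NX. NX f \<le> 1}. NY (the (T \<omega> (\<lambda>t. f (of_real t))))) \<le> ennreal B"
      using B by (intro SUP_least) auto
    then show "(SUP f\<in>{f \<in> analytic_space NX. NX f \<le> 1}. NY (the (T \<omega> (\<lambda>t. f (of_real t))))) < top"
      by (rule le_less_trans) simp
  qed
qed

theorem corollary15: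
  fixes p p' :: real
    and NX NY :: "(complex \<Rightarrow> complex) \<Rightarrow> ennreal"
    and \<nu> :: "real \<Rightarrow> real"
    and Q :: "(real \<Rightarrow> real) \<Rightarrow> (real \<Rightarrow> complex) \<Rightarrow> (complex \<Rightarrow> complex) option"
  assumes "1 < p" and "1 / p + 1 / p' = 1"
    and "NX \<in> {H_inf_norm p, Hardy_norm p, Dirichlet_norm p, HL_norm p}"
    and "NY \<in> {H_inf_norm p, Hardy_norm p, Dirichlet_norm p, HL_norm p}"
    and "radial_weight \<nu>"
    and "Q \<in> {H_op, H_tilde_op}"
    and "bounded_from_Lp p (Q \<nu>) NY"
  shows "\<exists>\<omega>. radial_weight \<omega> \<and>
           asymp_equiv_on {0..<1} (weight_tail \<omega>) (weight_tail \<nu>) \<and>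
           (\<forall>r0\<in>{0<..<1}. \<omega> \<in> Lp_space p' {0..r0}) \<and>
           (\<forall>T\<in>{H_op, H_tilde_op}.
              bounded_from_analytic NX (T \<omega>) NY \<and> \<not> bounded_from_Lp p (T \<omega>) NY)"
proof -
  note \<nu> = \<open>radial_weight \<nu>\<close>
  have q: "p' > 1"
  proof -
    have "1 / p' = 1 - 1 / p" using assms(2) by simp
    then have "0 < 1 / p'" "1 / p' < 1" using assms(1) by auto
    then show ?thesis by (simp add: zero_less_divide_iff)
  qed
  note pq = assms(1) q assms(2)
  obtain VX where VX: "norm_power p NX VX" "radial_embedding p VX" "radial_growth p VX"
    using space_properties[OF assms(1,3)] by metis
  obtain VY where VY: "norm_power p NY VY" "quasilinear_power p VY" "bounded_on_small_series VY"
    using space_properties[OF assms(1,4)] by metis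
  \<comment> \<open>Otherwise \<open>Q \<nu>\<close> would be undefined at some function of
    \<open>L^p\<close>, against the assumption.\<close>
  have \<nu>q: "(\<integral>\<^sup>+t\<in>{0..<1}. ennreal (\<nu> t powr p') \<partial>lebesgue) < top"
    using not_bounded_from_Lp[OF assms(1,2) \<nu> assms(6), of NY] assms(7) by (metis less_top)
  obtain B0 where B0: "\<And>g. set_borel_measurable lebesgue {0..<1} g \<Longrightarrow> (\<integral>\<^sup>+t\<in>{0..<1}. ennreal (norm (g t) powr p) \<partial>lebesgue) \<le> 1
      \<Longrightarrow> VY (H_fun \<nu> g) \<le> ennreal B0"
    using bounded_from_Lp_imp_H_fun_bound[OF pq \<nu> assms(6) VY(1,2) \<nu>q assms(7)] by blast
  \<comment> \<open>The minimum serves the two parts of the coefficient comparison; the cube serves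
    membership in the target space.\<close>
  define \<delta> where "\<delta> n = min (odd_moment \<nu> n) ((odd_moment \<nu> n)\<^sup>2) / (real n + 1) ^ 3" for n
  have \<delta>: "0 < \<delta> n" "\<delta> n \<le> odd_moment \<nu> n * (1 / (real n + 1) ^ 3)" "\<delta> n \<le> (odd_moment \<nu> n)\<^sup>2 * (1 / (real n + 1) ^ 3)" for n
    using odd_moment_pos[OF \<nu>, of n] by (auto simp: \<delta>_def intro!: divide_right_mono divide_pos_pos)
  obtain \<eta> where \<eta>: "\<eta> \<in> borel_measurable borel" "\<And>t. \<eta> t \<ge> 0"
    "\<And>n. (\<integral>\<^sup>+t\<in>{0..<1}. ennreal (t ^ n * (1 - t) powr (-2) * \<eta> t) \<partial>lborel) \<le> ennreal (\<delta> n)"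
    "\<And>r. 0 \<le> r \<Longrightarrow> r < 1 \<Longrightarrow> (\<integral>\<^sup>+t\<in>{r..<1}. ennreal (\<eta> t) \<partial>lborel) \<le> ennreal (weight_tail \<nu> r)"
    "\<And>r. 0 \<le> r \<Longrightarrow> r < 1 \<Longrightarrow> \<exists>B. \<forall>t\<in>{0..r}. \<eta> t \<le> B"
    "(\<integral>\<^sup>+t\<in>{0..<1}. ennreal (\<eta> t powr p') \<partial>lborel) = top"
  proof (rule tiny_spike_weight[OF q, of \<delta> "weight_tail \<nu>"])
    show "\<And>\<rho>. 0 < \<rho> \<Longrightarrow> \<rho> < 1 \<Longrightarrow> \<exists>K. \<forall>n. \<rho> ^ n \<le> K * \<delta> n"
      unfolding \<delta>_def by (rule power_le_odd_moment[OF \<nu>])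
    show "\<And>r. 0 \<le> r \<Longrightarrow> r < 1 \<Longrightarrow> weight_tail \<nu> r > 0" using \<nu> by (simp add: radial_weight_def)
    show "\<And>r s. 0 \<le> r \<Longrightarrow> r \<le> s \<Longrightarrow> s < 1 \<Longrightarrow> weight_tail \<nu> s \<le> weight_tail \<nu> r"
      by (rule weight_tail_antimono[OF \<nu>])
  qed (use \<delta> that in blast)+
  define \<omega> where "\<omega> = (\<lambda>t. \<nu> t + \<eta> t)"
  have \<omega>: "radial_weight \<omega>" "asymp_equiv_on {0..<1} (weight_tail \<omega>) (weight_tail \<nu>)"
    unfolding \<omega>_def using radial_weight_add[OF \<nu> \<eta>(1,2,4)] by auto
  have \<nu>0: "0 \<le> \<nu> t" if "t \<in> {0..<1}" for t using \<nu> that by (simp add: radial_weight_def)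
  \<comment> \<open>Here \<open>\<nu>\<close> is in \<open>L^(p')\<close> on all of
    \<open>[0,1)\<close>, and the finitely many spikes meeting \<open>[0,r0]\<close> are
    bounded.\<close>
  have local: "\<omega> \<in> Lp_space p' {0..r0}" if r0: "r0 \<in> {0<..<1}" for r0
    unfolding Lp_space_iff
  proof
    have "set_integrable lebesgue {0..r0} \<omega>"
      by (rule set_integrable_subset[of _ "{0..<1}"]) (use \<omega>(1) r0 in \<open>auto simp: radial_weight_def\<close>)
    then show "set_borel_measurable lebesgue {0..r0} \<omega>"
      by (simp add: set_integrable_def set_borel_measurable_def)
    obtain B where "\<forall>t\<in>{0..r0}. \<eta> t \<le> B" using \<eta>(5)[of r0] r0 by auto
    then have B: "\<And>t. t \<in> {0..r0} \<Longrightarrow> \<eta> t \<le> B" by blast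
    define W where "W t = indicator {0..<1} t *\<^sub>R \<nu> t" for t
    have [measurable]: "W \<in> borel_measurable lebesgue"
      unfolding W_def[abs_def] by (rule measurable_weight_on_unit[OF \<nu>])
    have [measurable]: "{0..r0} \<in> sets lebesgue" by simp
    have "(\<integral>\<^sup>+t\<in>{0..r0}. ennreal (norm (\<omega> t) powr p') \<partial>lebesgue) \<le> (\<integral>\<^sup>+t. ennreal (2 powr p') * (ennreal (W t powr p') + ennreal (B powr p') * indicator {0..r0} t) \<partial>lebesgue)"
    proof (rule nn_integral_mono)
      fix t :: real
      show "ennreal (norm (\<omega> t) powr p') * indicator {0..r0} t \<le> ennreal (2 powr p') * (ennreal (W t powr p') + ennreal (B powr p') * indicator {0..r0} t)"
      proof (cases "t \<in> {0..r0}")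
        case True
        then have "W t = \<nu> t" "0 \<le> \<nu> t" "0 \<le> B" using r0 \<nu>0[of t] B[of t] \<eta>(2)[of t] by (auto simp: W_def)
        then show ?thesis
          using ennreal_powr_add_le[of p' "norm (\<omega> t)" "\<nu> t" B 1] True B[of t] \<eta>(2)[of t] q by (simp add: \<omega>_def)
      qed simp
    qed
    also have "\<dots> = ennreal (2 powr p') * (\<integral>\<^sup>+t. ennreal (W t powr p') + ennreal (B powr p') * indicator {0..r0} t \<partial>lebesgue)"
      by (rule nn_integral_cmult) measurable
    also have "(\<integral>\<^sup>+t. ennreal (W t powr p') + ennreal (B powr p') * indicator {0..r0} t \<partial>lebesgue)
       = (\<integral>\<^sup>+t. ennreal (W t powr p') \<partial>lebesgue) + (\<integral>\<^sup>+t. ennreal (B powr p') * indicator {0..r0} t \<partial>lebesgue)"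
      by (rule nn_integral_add) measurable
    also have "(\<integral>\<^sup>+t. ennreal (B powr p') * indicator {0..r0} t \<partial>lebesgue) = ennreal (B powr p') * emeasure lebesgue {0..r0}"
      by (rule nn_integral_cmult_indicator) simp
    also have "(\<integral>\<^sup>+t. ennreal (W t powr p') \<partial>lebesgue) = (\<integral>\<^sup>+t\<in>{0..<1}. ennreal (\<nu> t powr p') \<partial>lebesgue)"
      using q by (intro nn_integral_cong) (auto simp: W_def indicator_def)
    also have "ennreal (2 powr p') * (\<dots> + ennreal (B powr p') * emeasure lebesgue {0..r0}) < top"
      using \<nu>q r0 by (auto simp: ennreal_mult_less_top)
    finally show "(\<integral>\<^sup>+t\<in>{0..r0}. ennreal (norm (\<omega> t) powr p') \<partial>lebesgue) < top" .
  qed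
  have "(\<integral>\<^sup>+t\<in>{0..<1}. ennreal (\<eta> t powr p') \<partial>lborel) \<le> (\<integral>\<^sup>+t\<in>{0..<1}. ennreal (\<omega> t powr p') \<partial>lebesgue)"
    unfolding nn_integral_completion using q \<eta>(2) \<nu>0
    by (intro nn_integral_mono) (auto simp: \<omega>_def indicator_def intro!: ennreal_leI powr_mono2)
  then have inf: "(\<integral>\<^sup>+t\<in>{0..<1}. ennreal (\<omega> t powr p') \<partial>lebesgue) = top"
    by (simp only: \<eta>(6) top_unique)
  have "bounded_from_analytic NX (T \<omega>) NY" if T: "T \<in> {H_op, H_tilde_op}" for T
  proof (rule bounded_from_analyticI[OF assms(1) VX VY(1) \<omega>(1) T])
    fix A :: real assume A: "A > 0"
    show "\<exists>B. \<forall>g. set_borel_measurable lebesgue {0..<1} g \<longrightarrow> (\<forall>t\<in>{0..<1}. norm (g t) \<le> A * (1 - t) powr (-2)) \<longrightarrow>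
     (\<integral>\<^sup>+t\<in>{0..<1}. ennreal (norm (g t) powr p) \<partial>lebesgue) \<le> ennreal (A powr p) \<longrightarrow>
     set_integrable lebesgue {0..<1} (\<lambda>t. g t * of_real (\<omega> t)) \<and> VY (H_fun \<omega> g) \<le> ennreal B"
      unfolding \<omega>_def
      by (rule perturbed_operator_bounded[OF pq VY(2,3) \<nu> \<omega>(1)[unfolded \<omega>_def] \<nu>q B0 \<eta>(1,2,3) \<delta> A])
  qed
  moreover have "\<not> bounded_from_Lp p (T \<omega>) NY" if "T \<in> {H_op, H_tilde_op}" for T
    by (rule not_bounded_from_Lp[OF assms(1,2) \<omega>(1) that inf])
  ultimately show ?thesis using \<omega> local by blast
qed

end
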